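(* Let $R>0$ and $\kappa\in\mathbb{R}$ with $\kappa>-\frac{1}{R^2}$. Let $(M,g)=(\mathbb{D}_R,g_\kappa)$, where $\mathbb{D}_R=\{(x,y)\in\mathbb{R}^2 : x^2+y^2\le R^2\}$ and $g_\kappa$ is the metric given in polar coordinates $(x,y)=(r\cos\theta,r\sin\theta)$ by $(1+\kappa r^2)^2\,dr^2+r^2\,d\theta^2$. Let $(Z,\mathscr{D})$ be its transport twistor space, identified with $\mathbb{D}_R\times\mathbb{D}$ ($\mathbb{D}$ the closed unit disk in $\mathbb{C}$) through the global coordinates $(z,\nu)$ described in the context. Define $$w(z,\nu):=(z-\bar z\nu^2)\,e^{\frac{\kappa(z\bar z-\bar z^2\nu^2)}{2}},\qquad \xi(z,\nu):=\nu\, e^{\frac{\kappa(z\bar z-\bar z^2\nu^2)}{2}},\qquad (z,\nu)\in\mathbb{D}_R\times\mathbb{D}.$$ Then the map $\beta:=(w,\xi)\colon Z\to\mathbb{C}^2$ has holomorphic blow-down structure.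
   Context: **Transport twistor space.** $\mathbb{D}_R$ carries its standard orientation. $SM=\{(x,v)\in TM: g_x(v,v)=1\}$ is the unit tangent bundle and $Z=BM=\{(x,v)\in TM: g_x(v,v)\le 1\}$ the unit ball bundle; $Z^\circ$ is the interior of $Z$ (points over the interior of $M$ with $g_x(v,v)<1$). The metric and orientation define the rotation by $+90$ degrees $\iota\colon TM\to TM$ and the complex multiplication $\omega\cdot v=\mathrm{Re}(\omega)v+\mathrm{Im}(\omega)\iota v$. Let $X$ be the generator of the geodesic flow on $SM$, $V$ the generator of the circle action $(x,v)\mapsto(x,e^{it}\cdot v)$, and $\eta_\pm=\frac12(X\pm i[X,V])$. The involutive rank-2 complex distribution $\mathscr{D}\subset T_{\mathbb{C}}Z$ is the pushforward under $\mathsf{p}\colon SM\times\mathbb{D}\to Z$, $(x,v,\omega)\mapsto(x,\omega\cdot v)$, of $\mathrm{span}\{\eta_-+\omega^2\eta_+,\ \partial_{\bar\omega}\}$. On $Z^\circ$, $\mathscr{D}$ is the bundle of $(0,1)$-vectors of a complex structure $J$, which makes $Z^\circ$ a complex surface. **Coordinates.** Let $\mathbf{e}_r=\frac{1}{1+\kappa r^2}\partial_r$, $\mathbf{e}_\theta=\frac1r\partial_\theta$. The vector field $\mathbf{e}=\cos\theta\,\mathbf{e}_r-\sin\theta\,\mathbf{e}_\theta$ extends smoothly across the origin to a section of $SM$, and the global chart on $Z$ is $\mathbb{D}_R\times\mathbb{D}\ni(z,\nu)\mapsto(z,\nu\cdot\mathbf{e})\in BM$, where $z=x+iy$. Thus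 $SM=\{|\nu|=1\}$. In these coordinates $\mathscr{D}=\mathbb{C}\partial_{\bar\nu}\oplus\mathbb{C}\,\Xi$ with $$\Xi=\big((2+\kappa z\bar z)\nu^2-\kappa z^2\big)\partial_z+\big(2+\kappa z\bar z-\kappa\nu^2\bar z^2\big)\partial_{\bar z}+\kappa\,(z-\nu^2\bar z)\,(\bar\nu\partial_{\bar\nu}-\nu\partial_\nu).$$ **Boundary structure.** $\partial_+SM$ is the set of $(x,v)\in SM$ with $x\in\partial M$ and $g_x(v,\nu_x)\ge0$, where $\nu_x$ is the inward unit normal. It is parametrized by $z=Re^{i\theta}$, $\nu=e^{i(\theta+\pi+\alpha)}$, $\theta\in\mathbb{R}/2\pi\mathbb{Z}$, $\alpha\in[-\frac\pi2,\frac\pi2]$. The boundary of $M$ is strictly convex and $M$ is non-trapping. The scattering relation $S\colon\partial SM\to\partial SM$ sends an incoming vector to the outgoing vector at the other end of its geodesic and vice versa; it is a smooth involution whose fixed point set is $\partial_0SM=\{(x,v)\in\partial SM: g_x(v,\nu_x)=0\}$. The $C^\infty_\alpha$-structure on $\partial_+SM$ is the smooth structure of manifold with boundary obtained by identifying $\partial_+SM$ with $\partial SM/S$: a function $u$ on (an open subset of) $\partial_+SM$ is $C^\infty_\alpha$-smooth iff its $S$-invariant extension to $\partial SM$ is smooth. A map $\partial_+SM\to\mathbb{C}^2$ is a totally real $C^\infty_\alpha$-embedding if it is a smooth embedding of this manifold with boundary and, at every point, the (real 2-dimensional) image $P$ of its differential satisfies $P\cap iP=\{0\}$. **Hermitian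 forms.** Let $\eta_1,\eta_2$ be the complex one-forms on $Z$ determined by $$\eta_1(\partial_\nu)=\eta_1(\partial_{\bar\nu})=\eta_1(\Xi)=0,\ \ \eta_1(\overline\Xi)=1-|\nu|^4;\qquad \eta_2(\overline\Xi)=\eta_2(\partial_{\bar\nu})=\eta_2(\Xi)=0,\ \ \eta_2(\partial_\nu)=1$$ (determined pointwise on $Z\setminus SM$, where $\Xi,\overline\Xi,\partial_\nu,\partial_{\bar\nu}$ form a frame of $T_{\mathbb{C}}Z$). Let $\Omega_{\mathbb{C}^2}=i(dw\wedge d\bar w+d\xi\wedge d\bar\xi)$ on $\mathbb{C}^2_{w,\xi}$. **Definition.** A smooth map $\beta\colon Z\to\mathbb{C}^2$ has *holomorphic blow-down structure* if: (a) the restriction $\beta|_{\partial_+SM}\colon\partial_+SM\to\mathbb{C}^2$ is a totally real $C^\infty_\alpha$-embedding; (b) the restriction $\beta|_{Z^\circ}$ is a biholomorphism onto its image (with respect to $J$ on $Z^\circ$ and the standard complex structure of $\mathbb{C}^2$); (c) writing $\beta^*\Omega_{\mathbb{C}^2}=i\sum_{j,k=1}^2H_{jk}\,\eta_j\wedge\bar\eta_k$ on $Z\setminus SM$ with $H=(H_{jk})$ a field of Hermitian matrices, there is a constant $c>0$ such that $H-c\,\mathrm{Id}$ is positive semidefinite at every point. *)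

theory Defs
  imports "HOL-Analysis.Analysis"
begin

section \<open>Smooth maps\<close>

primrec Ck_on :: "nat \<Rightarrow> ('a::real_normed_vector \<Rightarrow> 'b::real_normed_vector) \<Rightarrow> 'a set \<Rightarrow> bool" where
  "Ck_on 0 f U \<longleftrightarrow> continuous_on U f"
| "Ck_on (Suc k) f U \<longleftrightarrow> (\<forall>x\<in>U. f differentiable (at x)) \<and>
     (\<forall>v. Ck_on k (\<lambda>x. frechet_derivative f (at x) v) U)"

text \<open>
  On a set that need not be open, smoothness means that near every point there is an
  extension which is smooth on an open set.  For the submanifolds (with boundary
  and corners) below, this is the usual notion.
\<close>

definition smooth_on :: "'a set \<Rightarrow> ('a::real_normed_vector \<Rightarrow> 'b::real_normed_vector) \<Rightarrow> bool" where
  "smooth_on A f \<longleftrightarrow> (\<forall>p\<in>A. \<exists>U F. open U \<and> p \<in> U \<and> (\<forall>k. Ck_on k F U) \<and> (\<forall>x\<in>A \<inter> U. F x = f x))"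

section \<open>Complexification\<close>

text \<open>
  A vector \<open>a \<otimes> 1 + b \<otimes> \<i>\<close> of the complexification of a real vector space is
  written as the pair \<open>(a, b)\<close>.
\<close>

type_synonym 'a cplx = "'a \<times> 'a"

definition cscale :: "complex \<Rightarrow> 'a::real_vector cplx \<Rightarrow> 'a cplx" where
  "cscale c = (\<lambda>(a, b). (Re c *\<^sub>R a - Im c *\<^sub>R b, Re c *\<^sub>R b + Im c *\<^sub>R a))"

definition cconj :: "'a::real_vector cplx \<Rightarrow> 'a cplx" where
  "cconj = (\<lambda>(a, b). (a, - b))"

definition cpush :: "('a \<Rightarrow> 'b) \<Rightarrow> 'a cplx \<Rightarrow> 'b cplx" where
  "cpush A = (\<lambda>(a, b). (A a, A b))"

definition cext :: "('a \<Rightarrow> complex) \<Rightarrow> 'a cplx \<Rightarrow> complex" where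
  "cext A = (\<lambda>(a, b). A a + \<i> * A b)"

section \<open>The Riemannian surface\<close>

text \<open>
  The metric \<open>(1 + \<kappa> r\<^sup>2)\<^sup>2 dr\<^sup>2 + r\<^sup>2 d\<theta>\<^sup>2\<close>, with \<open>dr(u) = (x \<bullet> u) / r\<close> and
  \<open>d\<theta>(u) = Im (cnj x * u) / r\<^sup>2\<close>; tangent vectors are identified with complex numbers
  through the Cartesian coordinates.  The value at the origin is the continuous extension.
  The formula is not restricted to the disk, so that two-sided derivatives can be taken at
  the boundary.
\<close>

definition metric_g :: "real \<Rightarrow> complex \<Rightarrow> complex \<Rightarrow> complex \<Rightarrow> real" where
  "metric_g \<kappa> x u v =
     (if x = 0 then u \<bullet> v
      else (1 + \<kappa> * (norm x)\<^sup>2)\<^sup>2 * ((x \<bullet> u) / norm x) * ((x \<bullet> v) / norm x)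
         + (norm x)\<^sup>2 * (Im (cnj x * u) / (norm x)\<^sup>2) * (Im (cnj x * v) / (norm x)\<^sup>2))"

lemma metric_cartesian:
  "metric_g \<kappa> x u v = u \<bullet> v + (2 * \<kappa> + \<kappa>\<^sup>2 * (norm x)\<^sup>2) * (x \<bullet> u) * (x \<bullet> v)"
proof (cases "x = 0")
  case False
  define n where "n = (norm x)\<^sup>2"
  have n: "n \<noteq> 0" "n = (Re x)\<^sup>2 + (Im x)\<^sup>2" "norm x * norm x = n"
    using False by (simp_all add: n_def cmod_power2[symmetric]) (simp add: power2_eq_square)
  have xu: "(x \<bullet> u) * (x \<bullet> v) + Im (cnj x * u) * Im (cnj x * v) = n * (u \<bullet> v)"
    by (simp add: n(2) inner_complex_def algebra_simps power2_eq_square)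
  have "metric_g \<kappa> x u v = ((1 + \<kappa> * n)\<^sup>2 * ((x \<bullet> u) * (x \<bullet> v)) + Im (cnj x * u) * Im (cnj x * v)) / n"
    using False n(1,3) by (simp add: metric_g_def n_def[symmetric] divide_simps)
  also have "\<dots> = (n * (u \<bullet> v) + (2 * \<kappa> * n + \<kappa>\<^sup>2 * n\<^sup>2) * ((x \<bullet> u) * (x \<bullet> v))) / n"
    unfolding xu[symmetric] by (simp add: algebra_simps power2_eq_square)
  also have "\<dots> = u \<bullet> v + (2 * \<kappa> + \<kappa>\<^sup>2 * n) * (x \<bullet> u) * (x \<bullet> v)"
    using n(1) by (simp add: field_simps power2_eq_square)
  finally show ?thesis by (simp add: n_def)
qed (simp add: metric_g_def)

text \<open>Rotation by \<open>+90\<close> degrees; the last conjunct fixes the orientation.\<close>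

definition rot :: "real \<Rightarrow> complex \<Rightarrow> complex \<Rightarrow> complex" where
  "rot \<kappa> x v = (THE w. metric_g \<kappa> x w v = 0 \<and> metric_g \<kappa> x w w = metric_g \<kappa> x v v \<and> 0 \<le> Im (cnj v * w))"

lemma rot_eq:
  assumes "1 + \<kappa> * (norm x)\<^sup>2 > 0"
  shows "rot \<kappa> x v =
    \<i> * (v + of_real ((2 * \<kappa> + \<kappa>\<^sup>2 * (norm x)\<^sup>2) * (x \<bullet> v)) * x) / of_real (1 + \<kappa> * (norm x)\<^sup>2)"
proof -
  define a b c d where "a = Re x" and "b = Im x" and "c = Re v" and "d = Im v"
  define f l where "f = 2 * \<kappa> + \<kappa>\<^sup>2 * (a\<^sup>2 + b\<^sup>2)" and "l = 1 + \<kappa> * (a\<^sup>2 + b\<^sup>2)"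
  define p q where "p = c + f * (a * c + b * d) * a" and "q = d + f * (a * c + b * d) * b"
  have nx: "(norm x)\<^sup>2 = a\<^sup>2 + b\<^sup>2" by (simp add: cmod_power2 a_def b_def)
  have l: "l > 0" using assms by (simp add: l_def nx)
  have lf: "l\<^sup>2 = 1 + f * (a\<^sup>2 + b\<^sup>2)"
    by (simp add: l_def f_def algebra_simps power2_eq_square)
  have g: "metric_g \<kappa> x w v = Re w * p + Im w * q" for w
    by (simp add: metric_cartesian nx inner_complex_def p_def q_def a_def b_def c_def d_def f_def algebra_simps)
  have gv: "metric_g \<kappa> x v v = c * p + d * q" by (simp add: g c_def d_def)
  have gw: "metric_g \<kappa> x w w = (Re w)\<^sup>2 + (Im w)\<^sup>2 + f * (a * Re w + b * Im w)\<^sup>2" for w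
    unfolding metric_cartesian nx f_def a_def b_def
    by (simp add: inner_complex_def power2_eq_square algebra_simps)
  have gpq: "q\<^sup>2 + p\<^sup>2 + f * (b * p - a * q)\<^sup>2 = l\<^sup>2 * (c * p + d * q)"
    unfolding lf p_def q_def by algebra
  let ?r = "Complex (- q / l) (p / l)"
  have eq: "\<i> * (v + of_real ((2 * \<kappa> + \<kappa>\<^sup>2 * (norm x)\<^sup>2) * (x \<bullet> v)) * x) / of_real (1 + \<kappa> * (norm x)\<^sup>2) = ?r"
    unfolding nx
    by (simp add: complex_eq_iff inner_complex_def l_def p_def q_def f_def a_def b_def c_def d_def
        Re_divide_of_real Im_divide_of_real)
  have pos: "c * p + d * q = c\<^sup>2 + d\<^sup>2 + f * (a * c + b * d)\<^sup>2"
    unfolding p_def q_def by algebra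
  have pos': "c * p + d * q > 0" if "v \<noteq> 0"
  proof -
    have "(c * p + d * q) * (a\<^sup>2 + b\<^sup>2) = (b * c - a * d)\<^sup>2 + (l * (a * c + b * d))\<^sup>2"
      unfolding power_mult_distrib lf p_def q_def by algebra
    hence *: "(c * p + d * q) * (a\<^sup>2 + b\<^sup>2) \<ge> 0" by simp
    show ?thesis
    proof (cases "a\<^sup>2 + b\<^sup>2 = 0")
      case True
      hence "a = 0" "b = 0" by (auto simp: sum_power2_eq_zero_iff)
      moreover have "c \<noteq> 0 \<or> d \<noteq> 0" using that by (auto simp: c_def d_def complex_eq_iff)
      ultimately show ?thesis unfolding pos
        by (auto simp: sum_power2_gt_zero_iff)
    next
      case False
      hence ab: "a\<^sup>2 + b\<^sup>2 > 0" by (simp add: order_less_le)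
      have "(b * c - a * d)\<^sup>2 + (l * (a * c + b * d))\<^sup>2 \<noteq> 0"
      proof
        assume "(b * c - a * d)\<^sup>2 + (l * (a * c + b * d))\<^sup>2 = 0"
        hence "b * c - a * d = 0" "a * c + b * d = 0"
          using l by (auto simp: sum_power2_eq_zero_iff)
        moreover have "(b * c - a * d)\<^sup>2 + (a * c + b * d)\<^sup>2 = (a\<^sup>2 + b\<^sup>2) * (c\<^sup>2 + d\<^sup>2)" by algebra
        ultimately have "(a\<^sup>2 + b\<^sup>2) * (c\<^sup>2 + d\<^sup>2) = 0" by (metis add_0 zero_power2)
        hence "c\<^sup>2 + d\<^sup>2 = 0" using False by (metis mult_eq_0_iff)
        thus False using that by (auto simp: sum_power2_eq_zero_iff c_def d_def complex_eq_iff)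
      qed
      hence "(c * p + d * q) * (a\<^sup>2 + b\<^sup>2) > 0"
        using \<open>(c * p + d * q) * (a\<^sup>2 + b\<^sup>2) = _\<close> * by (simp add: order_less_le)
      thus ?thesis using ab by (simp add: zero_less_mult_iff)
    qed
  qed
  have "rot \<kappa> x v = ?r"
    unfolding rot_def
  proof (rule the_equality, intro conjI)
    show "metric_g \<kappa> x ?r v = 0" by (simp add: g)
    have "metric_g \<kappa> x ?r ?r = (q\<^sup>2 + p\<^sup>2 + f * (b * p - a * q)\<^sup>2) / l\<^sup>2"
      using l unfolding gw by (simp add: field_simps power2_eq_square)
    also have "\<dots> = metric_g \<kappa> x v v" using l by (simp add: gpq gv)
    finally show "metric_g \<kappa> x ?r ?r = metric_g \<kappa> x v v" .
    have "Im (cnj v * ?r) = (c * p + d * q) / l" by (simp add: c_def d_def add_divide_distrib)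
    also have "\<dots> \<ge> 0" using pos' l by (cases "v = 0") (auto simp: less_imp_le c_def d_def)
    finally show "0 \<le> Im (cnj v * ?r)" .
  next
    fix w assume w: "metric_g \<kappa> x w v = 0 \<and> metric_g \<kappa> x w w = metric_g \<kappa> x v v \<and> 0 \<le> Im (cnj v * w)"
    define s t where "s = Re w" and "t = Im w"
    have 1: "s * p + t * q = 0" using w by (simp add: g s_def t_def)
    have 2: "s\<^sup>2 + t\<^sup>2 + f * (a * s + b * t)\<^sup>2 = c * p + d * q"
      using w unfolding gv unfolding gw s_def t_def by simp
    have 3: "0 \<le> c * t - d * s" using w by (simp add: c_def d_def s_def t_def)
    define m where "m = c * t - d * s"
    define N where "N = c * p + d * q"
    have s: "N * s = - m * q" and t: "N * t = m * p" unfolding m_def N_def using 1 by algebra+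
    show "w = ?r"
    proof (cases "v = 0")
      case True
      hence z: "c = 0" "d = 0" "p = 0" "q = 0" by (auto simp: c_def d_def p_def q_def)
      have "w = 0"
      proof (rule ccontr)
        assume "w \<noteq> 0"
        have "(s\<^sup>2 + t\<^sup>2 + f * (a * s + b * t)\<^sup>2) * (a\<^sup>2 + b\<^sup>2) = (b * s - a * t)\<^sup>2 + (l * (a * s + b * t))\<^sup>2"
          unfolding power_mult_distrib lf by algebra
        hence "(b * s - a * t)\<^sup>2 + (l * (a * s + b * t))\<^sup>2 = 0" using 2 z by simp
        hence 4: "b * s - a * t = 0" "a * s + b * t = 0" using l by (auto simp: sum_power2_eq_zero_iff)
        hence "s\<^sup>2 + t\<^sup>2 = 0" using 2 z by simp
        thus False using \<open>w \<noteq> 0\<close> by (auto simp: sum_power2_eq_zero_iff s_def t_def complex_eq_iff)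
      qed
      thus ?thesis using z by (simp add: complex_eq_iff)
    next
      case False
      hence N: "N > 0" using pos' by (simp add: N_def)
      have "N\<^sup>2 * (s\<^sup>2 + t\<^sup>2 + f * (a * s + b * t)\<^sup>2)
          = (N * s)\<^sup>2 + (N * t)\<^sup>2 + f * (a * (N * s) + b * (N * t))\<^sup>2" by algebra
      also have "\<dots> = m\<^sup>2 * (q\<^sup>2 + p\<^sup>2 + f * (b * p - a * q)\<^sup>2)" unfolding s t by algebra
      finally have "N\<^sup>2 * N = m\<^sup>2 * (l\<^sup>2 * N)" by (simp add: 2 gpq N_def[symmetric])
      hence "N\<^sup>2 = (m * l)\<^sup>2" using N by (simp add: power_mult_distrib)
      hence "N = m * l" using N 3 l by (simp add: m_def power2_eq_iff_nonneg)
      moreover from this have "m \<noteq> 0" using N by auto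
      ultimately have "m * (l * s) = m * (- q)" "m * (l * t) = m * p" using s t by (simp_all add: mult_ac)
      hence "l * s = - q" "l * t = p" using \<open>m \<noteq> 0\<close> by (simp_all only: mult_cancel_left simp_thms)
      hence "s = - q / l" "t = p / l" using l by (simp_all add: field_simps)
      thus ?thesis by (simp add: complex_eq_iff s_def t_def)
    qed
  qed
  thus ?thesis by (simp only: eq)
qed

definition cmul :: "real \<Rightarrow> complex \<Rightarrow> complex \<Rightarrow> complex \<Rightarrow> complex" where
  "cmul \<kappa> x \<omega> v = Re \<omega> *\<^sub>R v + Im \<omega> *\<^sub>R rot \<kappa> x v"

text \<open>
  The Levi-Civita connection: \<open>christoffel \<kappa> x v w\<close> has the components
  \<open>\<Gamma>\<^sup>k\<^sub>i\<^sub>j v\<^sup>i w\<^sup>j\<close> in the Cartesian coordinates.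
\<close>

definition christoffel :: "real \<Rightarrow> complex \<Rightarrow> complex \<Rightarrow> complex \<Rightarrow> complex" where
  "christoffel \<kappa> x v w = (THE a. \<forall>u. metric_g \<kappa> x a u =
     (frechet_derivative (\<lambda>y. metric_g \<kappa> y w u) (at x) v
    + frechet_derivative (\<lambda>y. metric_g \<kappa> y v u) (at x) w
    - frechet_derivative (\<lambda>y. metric_g \<kappa> y v w) (at x) u) / 2)"

definition unit_tangent :: "real \<Rightarrow> real \<Rightarrow> (complex \<times> complex) set" where
  "unit_tangent \<kappa> R = {(x, v). norm x \<le> R \<and> metric_g \<kappa> x v v = 1}"

definition unit_ball :: "real \<Rightarrow> real \<Rightarrow> (complex \<times> complex) set" where
  "unit_ball \<kappa> R = {(x, v). norm x \<le> R \<and> metric_g \<kappa> x v v \<le> 1}"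

definition geodesic_field :: "real \<Rightarrow> complex \<times> complex \<Rightarrow> complex \<times> complex" where
  "geodesic_field \<kappa> = (\<lambda>(x, v). (v, - christoffel \<kappa> x v v))"

text \<open>The derivative at \<open>t = 0\<close> of \<open>(x, cmul \<kappa> x (cis t) v)\<close>.\<close>

definition vertical_field :: "real \<Rightarrow> complex \<times> complex \<Rightarrow> complex \<times> complex" where
  "vertical_field \<kappa> = (\<lambda>(x, v). (0, rot \<kappa> x v))"

definition lie_bracket :: "('a::real_normed_vector \<Rightarrow> 'a) \<Rightarrow> ('a \<Rightarrow> 'a) \<Rightarrow> 'a \<Rightarrow> 'a" where
  "lie_bracket X Y p = frechet_derivative Y (at p) (X p) - frechet_derivative X (at p) (Y p)"

section \<open>The transport twistor space\<close>

text \<open>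
  The fields \<open>\<eta>\<^sub>\<plusminus> = (X \<plusminus> \<i> [X, V]) / 2\<close>.  Here \<open>X\<close> and \<open>V\<close> are vector fields on the
  whole tangent bundle that are tangent to the unit tangent bundle, so the bracket restricts.
\<close>

definition eta_plus :: "real \<Rightarrow> complex \<times> complex \<Rightarrow> (complex \<times> complex) cplx" where
  "eta_plus \<kappa> q = cscale (1/2)
     ((geodesic_field \<kappa> q, 0) + cscale \<i> (lie_bracket (geodesic_field \<kappa>) (vertical_field \<kappa>) q, 0))"

definition eta_minus :: "real \<Rightarrow> complex \<times> complex \<Rightarrow> (complex \<times> complex) cplx" where
  "eta_minus \<kappa> q = cscale (1/2)
     ((geodesic_field \<kappa> q, 0) - cscale \<i> (lie_bracket (geodesic_field \<kappa>) (vertical_field \<kappa>) q, 0))"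

definition proj_p :: "real \<Rightarrow> (complex \<times> complex) \<times> complex \<Rightarrow> complex \<times> complex" where
  "proj_p \<kappa> = (\<lambda>((x, v), \<omega>). (x, cmul \<kappa> x \<omega> v))"

definition lift_cplx :: "(complex \<times> complex) cplx \<Rightarrow> ((complex \<times> complex) \<times> complex) cplx" where
  "lift_cplx = cpush (\<lambda>a. (a, 0))"

definition d_omega_bar :: "((complex \<times> complex) \<times> complex) cplx" where
  "d_omega_bar = cscale (1/2) ((((0, 0), 1), 0) + cscale \<i> (((0, 0), \<i>), 0))"

definition transport_distr_TM :: "real \<Rightarrow> real \<Rightarrow> complex \<times> complex \<Rightarrow> (complex \<times> complex) cplx set" where
  "transport_distr_TM \<kappa> R y =
     {cpush (frechet_derivative (proj_p \<kappa>) (at (q, \<omega>)))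
        (cscale a (lift_cplx (eta_minus \<kappa> q + cscale (\<omega>\<^sup>2) (eta_plus \<kappa> q))) + cscale b d_omega_bar)
      | q \<omega> a b. q \<in> unit_tangent \<kappa> R \<and> norm \<omega> \<le> 1 \<and> proj_p \<kappa> (q, \<omega>) = y}"

text \<open>
  The section \<open>e = cos \<theta> e\<^sub>r - sin \<theta> e\<^sub>\<theta>\<close> in the Cartesian frame, where
  \<open>e\<^sub>r = sgn x / (1 + \<kappa> r\<^sup>2)\<close> and \<open>e\<^sub>\<theta> = \<i> * sgn x\<close>; its smooth extension takes the value
  \<open>\<partial>\<^sub>x\<close> at the origin.
\<close>

definition frame_e :: "real \<Rightarrow> complex \<Rightarrow> complex" where
  "frame_e \<kappa> x = (if x = 0 then 1
     else Re (sgn x) *\<^sub>R (sgn x / of_real (1 + \<kappa> * (norm x)\<^sup>2)) - Im (sgn x) *\<^sub>R (\<i> * sgn x))"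

definition chart :: "real \<Rightarrow> complex \<times> complex \<Rightarrow> complex \<times> complex" where
  "chart \<kappa> = (\<lambda>(z, \<nu>). (z, cmul \<kappa> z \<nu> (frame_e \<kappa> z)))"

text \<open>
  From here on, \<open>Z\<close> and its subsets are expressed in the coordinates \<open>(z, \<nu>)\<close>.  The lemmas
  \<open>metric_chart\<close> and \<open>chart_bij\<close> show that they are the corresponding subsets of the tangent bundle.
\<close>

definition Z_space :: "real \<Rightarrow> (complex \<times> complex) set" where
  "Z_space R = cball 0 R \<times> cball 0 1"

definition Z_interior :: "real \<Rightarrow> (complex \<times> complex) set" where
  "Z_interior R = ball 0 R \<times> ball 0 1"

definition SM_coords :: "real \<Rightarrow> (complex \<times> complex) set" where
  "SM_coords R = cball 0 R \<times> sphere 0 1"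

lemma cmul_frame_e:
  assumes "1 + \<kappa> * (norm z)\<^sup>2 > 0"
  shows "cmul \<kappa> z \<nu> (frame_e \<kappa> z) = \<nu> - of_real (\<kappa> * (z \<bullet> \<nu>) / (1 + \<kappa> * (norm z)\<^sup>2)) * z"
proof -
  define l where "l = 1 + \<kappa> * (norm z)\<^sup>2"
  have l: "l > 0" using assms by (simp add: l_def)
  have nz: "(norm z)\<^sup>2 = (Re z)\<^sup>2 + (Im z)\<^sup>2" by (simp add: cmod_power2)
  have e: "frame_e \<kappa> z = 1 - of_real (\<kappa> * Re z / l) * z"
  proof (cases "z = 0")
    case False
    define n c d where "n = norm z" and "c = Re z" and "d = Im z"
    have n: "n > 0" "n\<^sup>2 = c\<^sup>2 + d\<^sup>2" using False by (simp_all add: n_def c_def d_def cmod_power2)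
    have ln: "l = 1 + \<kappa> * n\<^sup>2" by (simp add: l_def n_def)
    have s: "Re (sgn z) = c / n" "Im (sgn z) = d / n" by (simp_all add: n_def c_def d_def)
    have "Re (frame_e \<kappa> z) = (c\<^sup>2 / l + d\<^sup>2) / n\<^sup>2"
      using False by (simp add: frame_e_def l_def[symmetric] s Re_divide_of_real del: Re_sgn Im_sgn)
        (simp add: add_divide_distrib power2_eq_square)
    also have "\<dots> = 1 - \<kappa> * c * c / l"
    proof -
      have "c\<^sup>2 + d\<^sup>2 * l = n\<^sup>2 * (l - \<kappa> * c * c)" unfolding ln n(2) by algebra
      moreover have "(c\<^sup>2 / l + d\<^sup>2) / n\<^sup>2 = (c\<^sup>2 + d\<^sup>2 * l) / n\<^sup>2 / l"
        using l by (simp add: field_simps)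
      ultimately show ?thesis using l n(1) by (simp add: diff_divide_distrib)
    qed
    finally have 1: "Re (frame_e \<kappa> z) = 1 - \<kappa> * c * c / l" .
    have "Im (frame_e \<kappa> z) = (c * d / l - c * d) / n\<^sup>2"
      using False by (simp add: frame_e_def l_def[symmetric] s Im_divide_of_real del: Re_sgn Im_sgn)
        (simp add: diff_divide_distrib power2_eq_square mult_ac)
    also have "\<dots> = - (\<kappa> * c * d / l)"
    proof -
      have "c * d - c * d * l = - (n\<^sup>2 * (\<kappa> * c * d))" unfolding ln by algebra
      moreover have "(c * d / l - c * d) / n\<^sup>2 = (c * d - c * d * l) / n\<^sup>2 / l"
        using l by (simp add: field_simps)
      ultimately show ?thesis using n(1) by simp
    qed
    finally show ?thesis using 1 by (simp add: complex_eq_iff c_def d_def)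
  qed (simp add: frame_e_def)
  have r: "rot \<kappa> z (frame_e \<kappa> z) = \<i> - of_real (\<kappa> * Im z / l) * z"
  proof -
    define c d where "c = Re z" and "d = Im z"
    have ln: "l = 1 + \<kappa> * (c\<^sup>2 + d\<^sup>2)" by (simp add: l_def nz c_def d_def)
    have "z \<bullet> frame_e \<kappa> z = (c * l - \<kappa> * c * (c\<^sup>2 + d\<^sup>2)) / l"
      using l by (simp add: e inner_complex_def c_def d_def field_simps power2_eq_square)
    also have "c * l - \<kappa> * c * (c\<^sup>2 + d\<^sup>2) = c" by (simp add: ln algebra_simps)
    finally have ze: "z \<bullet> frame_e \<kappa> z = c / l" .
    have f: "2 * \<kappa> + \<kappa>\<^sup>2 * (norm z)\<^sup>2 = \<kappa> * (l + 1)"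
      by (simp add: l_def power2_eq_square algebra_simps)
    have "frame_e \<kappa> z + of_real (\<kappa> * (l + 1) * (c / l)) * z = 1 + of_real (\<kappa> * c) * z"
      using l by (simp add: e c_def[symmetric] complex_eq_iff field_simps)
    hence "rot \<kappa> z (frame_e \<kappa> z) = \<i> * (1 + of_real (\<kappa> * c) * z) / of_real l"
      unfolding rot_eq[OF assms] f ze l_def[symmetric] by simp
    also have "\<dots> = \<i> - of_real (\<kappa> * d / l) * z"
      using l ln by (simp add: complex_eq_iff Re_divide_of_real Im_divide_of_real c_def[symmetric] d_def[symmetric]
          field_simps power2_eq_square)
    finally show ?thesis by (simp add: d_def)
  qed
  show ?thesis unfolding cmul_def r unfolding e l_def[symmetric]
    using l by (simp add: complex_eq_iff inner_complex_def field_simps)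
qed

lemma metric_chart:
  assumes "1 + \<kappa> * (norm z)\<^sup>2 > 0" and "chart \<kappa> (z, \<nu>) = (x, v)"
  shows "metric_g \<kappa> x v v = (norm \<nu>)\<^sup>2"
proof -
  define l t where "l = 1 + \<kappa> * (norm z)\<^sup>2" and "t = z \<bullet> \<nu>"
  have l: "l > 0" using assms by (simp add: l_def)
  have x: "x = z" and v: "v = \<nu> - (\<kappa> * t / l) *\<^sub>R z"
    using assms cmul_frame_e[of \<kappa> z \<nu>] by (auto simp: chart_def l_def t_def scaleR_conv_of_real)
  have zv: "z \<bullet> v = t / l"
  proof -
    have "z \<bullet> v = (t * l - \<kappa> * t * (norm z)\<^sup>2) / l"
      using l by (simp add: v inner_diff_right t_def[symmetric] power2_norm_eq_inner field_simps)
    also have "t * l - \<kappa> * t * (norm z)\<^sup>2 = t" by (simp add: l_def algebra_simps)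
    finally show ?thesis .
  qed
  have f: "2 * \<kappa> + \<kappa>\<^sup>2 * (norm z)\<^sup>2 = \<kappa> * (l + 1)"
    by (simp add: l_def power2_eq_square algebra_simps)
  have "v \<bullet> v = \<nu> \<bullet> v - \<kappa> * t / l * (z \<bullet> v)" by (subst v) (simp add: inner_diff_left)
  also have "\<nu> \<bullet> v = (norm \<nu>)\<^sup>2 - \<kappa> * t / l * t"
    by (simp add: v inner_diff_right t_def inner_commute power2_norm_eq_inner)
  finally have "v \<bullet> v = (norm \<nu>)\<^sup>2 - \<kappa> * t / l * t - \<kappa> * t / l * (t / l)" unfolding zv .
  moreover have "\<kappa> * (l + 1) * (t / l) * (t / l) = \<kappa> * t / l * t + \<kappa> * t / l * (t / l)"
    using l by (simp add: field_simps)
  ultimately show ?thesis unfolding x metric_cartesian f zv by simp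
qed

lemma chart_bij:
  assumes "R > 0" "\<kappa> > - 1 / R\<^sup>2"
  shows "bij_betw (chart \<kappa>) (Z_space R) (unit_ball \<kappa> R)"
proof -
  have l: "1 + \<kappa> * (norm z)\<^sup>2 > 0" if "norm z \<le> R" for z :: complex
  proof (cases "\<kappa> \<ge> 0")
    case True
    thus ?thesis by (simp add: add_pos_nonneg)
  next
    case False
    have "(norm z)\<^sup>2 \<le> R\<^sup>2" using that by (simp add: power_mono)
    hence "\<kappa> * R\<^sup>2 \<le> \<kappa> * (norm z)\<^sup>2" using False by (simp add: mult_left_mono_neg)
    moreover have "\<kappa> * R\<^sup>2 > - 1" using assms by (simp add: field_simps)
    ultimately show ?thesis by linarith
  qed
  let ?l = "\<lambda>z. 1 + \<kappa> * (norm z)\<^sup>2"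
  have ch: "chart \<kappa> (z, \<nu>) = (z, \<nu> - (\<kappa> * (z \<bullet> \<nu>) / ?l z) *\<^sub>R z)" if "norm z \<le> R" for z \<nu>
    using cmul_frame_e[OF l[OF that]] by (simp add: chart_def scaleR_conv_of_real)
  define inv where "inv = (\<lambda>(z :: complex, v). (z, v + (\<kappa> * (z \<bullet> v)) *\<^sub>R z))"
  have 1: "inv (chart \<kappa> (z, \<nu>)) = (z, \<nu>)" if "norm z \<le> R" for z \<nu>
  proof -
    have "z \<bullet> \<nu> - \<kappa> * (z \<bullet> \<nu>) / ?l z * (norm z)\<^sup>2 = (z \<bullet> \<nu>) / ?l z"
      using l[OF that] by (simp add: field_simps)
    thus ?thesis by (simp add: ch[OF that] inv_def inner_diff_right power2_norm_eq_inner)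
  qed
  have 2: "chart \<kappa> (inv (z, v)) = (z, v)" if "norm z \<le> R" for z v
  proof -
    have "z \<bullet> (v + (\<kappa> * (z \<bullet> v)) *\<^sub>R z) = (z \<bullet> v) * ?l z"
      by (simp add: inner_add_right power2_norm_eq_inner algebra_simps)
    thus ?thesis using l[OF that] by (simp add: inv_def ch[OF that])
  qed
  show ?thesis
  proof (rule bij_betw_byWitness[where f' = inv])
    show "\<forall>a\<in>Z_space R. inv (chart \<kappa> a) = a" using 1 by (auto simp: Z_space_def)
    show "\<forall>a\<in>unit_ball \<kappa> R. chart \<kappa> (inv a) = a" using 2 by (auto simp: unit_ball_def)
    show "chart \<kappa> ` Z_space R \<subseteq> unit_ball \<kappa> R"
    proof (rule image_subsetI)
      fix p assume p: "p \<in> Z_space R"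
      obtain z \<nu> x v where e: "p = (z, \<nu>)" and a: "chart \<kappa> (z, \<nu>) = (x, v)" by (metis surj_pair)
      have z: "norm z \<le> R" "norm \<nu> \<le> 1" using p e by (auto simp: Z_space_def)
      have "metric_g \<kappa> x v v = (norm \<nu>)\<^sup>2" by (rule metric_chart[OF l[OF z(1)] a])
      moreover have "x = z" using a by (simp add: chart_def)
      ultimately show "chart \<kappa> p \<in> unit_ball \<kappa> R" unfolding e a using z by (simp add: unit_ball_def power_le_one)
    qed
    show "inv ` unit_ball \<kappa> R \<subseteq> Z_space R"
    proof (rule image_subsetI)
      fix p assume p: "p \<in> unit_ball \<kappa> R"
      obtain z v y \<nu> where e: "p = (z, v)" and a: "inv (z, v) = (y, \<nu>)" by (metis surj_pair)
      have z: "norm z \<le> R" "metric_g \<kappa> z v v \<le> 1" using p e by (auto simp: unit_ball_def)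
      have y: "y = z" using a by (simp add: inv_def)
      have "chart \<kappa> (z, \<nu>) = (z, v)" using 2[OF z(1), of v] a y by simp
      hence "(norm \<nu>)\<^sup>2 \<le> 1" using metric_chart[OF l[OF z(1)]] z(2) by metis
      hence "norm \<nu> \<le> 1" by (simp add: power_le_one_iff abs_square_le_1)
      thus "inv p \<in> Z_space R" unfolding e a using z(1) y by (simp add: Z_space_def)
    qed
  qed
qed

definition transport_distr :: "real \<Rightarrow> real \<Rightarrow> complex \<times> complex \<Rightarrow> (complex \<times> complex) cplx set" where
  "transport_distr \<kappa> R p =
     {L. cpush (frechet_derivative (chart \<kappa>) (at p)) L \<in> transport_distr_TM \<kappa> R (chart \<kappa> p)}"

text \<open>
  The complex structure whose \<open>(0,1)\<close>-vectors, i.e. the eigenvectors for the eigenvalue \<open>-\<i>\<close>,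
  form the distribution.
\<close>

definition cplx_struct_Z :: "real \<Rightarrow> real \<Rightarrow> complex \<times> complex \<Rightarrow> complex \<times> complex \<Rightarrow> complex \<times> complex" where
  "cplx_struct_Z \<kappa> R p = (THE J. linear J \<and> (\<forall>a. J (J a) = - a) \<and>
     transport_distr \<kappa> R p = {L. cpush J L = cscale (- \<i>) L})"

definition cplx_struct_std :: "complex \<times> complex \<Rightarrow> complex \<times> complex \<Rightarrow> complex \<times> complex" where
  "cplx_struct_std p = (\<lambda>(a, b). (\<i> * a, \<i> * b))"

definition holo_map ::
  "('a::real_normed_vector \<Rightarrow> 'a \<Rightarrow> 'a) \<Rightarrow> ('b::real_normed_vector \<Rightarrow> 'b \<Rightarrow> 'b) \<Rightarrow> 'a set \<Rightarrow> ('a \<Rightarrow> 'b) \<Rightarrow> bool" where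
  "holo_map J J' U f \<longleftrightarrow> smooth_on U f \<and>
     (\<forall>p\<in>U. \<forall>a. frechet_derivative f (at p) (J p a) = J' (f p) (frechet_derivative f (at p) a))"

definition biholo_onto_image ::
  "('a::real_normed_vector \<Rightarrow> 'a \<Rightarrow> 'a) \<Rightarrow> ('b::real_normed_vector \<Rightarrow> 'b \<Rightarrow> 'b) \<Rightarrow> 'a set \<Rightarrow> ('a \<Rightarrow> 'b) \<Rightarrow> bool" where
  "biholo_onto_image J J' U f \<longleftrightarrow> inj_on f U \<and> open (f ` U) \<and>
     holo_map J J' U f \<and> holo_map J' J (f ` U) (inv_into U f)"

section \<open>The scattering relation and the $C^\infty_\alpha$-structure\<close>

definition bdry_SM :: "real \<Rightarrow> (complex \<times> complex) set" where
  "bdry_SM R = sphere 0 R \<times> sphere 0 1"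

text \<open>The vector \<open>- e\<^sub>r\<close>.\<close>

definition inward_normal :: "real \<Rightarrow> complex \<Rightarrow> complex" where
  "inward_normal \<kappa> x = - (sgn x / of_real (1 + \<kappa> * (norm x)\<^sup>2))"

definition influx :: "real \<Rightarrow> real \<Rightarrow> (complex \<times> complex) set" where
  "influx \<kappa> R = {p \<in> bdry_SM R. case chart \<kappa> p of (x, v) \<Rightarrow> metric_g \<kappa> x v (inward_normal \<kappa> x) \<ge> 0}"

definition outflux :: "real \<Rightarrow> real \<Rightarrow> (complex \<times> complex) set" where
  "outflux \<kappa> R = {p \<in> bdry_SM R. case chart \<kappa> p of (x, v) \<Rightarrow> metric_g \<kappa> x v (inward_normal \<kappa> x) \<le> 0}"

definition geodesic_from_to :: "real \<Rightarrow> real \<Rightarrow> complex \<times> complex \<Rightarrow> complex \<times> complex \<Rightarrow> bool" where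
  "geodesic_from_to \<kappa> R q q' \<longleftrightarrow> (\<exists>T c. T \<ge> 0 \<and> c 0 = q \<and> c T = q' \<and>
     (\<forall>t\<in>{0..T}. c t \<in> unit_tangent \<kappa> R \<and>
        (c has_vector_derivative geodesic_field \<kappa> (c t)) (at t within {0..T})))"

text \<open>
  The geodesic of length zero is allowed, so that vectors tangent to the boundary, whose geodesic
  does not enter the disk, are fixed.
\<close>

definition scattering :: "real \<Rightarrow> real \<Rightarrow> complex \<times> complex \<Rightarrow> complex \<times> complex" where
  "scattering \<kappa> R p = (THE q.
     p \<in> influx \<kappa> R \<and> q \<in> outflux \<kappa> R \<and> geodesic_from_to \<kappa> R (chart \<kappa> p) (chart \<kappa> q) \<or>
     p \<in> outflux \<kappa> R \<and> q \<in> influx \<kappa> R \<and> geodesic_from_to \<kappa> R (chart \<kappa> q) (chart \<kappa> p))"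

definition scattering_ext :: "real \<Rightarrow> real \<Rightarrow> (complex \<times> complex \<Rightarrow> 'b) \<Rightarrow> complex \<times> complex \<Rightarrow> 'b" where
  "scattering_ext \<kappa> R u p = (if p \<in> influx \<kappa> R then u p else u (scattering \<kappa> R p))"

definition alpha_smooth :: "real \<Rightarrow> real \<Rightarrow> (complex \<times> complex \<Rightarrow> 'b::real_normed_vector) \<Rightarrow> bool" where
  "alpha_smooth \<kappa> R u \<longleftrightarrow> smooth_on (bdry_SM R) (scattering_ext \<kappa> R u)"

text \<open>
  Tangent vectors at \<open>p\<close> of the manifold with boundary given by this smooth structure, as
  derivations at \<open>p\<close> of its algebra of real-valued smooth functions.  Two functions that agree on
  \<open>influx \<kappa> R\<close> have the same image under such a derivation, by the Leibniz rule.
\<close>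

definition alpha_tangent :: "real \<Rightarrow> real \<Rightarrow> complex \<times> complex \<Rightarrow> ((complex \<times> complex \<Rightarrow> real) \<Rightarrow> real) set" where
  "alpha_tangent \<kappa> R p = {\<delta>. \<forall>u v. alpha_smooth \<kappa> R u \<longrightarrow> alpha_smooth \<kappa> R v \<longrightarrow>
     \<delta> (\<lambda>q. u q + v q) = \<delta> u + \<delta> v \<and>
     (\<forall>c. \<delta> (\<lambda>q. c * u q) = c * \<delta> u) \<and>
     \<delta> (\<lambda>q. u q * v q) = \<delta> u * v p + u p * \<delta> v}"

definition alpha_differential ::
  "(complex \<times> complex \<Rightarrow> complex \<times> complex) \<Rightarrow> ((complex \<times> complex \<Rightarrow> real) \<Rightarrow> real) \<Rightarrow> complex \<times> complex" where
  "alpha_differential f \<delta> =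
     (Complex (\<delta> (\<lambda>q. Re (fst (f q)))) (\<delta> (\<lambda>q. Im (fst (f q)))),
      Complex (\<delta> (\<lambda>q. Re (snd (f q)))) (\<delta> (\<lambda>q. Im (snd (f q)))))"

definition totally_real_alpha_embedding ::
  "real \<Rightarrow> real \<Rightarrow> (complex \<times> complex \<Rightarrow> complex \<times> complex) \<Rightarrow> bool" where
  "totally_real_alpha_embedding \<kappa> R f \<longleftrightarrow>
     alpha_smooth \<kappa> R f \<and>
     (\<exists>g. homeomorphism (influx \<kappa> R) (f ` influx \<kappa> R) f g) \<and>
     (\<forall>p\<in>influx \<kappa> R. \<forall>\<delta>\<in>alpha_tangent \<kappa> R p.
        alpha_differential f \<delta> = 0 \<longrightarrow> (\<forall>u. alpha_smooth \<kappa> R u \<longrightarrow> \<delta> u = 0)) \<and>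
     (\<forall>p\<in>influx \<kappa> R.
        let P = alpha_differential f ` alpha_tangent \<kappa> R p
        in P \<inter> cplx_struct_std (f p) ` P = {0})"

section \<open>Hermitian forms and holomorphic blow-down structure\<close>

definition d_z :: "(complex \<times> complex) cplx" where "d_z = ((1/2, 0), (- \<i>/2, 0))"
definition d_zbar :: "(complex \<times> complex) cplx" where "d_zbar = ((1/2, 0), (\<i>/2, 0))"
definition d_nu :: "(complex \<times> complex) cplx" where "d_nu = ((0, 1/2), (0, - \<i>/2))"
definition d_nubar :: "(complex \<times> complex) cplx" where "d_nubar = ((0, 1/2), (0, \<i>/2))"

definition Xi :: "real \<Rightarrow> complex \<times> complex \<Rightarrow> (complex \<times> complex) cplx" where
  "Xi \<kappa> = (\<lambda>(z, \<nu>).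
     cscale ((2 + \<kappa> * z * cnj z) * \<nu>\<^sup>2 - \<kappa> * z\<^sup>2) d_z
   + cscale (2 + \<kappa> * z * cnj z - \<kappa> * \<nu>\<^sup>2 * (cnj z)\<^sup>2) d_zbar
   + cscale (\<kappa> * (z - \<nu>\<^sup>2 * cnj z)) (cscale (cnj \<nu>) d_nubar - cscale \<nu> d_nu))"

text \<open>One-forms are given by their restrictions to real tangent vectors.\<close>

definition eta_form :: "real \<Rightarrow> complex \<times> complex \<Rightarrow> 2 \<Rightarrow> complex \<times> complex \<Rightarrow> complex" where
  "eta_form \<kappa> p j = (THE \<eta>. linear \<eta> \<and>
     (if j = 1
      then cext \<eta> d_nu = 0 \<and> cext \<eta> d_nubar = 0 \<and> cext \<eta> (Xi \<kappa> p) = 0 \<and>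
           cext \<eta> (cconj (Xi \<kappa> p)) = of_real (1 - norm (snd p) ^ 4)
      else cext \<eta> (cconj (Xi \<kappa> p)) = 0 \<and> cext \<eta> d_nubar = 0 \<and> cext \<eta> (Xi \<kappa> p) = 0 \<and>
           cext \<eta> d_nu = 1))"

definition wedge :: "('a \<Rightarrow> complex) \<Rightarrow> ('a \<Rightarrow> complex) \<Rightarrow> 'a \<Rightarrow> 'a \<Rightarrow> complex" where
  "wedge \<alpha> \<beta> a b = \<alpha> a * \<beta> b - \<alpha> b * \<beta> a"

definition Omega_C2 :: "complex \<times> complex \<Rightarrow> complex \<times> complex \<Rightarrow> complex" where
  "Omega_C2 a b = \<i> * (wedge fst (cnj \<circ> fst) a b + wedge snd (cnj \<circ> snd) a b)"

definition hermitian :: "complex^'n^'n \<Rightarrow> bool" where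
  "hermitian A \<longleftrightarrow> (\<forall>j k. A $ k $ j = cnj (A $ j $ k))"

definition pos_semidef :: "complex^'n^'n \<Rightarrow> bool" where
  "pos_semidef A \<longleftrightarrow> hermitian A \<and> (\<forall>a. 0 \<le> Re (\<Sum>j\<in>UNIV. \<Sum>k\<in>UNIV. A $ j $ k * a $ k * cnj (a $ j)))"

text \<open>
  The derivative \<open>B\<close> is taken within \<open>Z\<close> because of the points over the boundary of the disk;
  it is unique since \<open>Z\<close> is convex with nonempty interior.
\<close>

definition coercive_pullback :: "real \<Rightarrow> real \<Rightarrow> (complex \<times> complex \<Rightarrow> complex \<times> complex) \<Rightarrow> bool" where
  "coercive_pullback \<kappa> R \<beta> \<longleftrightarrow> (\<exists>H :: complex \<times> complex \<Rightarrow> complex^2^2.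
     (\<forall>p \<in> Z_space R - SM_coords R. hermitian (H p) \<and>
        (\<exists>B. (\<beta> has_derivative B) (at p within Z_space R) \<and>
           (\<forall>a b. Omega_C2 (B a) (B b) =
              \<i> * (\<Sum>j\<in>UNIV. \<Sum>k\<in>UNIV.
                     H p $ j $ k * wedge (eta_form \<kappa> p j) (cnj \<circ> eta_form \<kappa> p k) a b)))) \<and>
     (\<exists>c::real. c > 0 \<and> (\<forall>p \<in> Z_space R - SM_coords R. pos_semidef (H p - mat (of_real c)))))"

definition holomorphic_blow_down :: "real \<Rightarrow> real \<Rightarrow> (complex \<times> complex \<Rightarrow> complex \<times> complex) \<Rightarrow> bool" where
  "holomorphic_blow_down \<kappa> R \<beta> \<longleftrightarrow>
     smooth_on (Z_space R) \<beta> \<and>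
     totally_real_alpha_embedding \<kappa> R \<beta> \<and>
     biholo_onto_image (cplx_struct_Z \<kappa> R) cplx_struct_std (Z_interior R) \<beta> \<and>
     coercive_pullback \<kappa> R \<beta>"

end

theory Submission
  imports Defs
begin

text \<open>
  The linear map \<open>flat \<kappa> x\<close> identifies the metric at \<open>x\<close> with the Euclidean one, which makes the
  chart, the rotation, the geodesic field and the fields \<open>\<eta>\<^sub>\<plusminus>\<close> explicit.  The distribution is
  then the kernel of the complexified derivative of \<open>\<beta>\<close>, which is invertible where \<open>|\<nu>| < 1\<close>: so
  \<open>\<beta>\<close> carries the complex structure to the standard one.  It is injective because \<open>w / \<xi>\<close>
  determines the position up to the modulus of \<open>\<nu>\<close>, in which \<open>|\<xi>|\<close> is increasing as long as
  \<open>1 + \<kappa> |z|\<^sup>2 > 0\<close>.  The coefficients of \<open>dw\<close> and \<open>d\<xi>\<close> with respect to \<open>\<eta>\<^sub>1, \<eta>\<^sub>2\<close> extend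
  continuously and with nonzero determinant to the compact space \<open>Z\<close>, which yields the lower bound
  for \<open>H\<close>.

  On the boundary torus, the angular momentum \<open>q = Im (z cnj \<nu>)\<close> and a shifted phase \<open>t\<close> of \<open>\<nu>\<close> are
  constant along geodesics, and \<open>\<beta> = (2 \<i> q e\<^bsup>\<i> t + \<kappa> q\<^sup>2\<^esup>, e\<^bsup>\<i> t + \<kappa> q\<^sup>2\<^esup>)\<close>.  Writing \<open>q = R sin x\<close>, the
  scattering relation is the fold \<open>x \<mapsto> pi - x\<close>, and by Hadamard's lemma the even functions of the
  fold are locally smooth functions of \<open>q\<close> up to the fold, so that derivations are determined by
  their values on \<open>q\<close> and \<open>t\<close>.
\<close>

section \<open>Calculus of smooth maps\<close>

text \<open>Two definitions dictate the shape of the argument. The complex structure is a definite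
  description through \<open>transport_distr\<close>, which is built from Frechet derivatives and
  the Christoffel symbols, so the distribution has to be computed from the metric before holomorphy
  can be discussed. In flat coordinates the fibre component of the geodesic field is a mere
  rotation, at a rate given by the angular momentum, and this reduces all generators to
  \<open>Xi\<close> and \<open>d_nubar\<close>. The second obstacle is the boundary. Tangent vectors
  there are abstract derivations, and the projection of the torus to the quotient degenerates where
  \<open>cos x = 0\<close>: every invariant function has vanishing \<open>x\<close>-derivative
  there. Derivations are therefore evaluated through factorizations
  \<open>u (x, t) - u (x0, t) = (sin x - sin x0) * g (x, t)\<close> in which \<open>g\<close> is
  again invariant. The divisors \<open>sin ((x - a) / 2)\<close> take the place of
  \<open>x - a\<close>, so that a single quotient covers the whole plane and inherits the
  symmetries.\<close>

lemma Ck_on_cong: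
  assumes "open U" "\<And>x. x \<in> U \<Longrightarrow> f x = g x" "Ck_on k f U"
  shows "Ck_on k g U"
  using assms
proof (induction k arbitrary: f g)
  case 0
  then show ?case by (simp cong: continuous_on_cong)
next
  case (Suc k)
  have "(g has_derivative frechet_derivative f (at x)) (at x)" if "x \<in> U" for x
  proof (rule has_derivative_transform_within_open[OF _ \<open>open U\<close> that])
    show "(f has_derivative frechet_derivative f (at x)) (at x)"
      using Suc.prems(3) that frechet_derivative_works by auto
  qed (use Suc.prems in auto)
  then have "g differentiable (at x)" "frechet_derivative f (at x) = frechet_derivative g (at x)"
    if "x \<in> U" for x
    using that frechet_derivative_at by (auto simp: differentiable_def)
  then show ?case
    using Suc.prems Suc.IH[OF \<open>open U\<close>, of "\<lambda>x. frechet_derivative f (at x) v" for v] by simp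
qed

text \<open>Membership in the next class is checked on a candidate derivative \<open>D\<close> in
  place of the chosen \<open>frechet_derivative\<close>.\<close>

lemma Ck_on_Suc:
  assumes "\<And>x. x \<in> U \<Longrightarrow> (f has_derivative D x) (at x)"
    and "open U" "\<And>v. Ck_on k (\<lambda>x. D x v) U"
  shows "Ck_on (Suc k) f U"
proof -
  have "frechet_derivative f (at x) = D x" "f differentiable (at x)" if "x \<in> U" for x
    using frechet_derivative_at[OF assms(1)[OF that]] assms(1)[OF that]
    by (auto simp: differentiable_def)
  then show ?thesis
    using Ck_on_cong[OF assms(2) _ assms(3)] by simp
qed

lemma Ck_on_SucD:
  assumes "Ck_on (Suc k) f U" "x \<in> U"
  shows "(f has_derivative frechet_derivative f (at x)) (at x)"
  using assms frechet_derivative_works by auto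

lemma Ck_on_Suc_imp: "Ck_on (Suc k) f U \<Longrightarrow> Ck_on k f U"
proof (induction k arbitrary: f)
  case 0
  then show ?case
    by (auto intro!: continuous_at_imp_continuous_on differentiable_imp_continuous_within)
next
  case (Suc k)
  then show ?case by simp
qed

lemma Ck_on_imp_continuous: "Ck_on k f U \<Longrightarrow> continuous_on U f"
  by (induction k) (auto dest: Ck_on_Suc_imp simp del: Ck_on.simps(2))

lemma Ck_on_subset: "Ck_on k f U \<Longrightarrow> V \<subseteq> U \<Longrightarrow> Ck_on k f V"
  by (induction k arbitrary: f) (auto intro: continuous_on_subset)

text \<open>\<open>frechet_derivative\<close> at a point is a local notion, so each stage of the
  recursion can be tested on neighbourhoods. This recognizes smoothness from extensions or quotients
  that exist only locally.\<close>

lemma Ck_on_local: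
  assumes "\<And>x. x \<in> U \<Longrightarrow> \<exists>V. open V \<and> x \<in> V \<and> Ck_on k f V"
  shows "Ck_on k f U"
  using assms
proof (induction k arbitrary: f)
  case 0
  then show ?case
    by (auto intro!: continuous_at_imp_continuous_on) (metis continuous_on_eq_continuous_at)
next
  case (Suc k)
  show ?case
  proof (simp, intro conjI ballI allI)
    fix x assume "x \<in> U"
    then show "f differentiable at x" using Suc.prems by fastforce
  next
    fix v show "Ck_on k (\<lambda>x. frechet_derivative f (at x) v) U"
      using Suc.prems by (intro Suc.IH) fastforce
  qed
qed

lemma Ck_on_const: "Ck_on k (\<lambda>x. c) U"
proof (induction k arbitrary: c)
  case (Suc k)
  have "frechet_derivative (\<lambda>x. c) (at x) = (\<lambda>v. 0)" for x
    using frechet_derivative_at[OF has_derivative_const] by metis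
  then show ?case using Suc by (simp add: )
qed simp

lemma Ck_on_linear:
  assumes "bounded_linear f" "open U"
  shows "Ck_on k f U"
proof (cases k)
  case 0
  then show ?thesis using assms by (simp add: linear_continuous_on)
next
  case (Suc m)
  show ?thesis unfolding Suc
    by (rule Ck_on_Suc[where D = "\<lambda>x. f"]) (auto simp: assms bounded_linear_imp_has_derivative Ck_on_const)
qed

section \<open>Closure of the smoothness classes under algebra and composition\<close>

lemma Ck_on_add:
  assumes "open U" "Ck_on k f U" "Ck_on k g U"
  shows "Ck_on k (\<lambda>x. f x + g x) U"
  using assms(2,3)
proof (induction k arbitrary: f g)
  case (Suc k)
  show ?case
    by (rule Ck_on_Suc[where D = "\<lambda>x v. frechet_derivative f (at x) v + frechet_derivative g (at x) v"])
      (use Suc assms(1) in \<open>auto intro!: has_derivative_add Ck_on_SucD simp del: Ck_on.simps(2)\<close>, use Suc in auto)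
qed (auto intro: continuous_intros)

lemma Ck_on_sum:
  assumes "open U" "finite I" "\<And>i. i \<in> I \<Longrightarrow> Ck_on k (f i) U"
  shows "Ck_on k (\<lambda>x. \<Sum>i\<in>I. f i x) U"
  using assms(2,3) by (induction I) (auto intro: Ck_on_const Ck_on_add[OF assms(1)])

lemma Ck_on_bilinear:
  assumes "bounded_bilinear B" "open U" "Ck_on k f U" "Ck_on k g U"
  shows "Ck_on k (\<lambda>x. B (f x) (g x)) U"
  using assms(3,4)
proof (induction k arbitrary: f g)
  case 0
  then show ?case using bounded_bilinear.continuous_on[OF assms(1)] by auto
next
  case (Suc k)
  note fg = Suc.prems[THEN Ck_on_Suc_imp]
  show ?case
  proof (rule Ck_on_Suc[OF bounded_bilinear.FDERIV[OF assms(1) Ck_on_SucD Ck_on_SucD] \<open>open U\<close>])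
    fix v
    show "Ck_on k (\<lambda>x. B (f x) (frechet_derivative g (at x) v) +
        B (frechet_derivative f (at x) v) (g x)) U"
      using Suc fg by (intro Ck_on_add[OF \<open>open U\<close>]) auto
  qed (use Suc.prems in auto)
qed

lemma Ck_on_compose:
  fixes f :: "'b::euclidean_space \<Rightarrow> 'c::real_normed_vector"
  assumes "open U" "open V" "g ` U \<subseteq> V" "Ck_on k g U" "Ck_on k f V"
  shows "Ck_on k (\<lambda>x. f (g x)) U"
  using assms(4,5)
proof (induction k arbitrary: f)
  case 0
  then show ?case
    using continuous_on_compose2[of V f U g] assms(3) by auto
next
  case (Suc k)
  have lin: "linear (frechet_derivative f (at y))" if "y \<in> V" for y
    using Ck_on_SucD[OF Suc.prems(2) that] by (rule has_derivative_linear)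
  show ?case
  proof (rule Ck_on_Suc[OF _ \<open>open U\<close>])
    fix x assume x: "x \<in> U"
    then have "((f \<circ> g) has_derivative (frechet_derivative f (at (g x)) \<circ> frechet_derivative g (at x))) (at x)"
      using assms(3) by (intro diff_chain_at Ck_on_SucD[OF Suc.prems(1)] Ck_on_SucD[OF Suc.prems(2)]) auto
    then show "((\<lambda>x. f (g x)) has_derivative
        (\<lambda>v. frechet_derivative f (at (g x)) (frechet_derivative g (at x) v))) (at x)"
      by (simp add: o_def)
  next
    fix v
    \<comment> \<open>The direction \<open>frechet_derivative g (at x) v\<close> moves with
      \<open>x\<close>, while the induction hypothesis covers fixed directions. Expansion in the
      basis separates the two dependences.\<close>
    have "Ck_on k (\<lambda>x. \<Sum>b\<in>Basis. (frechet_derivative g (at x) v \<bullet> b) *\<^sub>R frechet_derivative f (at (g x)) b) U"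
    proof (rule Ck_on_sum[OF \<open>open U\<close> finite_Basis])
      fix b :: 'b
      have "Ck_on k (\<lambda>x. frechet_derivative g (at x) v \<bullet> b) U"
        by (rule Ck_on_bilinear[OF bounded_bilinear_inner \<open>open U\<close>])
          (use Suc.prems(1) in \<open>auto intro: Ck_on_const\<close>)
      moreover have "Ck_on k (\<lambda>x. frechet_derivative f (at (g x)) b) U"
        using Suc.prems by (intro Suc.IH Ck_on_Suc_imp[OF Suc.prems(1)]) auto
      ultimately show "Ck_on k (\<lambda>x. (frechet_derivative g (at x) v \<bullet> b) *\<^sub>R frechet_derivative f (at (g x)) b) U"
        by (rule Ck_on_bilinear[OF bounded_bilinear_scaleR \<open>open U\<close>])
    qed
    then show "Ck_on k (\<lambda>x. frechet_derivative f (at (g x)) (frechet_derivative g (at x) v)) U"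
    proof (rule Ck_on_cong[OF \<open>open U\<close>, rotated])
      fix x assume "x \<in> U"
      then have "g x \<in> V" using assms(3) by auto
      then show "(\<Sum>b\<in>Basis. (frechet_derivative g (at x) v \<bullet> b) *\<^sub>R frechet_derivative f (at (g x)) b)
          = frechet_derivative f (at (g x)) (frechet_derivative g (at x) v)"
        using lin[of "g x"] by (subst (3) euclidean_representation[symmetric])
          (simp add: linear_sum linear_cmul o_def)
    qed
  qed
qed

lemma Ck_on_bounded_linear:
  assumes "bounded_linear f" "open U" "Ck_on k g U"
  shows "Ck_on k (\<lambda>x. f (g x)) U"
  using assms(3)
proof (induction k arbitrary: g)
  case 0
  then show ?case by (simp add: bounded_linear.continuous_on[OF assms(1)])
next
  case (Suc k)
  show ?case
    by (rule Ck_on_Suc[OF bounded_linear.has_derivative[OF assms(1) Ck_on_SucD[OF Suc.prems]] assms(2)])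
      (use Suc in auto)
qed

lemma Ck_on_Pair:
  fixes f :: "'a::real_normed_vector \<Rightarrow> 'b::real_normed_vector" and g :: "'a \<Rightarrow> 'c::real_normed_vector"
  assumes "open U" "Ck_on k f U" "Ck_on k g U"
  shows "Ck_on k (\<lambda>x. (f x, g x)) U"
proof -
  have "bounded_linear (\<lambda>a. (a, 0) :: 'b \<times> 'c)" "bounded_linear (\<lambda>a. (0, a) :: 'b \<times> 'c)"
    by (auto intro: bounded_linear_Pair bounded_linear_ident bounded_linear_zero)
  from Ck_on_add[OF \<open>open U\<close> Ck_on_bounded_linear[OF this(1) assms(1,2)] Ck_on_bounded_linear[OF this(2) assms(1,3)]]
  show ?thesis by simp
qed

lemmas Ck_on_mult = Ck_on_bilinear[OF bounded_bilinear_mult]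
lemmas Ck_on_fst = Ck_on_bounded_linear[OF bounded_linear_fst]
lemmas Ck_on_snd = Ck_on_bounded_linear[OF bounded_linear_snd]
lemmas Ck_on_Re = Ck_on_bounded_linear[OF bounded_linear_Re]
lemmas Ck_on_Im = Ck_on_bounded_linear[OF bounded_linear_Im]
lemmas Ck_on_cnj = Ck_on_bounded_linear[OF bounded_linear_cnj]
lemmas Ck_on_of_real = Ck_on_bounded_linear[OF bounded_linear_of_real]
lemmas Ck_on_id = Ck_on_linear[OF bounded_linear_ident]
lemmas Ck_on_minus = Ck_on_bounded_linear[OF bounded_linear_minus[OF bounded_linear_ident]]

lemma Ck_on_diff:
  assumes "open U" "Ck_on k f U" "Ck_on k g U"
  shows "Ck_on k (\<lambda>x. f x - g x) U"
  using Ck_on_add[OF assms(1,2) Ck_on_minus[OF assms(1,3)]] by simp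

lemma Ck_on_power:
  fixes f :: "_ \<Rightarrow> 'b::real_normed_algebra_1"
  assumes "open U" "Ck_on k f U"
  shows "Ck_on k (\<lambda>x. f x ^ n) U"
  by (induction n) (auto intro!: Ck_on_const Ck_on_mult assms)

lemma Ck_on_inverse_UNIV: "Ck_on k (inverse :: 'a::real_normed_field \<Rightarrow> 'a) (- {0})"
proof (induction k)
  case (Suc k)
  show ?case
    by (rule Ck_on_Suc[OF has_derivative_inverse'])
      (auto intro!: Ck_on_minus Ck_on_mult Ck_on_const Suc open_Compl)
qed (auto intro: continuous_intros)

lemma Ck_on_inverse:
  fixes f :: "_ \<Rightarrow> 'b::{real_normed_field, euclidean_space}"
  assumes "open U" "Ck_on k f U" "\<And>x. x \<in> U \<Longrightarrow> f x \<noteq> 0"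
  shows "Ck_on k (\<lambda>x. inverse (f x)) U"
  using assms by (intro Ck_on_compose[OF _ _ _ _ Ck_on_inverse_UNIV]) (auto intro!: open_Compl)

lemma Ck_on_divide:
  fixes f :: "_ \<Rightarrow> 'b::{real_normed_field, euclidean_space}"
  assumes "open U" "Ck_on k f U" "Ck_on k g U" "\<And>x. x \<in> U \<Longrightarrow> g x \<noteq> 0"
  shows "Ck_on k (\<lambda>x. f x / g x) U"
  unfolding divide_inverse using assms by (intro Ck_on_mult Ck_on_inverse)

lemma Ck_on_exp_UNIV: "Ck_on k (exp :: complex \<Rightarrow> complex) UNIV"
proof (induction k)
  case (Suc k)
  have "((exp :: complex \<Rightarrow> complex) has_derivative (\<lambda>v. exp x * v)) (at x)" for x
    using DERIV_exp[of x] by (simp add: has_field_derivative_def)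
  then show ?case by (rule Ck_on_Suc) (auto intro!: Ck_on_mult Ck_on_const Suc)
qed (auto intro: continuous_intros)

lemma Ck_on_exp:
  fixes f :: "_ \<Rightarrow> complex"
  assumes "open U" "Ck_on k f U"
  shows "Ck_on k (\<lambda>x. exp (f x)) U"
  using assms by (intro Ck_on_compose[OF _ _ _ _ Ck_on_exp_UNIV]) auto

lemma Ck_on_Ln_slit: "Ck_on k (Ln :: complex \<Rightarrow> complex) (- \<real>\<^sub>\<le>\<^sub>0)"
proof (cases k)
  case 0
  then show ?thesis by (auto intro!: continuous_on_Ln)
next
  case (Suc m)
  show ?thesis unfolding Suc
  proof (rule Ck_on_Suc)
    fix x :: complex assume "x \<in> - \<real>\<^sub>\<le>\<^sub>0"
    then show "(Ln has_derivative (\<lambda>v. inverse x * v)) (at x)"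
      using has_field_derivative_Ln[of x] by (simp add: has_field_derivative_def)
  qed (auto intro!: Ck_on_mult Ck_on_inverse Ck_on_id Ck_on_const simp: open_Compl)
qed

lemma Ck_on_Ln:
  fixes f :: "_ \<Rightarrow> complex"
  assumes "open U" "Ck_on k f U" "\<And>x. x \<in> U \<Longrightarrow> f x \<notin> \<real>\<^sub>\<le>\<^sub>0"
  shows "Ck_on k (\<lambda>x. Ln (f x)) U"
  using assms by (intro Ck_on_compose[OF _ _ _ _ Ck_on_Ln_slit]) (auto simp: open_Compl)

lemma Ck_on_cos:
  fixes f :: "_ \<Rightarrow> real"
  assumes "open U" "Ck_on k f U"
  shows "Ck_on k (\<lambda>x. cos (f x)) U"
proof -
  have "Ck_on k (\<lambda>x. Re (exp (\<i> * of_real (f x)))) U"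
    using assms by (intro Ck_on_Re Ck_on_exp Ck_on_mult Ck_on_const Ck_on_of_real)
  then show ?thesis by (simp add: cis_conv_exp[symmetric])
qed

lemma Ck_on_sin:
  fixes f :: "_ \<Rightarrow> real"
  assumes "open U" "Ck_on k f U"
  shows "Ck_on k (\<lambda>x. sin (f x)) U"
proof -
  have "Ck_on k (\<lambda>x. Im (exp (\<i> * of_real (f x)))) U"
    using assms by (intro Ck_on_Im Ck_on_exp Ck_on_mult Ck_on_const Ck_on_of_real)
  then show ?thesis by (simp add: cis_conv_exp[symmetric])
qed

text \<open>Differentiation under the integral sign: the derivative is again such an integral, with
  an integrand that is one class lower, so the induction closes.\<close>

lemma Ck_on_integral:
  fixes f :: "'a::euclidean_space \<times> real \<Rightarrow> 'b::euclidean_space"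
  assumes "Ck_on k f UNIV"
  shows "Ck_on k (\<lambda>x. integral {0..1} (\<lambda>s. f (x, s))) UNIV"
  using assms
proof (induction k arbitrary: f)
  case 0
  have "continuous_on (UNIV \<times> cbox 0 1) (\<lambda>(x, s). f (x, s))"
    using 0 by (auto intro: continuous_on_subset)
  from integral_continuous_on_param[OF this] show ?case by simp
next
  case (Suc k)
  define f' where "f' p = frechet_derivative f (at p)" for p
  have f': "(f has_derivative f' p) (at p)" for p
    using Ck_on_SucD[OF Suc.prems] by (simp add: f'_def)
  have lin: "bounded_linear (\<lambda>v. f' p (v, 0))" for p
    using bounded_linear_compose[OF has_derivative_bounded_linear[OF f'], of "\<lambda>v. (v, 0)"]
    by (simp add: bounded_linear_Pair bounded_linear_ident bounded_linear_zero)
  \<comment> \<open>The Leibniz rule wants the \<open>x\<close>-derivative as a continuous map into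
    bounded linear functions; in finite dimension its continuity can be checked on basis
    vectors.\<close>
  define D where "D x s = Blinfun (\<lambda>v. f' (x, s) (v, 0))" for x s
  have D: "blinfun_apply (D x s) v = f' (x, s) (v, 0)" for x s v
    by (simp add: D_def bounded_linear_Blinfun_apply lin)
  have Ckf': "Ck_on k (\<lambda>p. f' p v) UNIV" for v
    unfolding f'_def using Suc.prems by (simp del: split_paired_All)
  have "continuous_on (UNIV \<times> cbox 0 1) (\<lambda>p. D (fst p) (snd p))"
  proof (rule continuous_on_blinfun_componentwise)
    fix i :: 'a
    have "continuous_on UNIV (\<lambda>p. f' p (i, 0))" by (rule Ck_on_imp_continuous[OF Ckf'])
    then show "continuous_on (UNIV \<times> cbox 0 1) (\<lambda>p. blinfun_apply (D (fst p) (snd p)) i)"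
      using continuous_on_subset by (fastforce simp: D)
  qed
  then have contD: "continuous_on (UNIV \<times> cbox 0 1) (\<lambda>(x, s). D x s)"
    by (simp add: case_prod_unfold)
  moreover have "((\<lambda>x. f (x, s)) has_derivative blinfun_apply (D x s)) (at x within UNIV)" for x s
  proof -
    have "((\<lambda>x. (x, s)) has_derivative (\<lambda>v. (v, 0))) (at x)" by (auto intro!: derivative_eq_intros)
    note diff_chain_at[OF this f']
    moreover have "blinfun_apply (D x s) = (\<lambda>v. f' (x, s) (v, 0))" by (simp add: fun_eq_iff D)
    ultimately show ?thesis by (simp add: o_def)
  qed
  moreover have "(\<lambda>s. f (x, s)) integrable_on cbox 0 1" for x
    using Ck_on_imp_continuous[OF Suc.prems]
    by (intro integrable_continuous) (auto intro!: continuous_on_compose2[of UNIV f] continuous_intros)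
  ultimately have der: "((\<lambda>x. integral (cbox 0 1) (\<lambda>s. f (x, s))) has_derivative
      integral (cbox 0 1) (D x)) (at x within UNIV)" for x
    by (intro leibniz_rule) auto
  have int: "D x integrable_on cbox 0 1" for x
    using contD
    by (intro integrable_continuous continuous_on_compose2[of _ "\<lambda>(x, s). D x s" _ "\<lambda>s. (x, s)", simplified])
      (auto intro!: continuous_intros)
  have "blinfun_apply (integral (cbox 0 1) (D x)) v = integral {0..1} (\<lambda>s. f' (x, s) (v, 0))" for x v
    using blinfun_apply_integral[OF int, of x v] by (simp add: D)
  then have "blinfun_apply (integral (cbox 0 1) (D x)) = (\<lambda>v. integral {0..1} (\<lambda>s. f' (x, s) (v, 0)))" for x
    by (simp add: fun_eq_iff)
  then have "((\<lambda>x. integral {0..1} (\<lambda>s. f (x, s))) has_derivative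
      (\<lambda>v. integral {0..1} (\<lambda>s. f' (x, s) (v, 0)))) (at x)" for x
    using der[of x] by simp
  then show ?case
    by (rule Ck_on_Suc) (auto intro!: Suc.IH Ckf')
qed

section \<open>Geometry in the flat frame\<close>

definition ell :: "real \<Rightarrow> complex \<Rightarrow> real" where
  "ell \<kappa> x = 1 + \<kappa> * (norm x)\<^sup>2"

text \<open>
  The metric at \<open>x\<close> is the pullback of the Euclidean one under the linear map \<open>flat \<kappa> x\<close>, which
  stretches by \<open>ell \<kappa> x\<close> in the radial direction.  So \<open>(x, v) \<mapsto> (x, flat \<kappa> x v)\<close> inverts the
  chart, and it turns the rotation into the multiplication by \<open>\<i>\<close>.
\<close>

definition flat :: "real \<Rightarrow> complex \<Rightarrow> complex \<Rightarrow> complex" where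
  "flat \<kappa> x v = v + (\<kappa> * (x \<bullet> v)) *\<^sub>R x"

text \<open>Sherman-Morrison inverse of \<open>flat \<kappa> x\<close>, which is a rank-one
  perturbation of the identity with determinant \<open>ell \<kappa> x\<close>.\<close>

definition unflat :: "real \<Rightarrow> complex \<Rightarrow> complex \<Rightarrow> complex" where
  "unflat \<kappa> x n = n - (\<kappa> * (x \<bullet> n) / ell \<kappa> x) *\<^sub>R x"

lemma ell_pos:
  assumes "R > 0" "\<kappa> > - 1 / R\<^sup>2" "norm x \<le> R"
  shows "ell \<kappa> x > 0"
proof (cases "\<kappa> \<ge> 0")
  case False
  have "(norm x)\<^sup>2 \<le> R\<^sup>2" using assms(3) by (simp add: power_mono)
  hence "\<kappa> * R\<^sup>2 \<le> \<kappa> * (norm x)\<^sup>2" using False by (simp add: mult_left_mono_neg)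
  moreover have "\<kappa> * R\<^sup>2 > - 1" using assms by (simp add: field_simps)
  ultimately show ?thesis by (simp add: ell_def)
qed (simp add: ell_def add_pos_nonneg)

lemma ell_complex: "of_real (ell \<kappa> x) = 1 + of_real \<kappa> * x * cnj x"
  using complex_norm_square[of x] by (simp add: ell_def mult.assoc)

lemma ell_coords: "ell \<kappa> x = 1 + \<kappa> * ((Re x)\<^sup>2 + (Im x)\<^sup>2)"
  by (simp add: ell_def cmod_power2)

lemma continuous_ell: "continuous_on UNIV (ell \<kappa>)"
  unfolding ell_def by (intro continuous_intros)

lemma open_ell_pos: "open {x. ell \<kappa> x > 0}"
  using continuous_open_preimage[OF continuous_ell[of \<kappa>] open_UNIV open_greaterThan[of 0]]
  by (simp add: vimage_def)

lemma open_ell_pos_fst: "open {p :: complex \<times> 'a::topological_space. ell \<kappa> (fst p) > 0}"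
proof -
  have "{p :: complex \<times> 'a. ell \<kappa> (fst p) > 0} = {x. ell \<kappa> x > 0} \<times> UNIV" by auto
  then show ?thesis by (simp add: open_Times open_ell_pos)
qed

text \<open>Away from the origin this coefficient is
  \<open>((ell \<kappa> x)^2 - 1) / |x|^2\<close>, the excess of the squared radial stretch.\<close>

lemma metric_factor: "2 * \<kappa> + \<kappa>\<^sup>2 * (norm x)\<^sup>2 = \<kappa> * (ell \<kappa> x + 1)"
  by (simp add: ell_def power2_eq_square algebra_simps)

lemma inner_flat: "x \<bullet> flat \<kappa> x v = ell \<kappa> x * (x \<bullet> v)"
  by (simp add: flat_def inner_add_right ell_def power2_norm_eq_inner algebra_simps)

lemma inner_unflat: "ell \<kappa> x \<noteq> 0 \<Longrightarrow> x \<bullet> unflat \<kappa> x n = (x \<bullet> n) / ell \<kappa> x"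
  by (simp add: unflat_def inner_diff_right field_simps) (simp add: ell_def power2_norm_eq_inner algebra_simps)

lemma flat_unflat: "ell \<kappa> x \<noteq> 0 \<Longrightarrow> flat \<kappa> x (unflat \<kappa> x n) = n"
  unfolding flat_def by (simp add: inner_unflat) (simp add: unflat_def)

lemma unflat_flat: "ell \<kappa> x \<noteq> 0 \<Longrightarrow> unflat \<kappa> x (flat \<kappa> x v) = v"
  unfolding unflat_def by (simp add: inner_flat) (simp add: flat_def)

lemma metric_flat: "metric_g \<kappa> x u v = flat \<kappa> x u \<bullet> flat \<kappa> x v"
  unfolding metric_cartesian metric_factor
  by (simp add: flat_def inner_add_left inner_add_right inner_commute[of u x] ell_def power2_norm_eq_inner
      algebra_simps)

lemma metric_flat_norm: "metric_g \<kappa> x v v = (norm (flat \<kappa> x v))\<^sup>2"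
  by (simp add: metric_flat power2_norm_eq_inner)

lemma rot_unflat:
  assumes "ell \<kappa> x > 0"
  shows "rot \<kappa> x v = \<i> * ((1 / ell \<kappa> x) *\<^sub>R (v + (\<kappa> * (ell \<kappa> x + 1) * (x \<bullet> v)) *\<^sub>R x))"
  using assms rot_eq[of \<kappa> x v] by (simp add: ell_def[symmetric] metric_factor scaleR_conv_of_real)

lemma inner_rot:
  assumes "ell \<kappa> x > 0"
  shows "x \<bullet> rot \<kappa> x v = (x \<bullet> (\<i> * v)) / ell \<kappa> x"
    and "v \<bullet> rot \<kappa> x v = - \<kappa> * (ell \<kappa> x + 1) * (x \<bullet> v) * (x \<bullet> (\<i> * v)) / ell \<kappa> x"
  unfolding rot_unflat[OF assms] using assms
  by (simp_all add: inner_complex_def field_simps)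

text \<open>An orientation-preserving isometry intertwines the rotations by 90 degrees. The
  verification multiplies by \<open>ell \<kappa> x\<close>, which leaves polynomial identities in
  the coordinates of \<open>x\<close> and \<open>v\<close>.\<close>

lemma flat_rot:
  assumes "ell \<kappa> x > 0"
  shows "flat \<kappa> x (rot \<kappa> x v) = \<i> * flat \<kappa> x v"
proof -
  define a b c d l t s where defs: "a = Re x" "b = Im x" "c = Re v" "d = Im v" "l = ell \<kappa> x"
    and ts: "t = x \<bullet> v" "s = x \<bullet> (\<i> * v)"
  have l: "l = 1 + \<kappa> * (a\<^sup>2 + b\<^sup>2)" "l > 0" using assms by (simp_all add: defs ell_coords)
  have ts': "t = a * c + b * d" "s = b * c - a * d" by (simp_all add: defs ts inner_complex_def)
  have 1: "\<kappa> * s * a - (d + \<kappa> * (l + 1) * t * b) = l * (- (d + \<kappa> * t * b))"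
    and 2: "\<kappa> * s * b + (c + \<kappa> * (l + 1) * t * a) = l * (c + \<kappa> * t * a)"
    unfolding l(1) ts' by algebra+
  have 3: "\<kappa> * (s / l) * a - (d + \<kappa> * (l + 1) * t * b) / l = - (d + \<kappa> * t * b)"
    "\<kappa> * (s / l) * b + (c + \<kappa> * (l + 1) * t * a) / l = c + \<kappa> * t * a"
    using 1 2 l(2) by (simp_all add: nonzero_divide_eq_eq nonzero_eq_divide_eq add_divide_distrib[symmetric]
        diff_divide_distrib[symmetric] mult_ac)
  show ?thesis
    unfolding flat_def inner_rot[OF assms] unfolding rot_unflat[OF assms] defs(5)[symmetric] ts[symmetric]
    using 3 by (simp add: complex_eq_iff defs(1-4)[symmetric] diff_divide_distrib add_divide_distrib)
qed

lemma flat_cmul: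
  assumes "ell \<kappa> x > 0"
  shows "flat \<kappa> x (cmul \<kappa> x \<omega> v) = \<omega> * flat \<kappa> x v"
proof -
  have "flat \<kappa> x (cmul \<kappa> x \<omega> v) = Re \<omega> *\<^sub>R flat \<kappa> x v + Im \<omega> *\<^sub>R flat \<kappa> x (rot \<kappa> x v)"
    by (simp add: cmul_def flat_def inner_add_right scaleR_add_right algebra_simps)
  then show ?thesis by (simp add: flat_rot[OF assms] complex_eq_iff)
qed

lemma chart_unflat:
  assumes "ell \<kappa> z > 0"
  shows "chart \<kappa> (z, n) = (z, unflat \<kappa> z n)"
  using assms cmul_frame_e[of \<kappa> z n]
  by (simp add: chart_def unflat_def ell_def scaleR_conv_of_real)

text \<open>The Koszul combination of the derivatives of the metric is a multiple of
  \<open>x \<bullet> u\<close> for every \<open>u\<close>, and so is the metric product of a radial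
  vector with \<open>u\<close>; hence the Christoffel vector points along \<open>x\<close>.
  Uniqueness is nondegeneracy, in the form of injectivity of \<open>flat\<close>.\<close>

lemma christoffel_eq:
  assumes "ell \<kappa> x > 0"
  shows "christoffel \<kappa> x v w =
    ((\<kappa>\<^sup>2 * (x \<bullet> v) * (x \<bullet> w) + \<kappa> * (ell \<kappa> x + 1) * (v \<bullet> w)) / (ell \<kappa> x)\<^sup>2) *\<^sub>R x" (is "_ = ?c *\<^sub>R x")
proof -
  define F where "F = 2 * \<kappa> + \<kappa>\<^sup>2 * (x \<bullet> x)"
  have F: "F = \<kappa> * (ell \<kappa> x + 1)" using metric_factor[of \<kappa> x] by (simp add: F_def power2_norm_eq_inner)
  have der: "frechet_derivative (\<lambda>y. metric_g \<kappa> y a b) (at x) =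
      (\<lambda>h. 2 * \<kappa>\<^sup>2 * (x \<bullet> h) * (x \<bullet> a) * (x \<bullet> b) + F * (h \<bullet> a) * (x \<bullet> b) + F * (x \<bullet> a) * (h \<bullet> b))" for a b
  proof (rule frechet_derivative_at[symmetric])
    show "((\<lambda>y. metric_g \<kappa> y a b) has_derivative
      (\<lambda>h. 2 * \<kappa>\<^sup>2 * (x \<bullet> h) * (x \<bullet> a) * (x \<bullet> b) + F * (h \<bullet> a) * (x \<bullet> b) + F * (x \<bullet> a) * (h \<bullet> b))) (at x)"
      unfolding metric_cartesian power2_norm_eq_inner F_def
      by (auto intro!: derivative_eq_intros simp: algebra_simps inner_commute)
  qed
  have K: "metric_g \<kappa> x (?c *\<^sub>R x) u = (\<kappa>\<^sup>2 * (x \<bullet> v) * (x \<bullet> w) + F * (v \<bullet> w)) * (x \<bullet> u)" for u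
  proof -
    have *: "flat \<kappa> x (c *\<^sub>R x) = (c * ell \<kappa> x) *\<^sub>R x" for c
      by (simp add: flat_def ell_def power2_norm_eq_inner algebra_simps)
    have "flat \<kappa> x (?c *\<^sub>R x) = (?c * ell \<kappa> x) *\<^sub>R x"
      by (rule *)
    then have "metric_g \<kappa> x (?c *\<^sub>R x) u = ?c * (ell \<kappa> x)\<^sup>2 * (x \<bullet> u)"
      by (simp add: metric_flat inner_flat power2_eq_square)
    then show ?thesis using assms by (simp add: F)
  qed
  have rhs: "(\<kappa>\<^sup>2 * (x \<bullet> v) * (x \<bullet> w) + F * (v \<bullet> w)) * (x \<bullet> u) =
     (frechet_derivative (\<lambda>y. metric_g \<kappa> y w u) (at x) v
    + frechet_derivative (\<lambda>y. metric_g \<kappa> y v u) (at x) w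
    - frechet_derivative (\<lambda>y. metric_g \<kappa> y v w) (at x) u) / 2" for u
    unfolding der by (simp add: inner_commute algebra_simps)
  show ?thesis unfolding christoffel_def rhs[symmetric]
  proof (rule the_equality)
    fix a assume a: "\<forall>u. metric_g \<kappa> x a u = (\<kappa>\<^sup>2 * (x \<bullet> v) * (x \<bullet> w) + F * (v \<bullet> w)) * (x \<bullet> u)"
    define d where "d = a - ?c *\<^sub>R x"
    have "metric_g \<kappa> x d d = metric_g \<kappa> x a d - metric_g \<kappa> x (?c *\<^sub>R x) d"
      by (simp add: metric_cartesian d_def inner_diff_left inner_diff_right algebra_simps)
    then have "flat \<kappa> x d = 0" using a K by (simp add: metric_flat_norm)
    then have "d = unflat \<kappa> x 0" using unflat_flat[of \<kappa> x d] assms by simp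
    then show "a = ?c *\<^sub>R x" by (simp add: d_def unflat_def)
  qed (use K in auto)
qed

section \<open>Derivatives of the basic fields and the bracket\<close>

lemma flat_has_derivative:
  "((\<lambda>(x, v). flat \<kappa> x v) has_derivative
     (\<lambda>(h, k). k + (\<kappa> * (h \<bullet> v + x \<bullet> k)) *\<^sub>R x + (\<kappa> * (x \<bullet> v)) *\<^sub>R h)) (at (x, v))"
  unfolding flat_def case_prod_unfold
  by (auto intro!: derivative_eq_intros simp: algebra_simps)

lemma rot_has_derivative:
  assumes l: "ell \<kappa> x > 0"
  shows "((\<lambda>(x, v). rot \<kappa> x v) has_derivative
     (\<lambda>(h, k). \<i> * ((- 2 * \<kappa> * (x \<bullet> h) / (ell \<kappa> x)\<^sup>2) *\<^sub>R (v + (\<kappa> * (ell \<kappa> x + 1) * (x \<bullet> v)) *\<^sub>R x)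
        + (1 / ell \<kappa> x) *\<^sub>R (k + (2 * \<kappa>\<^sup>2 * (x \<bullet> h) * (x \<bullet> v) + \<kappa> * (ell \<kappa> x + 1) * (h \<bullet> v + x \<bullet> k)) *\<^sub>R x
            + (\<kappa> * (ell \<kappa> x + 1) * (x \<bullet> v)) *\<^sub>R h)))) (at (x, v))"
proof (rule has_derivative_transform_within_open[OF _ open_ell_pos_fst[of \<kappa>]])
  show "((\<lambda>(x, v). \<i> * ((1 / ell \<kappa> x) *\<^sub>R (v + (\<kappa> * (ell \<kappa> x + 1) * (x \<bullet> v)) *\<^sub>R x))) has_derivative
     (\<lambda>(h, k). \<i> * ((- 2 * \<kappa> * (x \<bullet> h) / (ell \<kappa> x)\<^sup>2) *\<^sub>R (v + (\<kappa> * (ell \<kappa> x + 1) * (x \<bullet> v)) *\<^sub>R x)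
        + (1 / ell \<kappa> x) *\<^sub>R (k + (2 * \<kappa>\<^sup>2 * (x \<bullet> h) * (x \<bullet> v) + \<kappa> * (ell \<kappa> x + 1) * (h \<bullet> v + x \<bullet> k)) *\<^sub>R x
            + (\<kappa> * (ell \<kappa> x + 1) * (x \<bullet> v)) *\<^sub>R h)))) (at (x, v))"
    using l unfolding case_prod_unfold ell_def power2_norm_eq_inner
    by (auto intro!: derivative_eq_intros ext simp: inner_commute power2_eq_square)
      (simp add: algebra_simps divide_simps)
qed (use l in \<open>auto simp: rot_unflat\<close>)

lemma frechet_derivativeI: "(f has_derivative D) (at x) \<Longrightarrow> frechet_derivative f (at x) = D"
  by (rule frechet_derivative_at[symmetric])

text \<open>The bracket with the vertical field differentiates the geodesic field along vectors
  \<open>(0, k)\<close>. In these directions the field is quadratic, whence the factor 2; the other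
  values of \<open>D\<close> are left unspecified.\<close>

lemma geodesic_field_has_derivative:
  assumes l: "ell \<kappa> x > 0"
  shows "\<exists>D. (geodesic_field \<kappa> has_derivative D) (at (x, v)) \<and>
    (\<forall>k. D (0, k) = (k, - 2 *\<^sub>R christoffel \<kappa> x v k))"
proof -
  let ?G = "\<lambda>p :: complex \<times> complex. (snd p, - (((\<kappa>\<^sup>2 * (fst p \<bullet> snd p) * (fst p \<bullet> snd p) +
      \<kappa> * (ell \<kappa> (fst p) + 1) * (snd p \<bullet> snd p)) * inverse ((ell \<kappa> (fst p))\<^sup>2)) *\<^sub>R fst p))"
  have "((\<lambda>p. ell \<kappa> (fst p)) has_derivative (\<lambda>h. 2 * \<kappa> * (x \<bullet> fst h))) (at (x, v))"
    unfolding ell_def power2_norm_eq_inner by (auto intro!: derivative_eq_intros simp: inner_commute)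
  note [derivative_intros] = this
  have ne: "ell \<kappa> x \<noteq> 0" "(ell \<kappa> x)\<^sup>2 \<noteq> 0" using l by auto
  obtain D where D: "(?G has_derivative D) (at (x, v))" "\<And>k. D (0, k) = (k, - 2 *\<^sub>R christoffel \<kappa> x v k)"
  proof
    let ?n = "(\<kappa>\<^sup>2 * (x \<bullet> v) * (x \<bullet> v) + \<kappa> * (ell \<kappa> x + 1) * (v \<bullet> v))"
    let ?m = "\<lambda>h k. 2 * \<kappa>\<^sup>2 * (x \<bullet> v) * (h \<bullet> v + x \<bullet> k) + \<kappa> * (2 * \<kappa> * (x \<bullet> h)) * (v \<bullet> v)
      + 2 * \<kappa> * (ell \<kappa> x + 1) * (v \<bullet> k)"
    let ?i = "\<lambda>h. - 2 * (2 * \<kappa> * (x \<bullet> h)) * inverse (ell \<kappa> x ^ 3)"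
    show "(?G has_derivative (\<lambda>p. (snd p, - ((?n * inverse ((ell \<kappa> x)\<^sup>2)) *\<^sub>R fst p
       + (?m (fst p) (snd p) * inverse ((ell \<kappa> x)\<^sup>2) + ?n * ?i (fst p)) *\<^sub>R x)))) (at (x, v))"
      using ne by (auto intro!: derivative_eq_intros ext simp: inner_commute field_simps eval_nat_numeral)
    fix k show "(\<lambda>p. (snd p, - ((?n * inverse ((ell \<kappa> x)\<^sup>2)) *\<^sub>R fst p
       + (?m (fst p) (snd p) * inverse ((ell \<kappa> x)\<^sup>2) + ?n * ?i (fst p)) *\<^sub>R x))) (0, k) =
       (k, - 2 *\<^sub>R christoffel \<kappa> x v k)"
      unfolding christoffel_eq[OF l] by (simp add: complex_eq_iff algebra_simps divide_inverse)
  qed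
  have "(geodesic_field \<kappa> has_derivative D) (at (x, v))"
    by (rule has_derivative_transform_within_open[OF D(1) open_ell_pos_fst[of \<kappa>]])
      (use l in \<open>auto simp: geodesic_field_def christoffel_eq divide_inverse\<close>)
  then show ?thesis using D(2) by blast
qed

text \<open>One coordinate of the parallelism of the rotation, with denominators cleared. The second
  hypothesis is a coordinate of
  \<open>|x|^2 v = (x \<bullet> v) x - (x \<bullet> \<i> v) \<i> x\<close>, so
  \<open>(b, - a, d)\<close> in place of \<open>(a, b, c)\<close> gives the other
  coordinate.\<close>

lemma rot_parallel_identity:
  fixes \<kappa> L a b c n r s t :: real
  assumes r: "\<kappa> * r = L - 1" and c: "c * (L - 1) = \<kappa> * t * a + \<kappa> * b * s"
  shows "L * (- 2 * \<kappa> * t) * (c + \<kappa> * (L + 1) * t * a) - (\<kappa>\<^sup>2 * t * t + \<kappa> * (L + 1) * n) * a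
     + (2 * \<kappa>\<^sup>2 * t * t * L\<^sup>2 * a + \<kappa> * (L + 1) * (n * L\<^sup>2 - (\<kappa>\<^sup>2 * t * t + \<kappa> * (L + 1) * n) * r) * a
          + L\<^sup>2 * \<kappa> * (L + 1) * t * c)
     = - (\<kappa>\<^sup>2 * t * s - \<kappa> * (L + 1) * (\<kappa> * (L + 1) * t * s)) * b"
proof -
  have 1: "\<kappa> * (L + 1) * (n * L\<^sup>2 - (\<kappa>\<^sup>2 * t * t + \<kappa> * (L + 1) * n) * r)
      = (L + 1) * (\<kappa> * n * L\<^sup>2 - (\<kappa>\<^sup>2 * t * t + \<kappa> * (L + 1) * n) * (\<kappa> * r))" by algebra
  have 2: "c * L\<^sup>2 * \<kappa> * (L + 1) * t + L * (- 2 * \<kappa> * t) * c = \<kappa> * t * L * (L + 2) * (c * (L - 1))" by algebra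
  show ?thesis using 2 unfolding 1 r c by algebra
qed

text \<open>The second component says that the rotation is parallel.\<close>

lemma lie_bracket_geodesic_vertical:
  assumes l: "ell \<kappa> x > 0"
  shows "lie_bracket (geodesic_field \<kappa>) (vertical_field \<kappa>) (x, v) =
    (- rot \<kappa> x v, christoffel \<kappa> x v (rot \<kappa> x v))"
proof -
  obtain D where D: "(geodesic_field \<kappa> has_derivative D) (at (x, v))"
    "\<And>k. D (0, k) = (k, - 2 *\<^sub>R christoffel \<kappa> x v k)"
    using geodesic_field_has_derivative[OF l] by metis
  define D' where "D' = (\<lambda>(h, k). \<i> * ((- 2 * \<kappa> * (x \<bullet> h) / (ell \<kappa> x)\<^sup>2) *\<^sub>R (v + (\<kappa> * (ell \<kappa> x + 1) * (x \<bullet> v)) *\<^sub>R x)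
        + (1 / ell \<kappa> x) *\<^sub>R (k + (2 * \<kappa>\<^sup>2 * (x \<bullet> h) * (x \<bullet> v) + \<kappa> * (ell \<kappa> x + 1) * (h \<bullet> v + x \<bullet> k)) *\<^sub>R x
            + (\<kappa> * (ell \<kappa> x + 1) * (x \<bullet> v)) *\<^sub>R h)))"
  have "((\<lambda>(x, v). rot \<kappa> x v) has_derivative D') (at (x, v))"
    using rot_has_derivative[OF l] unfolding D'_def .
  then have "(vertical_field \<kappa> has_derivative (\<lambda>p. (0, D' p))) (at (x, v))"
    unfolding vertical_field_def case_prod_unfold by (auto intro!: derivative_eq_intros)
  note fd = frechet_derivativeI[OF this] frechet_derivativeI[OF D(1)]
  have parallel: "D' (v, - christoffel \<kappa> x v v) = - christoffel \<kappa> x v (rot \<kappa> x v)"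
  proof -
    define a b c d L where defs: "a = Re x" "b = Im x" "c = Re v" "d = Im v" "L = ell \<kappa> x"
    define t s where ts: "t = a * c + b * d" "s = b * c - a * d"
    have L: "L = 1 + \<kappa> * (a\<^sup>2 + b\<^sup>2)" "L > 0" using l by (simp_all add: defs ell_coords)
    have ix: "x \<bullet> v = t" "x \<bullet> (\<i> * v) = s" "x \<bullet> x = a\<^sup>2 + b\<^sup>2" "v \<bullet> v = c\<^sup>2 + d\<^sup>2" "v \<bullet> x = t"
      by (simp_all add: inner_complex_def defs ts power2_eq_square algebra_simps)
    define K where "K = (\<kappa>\<^sup>2 * t * t + \<kappa> * (L + 1) * (c\<^sup>2 + d\<^sup>2)) / L\<^sup>2"
    define M where "M = (\<kappa>\<^sup>2 * t * (s / L) + \<kappa> * (L + 1) * (- \<kappa> * (L + 1) * t * s / L)) / L\<^sup>2"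
    define P where "P = - 2 * \<kappa> * t / L\<^sup>2"
    define Q where "Q = 2 * \<kappa>\<^sup>2 * t * t + \<kappa> * (L + 1) * (c\<^sup>2 + d\<^sup>2 - K * (a\<^sup>2 + b\<^sup>2))"
    have c1: "christoffel \<kappa> x v v = K *\<^sub>R x"
      unfolding christoffel_eq[OF l] ix defs(5)[symmetric] K_def ..
    have c2: "christoffel \<kappa> x v (rot \<kappa> x v) = M *\<^sub>R x"
      unfolding christoffel_eq[OF l] inner_rot[OF l] ix defs(5)[symmetric] M_def ..
    have D'v: "D' (v, - (K *\<^sub>R x)) = \<i> * (P *\<^sub>R (v + (\<kappa> * (L + 1) * t) *\<^sub>R x)
        + (1 / L) *\<^sub>R (- (K *\<^sub>R x) + Q *\<^sub>R x + (\<kappa> * (L + 1) * t) *\<^sub>R v))"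
      unfolding D'_def P_def Q_def
      by (simp add: ix defs(5)[symmetric])
    have L1: "L - 1 = \<kappa> * (a\<^sup>2 + b\<^sup>2)" by (simp add: L(1))
    note r1 = L1[symmetric]
    have KL: "K * L\<^sup>2 = \<kappa>\<^sup>2 * t * t + \<kappa> * (L + 1) * (c\<^sup>2 + d\<^sup>2)" using L(2) by (simp add: K_def)
    have MM: "M * L ^ 3 = \<kappa>\<^sup>2 * t * s - \<kappa> * (L + 1) * (\<kappa> * (L + 1) * t * s)"
      using L(2) by (simp add: M_def field_simps eval_nat_numeral)
    have PL: "P * L\<^sup>2 = - 2 * \<kappa> * t" using L(2) by (simp add: P_def)
    \<comment> \<open>\<open>L ^ 3\<close> is a common denominator of \<open>P\<close>,
      \<open>K / L\<close>, \<open>Q / L\<close> and \<open>M\<close>. Once it is cleared,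
      \<open>rot_parallel_identity\<close> serves the real part here and the imaginary part
      below.\<close>
    have "L ^ 3 * (P * (c + \<kappa> * (L + 1) * t * a) + (1 / L) * (- (K * a) + Q * a + \<kappa> * (L + 1) * t * c))
       = L * (P * L\<^sup>2) * (c + \<kappa> * (L + 1) * t * a) - (K * L\<^sup>2) * a + L\<^sup>2 * (Q * a + \<kappa> * (L + 1) * t * c)"
      using L(2) by (simp add: field_simps eval_nat_numeral)
    also have "L\<^sup>2 * (Q * a + \<kappa> * (L + 1) * t * c) =
        2 * \<kappa>\<^sup>2 * t * t * L\<^sup>2 * a + \<kappa> * (L + 1) * ((c\<^sup>2 + d\<^sup>2) * L\<^sup>2 - (K * L\<^sup>2) * (a\<^sup>2 + b\<^sup>2)) * a
          + L\<^sup>2 * \<kappa> * (L + 1) * t * c"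
      unfolding Q_def by algebra
    finally have e1: "L ^ 3 * (P * (c + \<kappa> * (L + 1) * t * a) + (1 / L) * (- (K * a) + Q * a + \<kappa> * (L + 1) * t * c))
       = - (M * L ^ 3) * b" unfolding KL MM PL 
      by (rule trans[OF _ rot_parallel_identity[OF r1]]) (unfold L1 ts, algebra)
    have "L ^ 3 * (P * (d + \<kappa> * (L + 1) * t * b) + (1 / L) * (- (K * b) + Q * b + \<kappa> * (L + 1) * t * d))
       = L * (P * L\<^sup>2) * (d + \<kappa> * (L + 1) * t * b) - (K * L\<^sup>2) * b + L\<^sup>2 * (Q * b + \<kappa> * (L + 1) * t * d)"
      using L(2) by (simp add: field_simps eval_nat_numeral)
    also have "L\<^sup>2 * (Q * b + \<kappa> * (L + 1) * t * d) =
        2 * \<kappa>\<^sup>2 * t * t * L\<^sup>2 * b + \<kappa> * (L + 1) * ((c\<^sup>2 + d\<^sup>2) * L\<^sup>2 - (K * L\<^sup>2) * (a\<^sup>2 + b\<^sup>2)) * b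
          + L\<^sup>2 * \<kappa> * (L + 1) * t * d"
      unfolding Q_def by algebra
    finally have e2: "L ^ 3 * (P * (d + \<kappa> * (L + 1) * t * b) + (1 / L) * (- (K * b) + Q * b + \<kappa> * (L + 1) * t * d))
       = - (M * L ^ 3) * (- a)" unfolding KL MM PL 
      by (rule trans[OF _ rot_parallel_identity[OF r1]]) (unfold L1 ts, algebra)
    have "L ^ 3 \<noteq> 0" using L(2) by simp
    from e1 have "L ^ 3 * (P * (c + \<kappa> * (L + 1) * t * a) + (1 / L) * (- (K * a) + Q * a + \<kappa> * (L + 1) * t * c))
       = L ^ 3 * (- (M * b))" by simp
    with \<open>L ^ 3 \<noteq> 0\<close> have e1': "P * (c + \<kappa> * (L + 1) * t * a) + (1 / L) * (- (K * a) + Q * a + \<kappa> * (L + 1) * t * c)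
       = - (M * b)" by (simp only: mult_cancel_left) simp
    from e2 have "L ^ 3 * (P * (d + \<kappa> * (L + 1) * t * b) + (1 / L) * (- (K * b) + Q * b + \<kappa> * (L + 1) * t * d))
       = L ^ 3 * (M * a)" by simp
    with \<open>L ^ 3 \<noteq> 0\<close> have e2': "P * (d + \<kappa> * (L + 1) * t * b) + (1 / L) * (- (K * b) + Q * b + \<kappa> * (L + 1) * t * d)
       = M * a" by (simp only: mult_cancel_left) simp
    show ?thesis unfolding c1 c2 D'v
      using e1' e2' by (simp add: complex_eq_iff defs(1-4)[symmetric])
  qed
  show ?thesis
    unfolding lie_bracket_def fd
    by (simp add: geodesic_field_def vertical_field_def D(2) parallel scaleR_2)
qed

section \<open>The transport distribution as a kernel\<close>

lemma cext_add: "linear \<phi> \<Longrightarrow> cext \<phi> (L + M) = cext \<phi> L + cext \<phi> M"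
  by (cases L; cases M) (simp add: cext_def linear_add algebra_simps)

lemma cext_diff: "linear \<phi> \<Longrightarrow> cext \<phi> (L - M) = cext \<phi> L - cext \<phi> M"
  by (cases L; cases M) (simp add: cext_def linear_diff algebra_simps)

lemma cext_cscale: "linear \<phi> \<Longrightarrow> cext \<phi> (cscale c L) = c * cext \<phi> L"
  by (cases L)
    (simp add: cext_def cscale_def linear_add linear_diff linear_cmul complex_eq_iff algebra_simps)

lemma cext_cpush: "cext \<phi> (cpush T L) = cext (\<phi> \<circ> T) L"
  by (cases L) (simp add: cext_def cpush_def)

lemma cext_real: "linear \<phi> \<Longrightarrow> cext \<phi> (a, 0) = \<phi> a"
  by (simp add: cext_def linear_0)

lemma linear_coords:
  "linear (fst :: complex \<times> complex \<Rightarrow> complex)" "linear (snd :: complex \<times> complex \<Rightarrow> complex)"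
  "linear (cnj \<circ> fst :: complex \<times> complex \<Rightarrow> complex)" "linear (cnj \<circ> snd :: complex \<times> complex \<Rightarrow> complex)"
  by (auto intro!: linearI simp: scaleR_conv_of_real)

text \<open>\<open>fst\<close>, \<open>snd\<close> and their conjugates extend to a basis of the
  complex-linear forms on the complexified tangent space, so they separate its vectors.\<close>

lemma cplx_coords_eqI:
  fixes L M :: "(complex \<times> complex) cplx"
  assumes "cext fst L = cext fst M" "cext (cnj \<circ> fst) L = cext (cnj \<circ> fst) M"
    and "cext snd L = cext snd M" "cext (cnj \<circ> snd) L = cext (cnj \<circ> snd) M"
  shows "L = M"
proof -
  obtain a b c d where L: "L = ((a, b), (c, d))" by (metis surj_pair)
  obtain a' b' c' d' where M: "M = ((a', b'), (c', d'))" by (metis surj_pair)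
  have "a = a' \<and> c = c'" "b = b' \<and> d = d'"
    using assms unfolding L M cext_def by (auto simp: complex_eq_iff)
  then show ?thesis by (simp add: L M)
qed

text \<open>The three coefficients of \<open>Xi\<close>: at \<open>d_z\<close>, at
  \<open>d_zbar\<close>, and, in \<open>xi_nu\<close>, at the rotational field in the
  \<nu>-plane.\<close>

definition xi_z :: "real \<Rightarrow> complex \<Rightarrow> complex \<Rightarrow> complex" where
  "xi_z \<kappa> z n = (2 + \<kappa> * z * cnj z) * n\<^sup>2 - \<kappa> * z\<^sup>2"

definition xi_zbar :: "real \<Rightarrow> complex \<Rightarrow> complex \<Rightarrow> complex" where
  "xi_zbar \<kappa> z n = 2 + \<kappa> * z * cnj z - \<kappa> * n\<^sup>2 * (cnj z)\<^sup>2"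

definition xi_nu :: "real \<Rightarrow> complex \<Rightarrow> complex \<Rightarrow> complex" where
  "xi_nu \<kappa> z n = \<kappa> * (z - n\<^sup>2 * cnj z)"

lemma norm_power4: "complex_of_real (norm n ^ 4) = (n * cnj n)\<^sup>2"
  using complex_norm_square[of n]
  by (metis (no_types, lifting) of_real_power power2_eq_square power4_eq_xxxx mult.assoc)

text \<open>Up to sign and modulo the \<nu>-directions this is the determinant of \<open>Xi\<close>
  and its conjugate. Its decay like \<open>1 - |\<nu>|^4\<close> at |\<nu>| = 1 is what the
  normalization of \<eta>1 compensates.\<close>

lemma xi_norm:
  "xi_zbar \<kappa> z n * cnj (xi_zbar \<kappa> z n) - xi_z \<kappa> z n * cnj (xi_z \<kappa> z n)
    = 4 * of_real (ell \<kappa> z) * (1 - of_real (norm n ^ 4))"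
  unfolding norm_power4 ell_complex xi_z_def xi_zbar_def
  by (simp only: complex_cnj_diff complex_cnj_add complex_cnj_mult complex_cnj_power complex_cnj_cnj
      complex_cnj_numeral complex_cnj_complex_of_real) algebra

lemma xi_zbar_nonzero:
  assumes "ell \<kappa> z > 0" "norm n < 1"
  shows "(norm (xi_zbar \<kappa> z n))\<^sup>2 - (norm (xi_z \<kappa> z n))\<^sup>2 > 0" and "xi_zbar \<kappa> z n \<noteq> 0"
proof -
  have "complex_of_real ((norm (xi_zbar \<kappa> z n))\<^sup>2 - (norm (xi_z \<kappa> z n))\<^sup>2) =
      of_real (4 * ell \<kappa> z * (1 - norm n ^ 4))"
    using xi_norm[of \<kappa> z n] unfolding complex_norm_square[symmetric] by simp
  then have "(norm (xi_zbar \<kappa> z n))\<^sup>2 - (norm (xi_z \<kappa> z n))\<^sup>2 = 4 * ell \<kappa> z * (1 - norm n ^ 4)"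
    by (simp only: of_real_eq_iff)
  moreover have "norm n ^ 4 < 1" using assms(2) by (simp add: power_Suc_less_one power_less_one_iff)
  ultimately show "(norm (xi_zbar \<kappa> z n))\<^sup>2 - (norm (xi_z \<kappa> z n))\<^sup>2 > 0" using assms by simp
  moreover have "(norm (xi_z \<kappa> z n))\<^sup>2 \<ge> 0" by simp
  ultimately show "xi_zbar \<kappa> z n \<noteq> 0" by force
qed

lemma of_real_inner: "complex_of_real (x \<bullet> n) = (x * cnj n + cnj x * n) / 2"
  by (simp add: complex_eq_iff inner_complex_def)

lemma unflat_complex:
  assumes "ell \<kappa> x \<noteq> 0"
  shows "unflat \<kappa> x n = ((2 + \<kappa> * x * cnj x) * n - \<kappa> * x\<^sup>2 * cnj n) / (2 * of_real (ell \<kappa> x))"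
proof -
  have "unflat \<kappa> x n = n - of_real \<kappa> * ((x * cnj n + cnj x * n) / 2) / of_real (ell \<kappa> x) * x"
    by (simp add: unflat_def scaleR_conv_of_real of_real_inner)
  also have "\<dots> = (2 * of_real (ell \<kappa> x) * n - of_real \<kappa> * (x * cnj n + cnj x * n) * x) / (2 * of_real (ell \<kappa> x))"
    using assms by (simp add: field_simps)
  also have "2 * of_real (ell \<kappa> x) * n - of_real \<kappa> * (x * cnj n + cnj x * n) * x =
      (2 + \<kappa> * x * cnj x) * n - \<kappa> * x\<^sup>2 * cnj n"
    unfolding ell_complex by algebra
  finally show ?thesis .
qed

definition flat_deriv :: "real \<Rightarrow> complex \<Rightarrow> complex \<Rightarrow> complex \<times> complex \<Rightarrow> complex" where
  "flat_deriv \<kappa> x v = (\<lambda>(h, k). k + (\<kappa> * (h \<bullet> v + x \<bullet> k)) *\<^sub>R x + (\<kappa> * (x \<bullet> v)) *\<^sub>R h)"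

lemma linear_flat_deriv: "linear (flat_deriv \<kappa> x v)"
  unfolding flat_deriv_def
  by (auto intro!: linearI simp: inner_add_left inner_add_right algebra_simps)

text \<open>Along a geodesic the flat velocity \<open>n = flat \<kappa> x v\<close> keeps its
  Euclidean length, so it can only rotate; the rate is the angular momentum
  \<open>Im (x * cnj n)\<close> times \<open>- \<kappa> / ell \<kappa> x\<close>.\<close>

lemma flat_deriv_geodesic_field:
  assumes l: "ell \<kappa> x > 0"
  shows "flat_deriv \<kappa> x v (geodesic_field \<kappa> (x, v)) =
    - (\<kappa> * Im (x * cnj (flat \<kappa> x v)) / ell \<kappa> x) *\<^sub>R (\<i> * flat \<kappa> x v)"
proof -
  define a b c d L t q where defs: "a = Re x" "b = Im x" "c = Re v" "d = Im v" "L = ell \<kappa> x" "t = x \<bullet> v"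
    "q = Im (x * cnj (flat \<kappa> x v))"
  have L: "L = 1 + \<kappa> * (a\<^sup>2 + b\<^sup>2)" "L > 0" using l by (simp_all add: defs ell_coords)
  have t: "t = a * c + b * d" by (simp add: defs inner_complex_def)
  have q: "q = b * c - a * d"
    by (simp add: defs flat_def inner_complex_def algebra_simps)
  define n where "n = c\<^sup>2 + d\<^sup>2"
  have vv: "v \<bullet> v = n" "x \<bullet> x = a\<^sup>2 + b\<^sup>2" by (simp_all add: n_def defs inner_complex_def power2_eq_square)
  define K where "K = (\<kappa>\<^sup>2 * t * t + \<kappa> * (L + 1) * n) / L\<^sup>2"
  have KL: "K * L\<^sup>2 = \<kappa>\<^sup>2 * t * t + \<kappa> * (L + 1) * n" using L(2) by (simp add: K_def)
  have KL': "L * (\<kappa> * n - K * L) = - \<kappa> * (n + \<kappa> * t\<^sup>2)" using KL by algebra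
  have "flat_deriv \<kappa> x v (geodesic_field \<kappa> (x, v)) = (- K + \<kappa> * (n - K * (a\<^sup>2 + b\<^sup>2))) *\<^sub>R x + (\<kappa> * t) *\<^sub>R v"
    unfolding geodesic_field_def case_prod_conv christoffel_eq[OF l] flat_deriv_def vv defs(6)[symmetric] defs(5)[symmetric]
      K_def[symmetric]
    by (simp add: vv algebra_simps)
  also have "- K + \<kappa> * (n - K * (a\<^sup>2 + b\<^sup>2)) = - \<kappa> * (n + \<kappa> * t\<^sup>2) / L"
    using KL' L by (simp add: field_simps)
  also have "(- \<kappa> * (n + \<kappa> * t\<^sup>2) / L) *\<^sub>R x + (\<kappa> * t) *\<^sub>R v = - (\<kappa> / L) *\<^sub>R ((n + \<kappa> * t\<^sup>2) *\<^sub>R x - (t * L) *\<^sub>R v)"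
    using L(2) by (simp add: complex_eq_iff field_simps)
  also have "(n + \<kappa> * t\<^sup>2) *\<^sub>R x - (t * L) *\<^sub>R v = q *\<^sub>R (\<i> * flat \<kappa> x v)"
  proof -
    have "(n + \<kappa> * t\<^sup>2) * a - t * L * c = q * - (d + \<kappa> * t * b)" "(n + \<kappa> * t\<^sup>2) * b - t * L * d = q * (c + \<kappa> * t * a)"
      unfolding n_def t L q by algebra+
    then show ?thesis by (simp add: complex_eq_iff flat_def defs(1-4)[symmetric] defs(6)[symmetric] algebra_simps)
  qed
  finally show ?thesis unfolding defs(7)[symmetric] defs(5)[symmetric] by (simp add: mult_ac)
qed

text \<open>The formula for the geodesic field in the direction turned by -90 degrees: the base
  component has flat image \<open>- \<i> * n\<close>, and \<open>Im (x * cnj (- \<i> * n))\<close>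
  is \<open>x \<bullet> n\<close>.\<close>

lemma flat_deriv_bracket:
  assumes l: "ell \<kappa> x > 0"
  shows "flat_deriv \<kappa> x v (- rot \<kappa> x v, christoffel \<kappa> x v (rot \<kappa> x v)) =
    - (\<kappa> * (x \<bullet> flat \<kappa> x v) / ell \<kappa> x) *\<^sub>R (\<i> * flat \<kappa> x v)"
proof -
  define L t s r where defs: "L = ell \<kappa> x" "t = x \<bullet> v" "s = x \<bullet> (\<i> * v)" "r = rot \<kappa> x v"
  have L: "L > 0" using l by (simp add: defs)
  have xx: "\<kappa> * (x \<bullet> x) = L - 1" by (simp add: defs ell_def power2_norm_eq_inner)
  define y where "y = s / L"
  have s: "s = y * L" using L by (simp add: y_def)
  have r: "x \<bullet> r = y" "r \<bullet> v = - \<kappa> * (L + 1) * t * y" "v \<bullet> r = - \<kappa> * (L + 1) * t * y"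
    using inner_rot[OF l, of v] by (simp_all add: defs inner_commute y_def)
  define M where "M = (\<kappa>\<^sup>2 * t * y + \<kappa> * (L + 1) * (- \<kappa> * (L + 1) * t * y)) / L\<^sup>2"
  have c: "christoffel \<kappa> x v r = M *\<^sub>R x"
    unfolding christoffel_eq[OF l] defs(1,2)[symmetric] r M_def ..
  have 1: "M + \<kappa> * M * (x \<bullet> x) - \<kappa> * (r \<bullet> v) = - \<kappa>\<^sup>2 * t * y"
  proof -
    have "M * L\<^sup>2 = \<kappa>\<^sup>2 * t * y - \<kappa> * (L + 1) * (\<kappa> * (L + 1) * t * y)"
      using L by (simp add: M_def)
    then have "L * (M * L + \<kappa> * (\<kappa> * (L + 1) * t * y)) = L * (- \<kappa>\<^sup>2 * t * y)" by algebra
    then have "M * L + \<kappa> * (\<kappa> * (L + 1) * t * y) = - \<kappa>\<^sup>2 * t * y"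
      using L by (simp only: mult_cancel_left) simp
    moreover have "M + \<kappa> * M * (x \<bullet> x) = M * (1 + \<kappa> * (x \<bullet> x))" by (simp add: algebra_simps)
    ultimately show ?thesis by (simp add: r xx)
  qed
  have "flat_deriv \<kappa> x v (- r, M *\<^sub>R x) = (M + \<kappa> * M * (x \<bullet> x) - \<kappa> * (r \<bullet> v)) *\<^sub>R x - (\<kappa> * t) *\<^sub>R r"
    by (simp add: flat_deriv_def defs(2)[symmetric] algebra_simps)
  also have "\<dots> = - (\<kappa> * t) *\<^sub>R flat \<kappa> x r"
    unfolding 1 by (simp add: flat_def r algebra_simps power2_eq_square)
  also have "flat \<kappa> x r = \<i> * flat \<kappa> x v" unfolding defs(4) by (rule flat_rot[OF l])
  finally show ?thesis using L unfolding defs(4)[symmetric] c by (simp add: inner_flat defs(1,2)[symmetric])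
qed

text \<open>The derivative of \<open>proj_p\<close> at \<open>((x, v), \<omega>)\<close> read in
  flat coordinates, where \<open>proj_p\<close> becomes
  \<open>(x, \<omega> * flat \<kappa> x v)\<close>.\<close>

definition push_flat :: "real \<Rightarrow> complex \<Rightarrow> complex \<Rightarrow> complex \<Rightarrow> (complex \<times> complex) \<times> complex \<Rightarrow> complex \<times> complex" where
  "push_flat \<kappa> x v \<omega> = (\<lambda>(h, w). (fst h, \<omega> * flat_deriv \<kappa> x v h + w * flat \<kappa> x v))"

lemma linear_push_flat: "linear (push_flat \<kappa> x v \<omega>)"
  unfolding push_flat_def case_prod_unfold
  by (rule linearI) (simp_all add: linear_add[OF linear_flat_deriv] linear_cmul[OF linear_flat_deriv] algebra_simps)

lemma cext_generator:
  assumes l: "ell \<kappa> x > 0" and lin: "linear \<phi>"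
  shows "cext \<phi> (cpush (push_flat \<kappa> x v \<omega>)
      (cscale a (lift_cplx (eta_minus \<kappa> (x, v) + cscale (\<omega>\<^sup>2) (eta_plus \<kappa> (x, v)))) + cscale b d_omega_bar)) =
    a * ((\<phi> (v, - (\<kappa> * Im (x * cnj (flat \<kappa> x v)) / ell \<kappa> x) *\<^sub>R (\<i> * \<omega> * flat \<kappa> x v)) * (1 + \<omega>\<^sup>2)
      - \<phi> (- rot \<kappa> x v, - (\<kappa> * (x \<bullet> flat \<kappa> x v) / ell \<kappa> x) *\<^sub>R (\<i> * \<omega> * flat \<kappa> x v)) * \<i> * (1 - \<omega>\<^sup>2)) / 2)
    + b * ((\<phi> (0, flat \<kappa> x v) + \<i> * \<phi> (0, \<i> * flat \<kappa> x v)) / 2)"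
proof -
  define T where "T = push_flat \<kappa> x v \<omega>"
  have linT: "linear (\<phi> \<circ> T)" unfolding T_def by (intro linear_compose linear_push_flat lin)
  have linT1: "linear (\<phi> \<circ> T \<circ> (\<lambda>h. (h, 0)))"
    by (intro linear_compose[OF _ linT]) (auto intro!: linearI)
  have T: "T (geodesic_field \<kappa> (x, v), 0) = (v, - (\<kappa> * Im (x * cnj (flat \<kappa> x v)) / ell \<kappa> x) *\<^sub>R (\<i> * \<omega> * flat \<kappa> x v))"
    "T ((- rot \<kappa> x v, christoffel \<kappa> x v (rot \<kappa> x v)), 0) =
      (- rot \<kappa> x v, - (\<kappa> * (x \<bullet> flat \<kappa> x v) / ell \<kappa> x) *\<^sub>R (\<i> * \<omega> * flat \<kappa> x v))"
    unfolding T_def push_flat_def using flat_deriv_geodesic_field[OF l, of v] flat_deriv_bracket[OF l, of v]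
    by (simp_all add: scaleR_conv_of_real) (simp add: geodesic_field_def)
  define P Q S where "P = \<phi> (T (geodesic_field \<kappa> (x, v), 0))"
    and "Q = \<phi> (T ((- rot \<kappa> x v, christoffel \<kappa> x v (rot \<kappa> x v)), 0))"
    and "S = \<phi> (0, flat \<kappa> x v) + \<i> * \<phi> (0, \<i> * flat \<kappa> x v)"
  have 1: "cext (\<phi> \<circ> T) (lift_cplx M) = cext (\<phi> \<circ> T \<circ> (\<lambda>h. (h, 0))) M" for M
    by (simp add: lift_cplx_def cext_cpush)
  have 2: "cext (\<phi> \<circ> T) d_omega_bar = S / 2"
    unfolding d_omega_bar_def S_def
    by (simp add: cext_cscale[OF linT] cext_add[OF linT] cext_real[OF linT])
      (simp add: T_def push_flat_def linear_0[OF linear_flat_deriv, unfolded zero_prod_def])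
  have 3: "cext (\<phi> \<circ> T \<circ> (\<lambda>h. (h, 0))) (eta_minus \<kappa> (x, v)) = (P - \<i> * Q) / 2"
    unfolding eta_minus_def lie_bracket_geodesic_vertical[OF l] P_def Q_def
    by (simp only: cext_cscale[OF linT1] cext_diff[OF linT1] cext_real[OF linT1]) simp
  have 4: "cext (\<phi> \<circ> T \<circ> (\<lambda>h. (h, 0))) (eta_plus \<kappa> (x, v)) = (P + \<i> * Q) / 2"
    unfolding eta_plus_def lie_bracket_geodesic_vertical[OF l] P_def Q_def
    by (simp only: cext_cscale[OF linT1] cext_add[OF linT1] cext_real[OF linT1]) simp
  have "cext \<phi> (cpush T (cscale a (lift_cplx (eta_minus \<kappa> (x, v) + cscale (\<omega>\<^sup>2) (eta_plus \<kappa> (x, v))))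
      + cscale b d_omega_bar)) = a * ((P - \<i> * Q) / 2 + \<omega>\<^sup>2 * ((P + \<i> * Q) / 2)) + b * (S / 2)"
    unfolding cext_cpush
    by (simp only: cext_add[OF linT] cext_cscale[OF linT] 1 cext_add[OF linT1] cext_cscale[OF linT1] 2 3 4)
  also have "\<dots> = a * ((P * (1 + \<omega>\<^sup>2) - Q * \<i> * (1 - \<omega>\<^sup>2)) / 2) + b * (S / 2)"
    by (simp add: field_simps)
  finally show ?thesis unfolding P_def Q_def S_def T unfolding T_def .
qed

text \<open>The generator over a unit vector \<open>u\<close> is a multiple of \<open>Xi\<close> up to a multiple of \<open>d_nubar\<close>.\<close>

lemma generator_coords:
  assumes l: "ell \<kappa> x > 0" and u: "flat \<kappa> x v = u" "norm u = 1" and n: "\<omega> * u = n"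
  defines "L \<equiv> \<lambda>a b. cpush (push_flat \<kappa> x v \<omega>)
      (cscale a (lift_cplx (eta_minus \<kappa> (x, v) + cscale (\<omega>\<^sup>2) (eta_plus \<kappa> (x, v)))) + cscale b d_omega_bar)"
  shows "cext fst (L a b) = a * cnj u / (2 * of_real (ell \<kappa> x)) * xi_z \<kappa> x n" (is ?A)
    and "cext (cnj \<circ> fst) (L a b) = a * cnj u / (2 * of_real (ell \<kappa> x)) * xi_zbar \<kappa> x n" (is ?B)
    and "cext snd (L a b) = - (a * cnj u / (2 * of_real (ell \<kappa> x))) * (n * xi_nu \<kappa> x n)" (is ?C)
    and "\<exists>e. \<forall>b. cext (cnj \<circ> snd) (L a b) = e + b * cnj u" (is ?D)
proof -
  define E :: complex where "E = 2 * of_real (ell \<kappa> x)"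
  have E: "E \<noteq> 0" using l by (simp add: E_def)
  have uu: "u * cnj u = 1" using u(2) complex_norm_square[of u] by simp
  have v: "v = ((2 + \<kappa> * x * cnj x) * u - \<kappa> * x\<^sup>2 * cnj u) / E"
    using unflat_flat[of \<kappa> x v] unflat_complex[of \<kappa> x u] u l by (simp add: E_def)
  define r where "r = rot \<kappa> x v"
  have r: "r = ((2 + \<kappa> * x * cnj x) * (\<i> * u) - \<kappa> * x\<^sup>2 * cnj (\<i> * u)) / E"
    using unflat_flat[of \<kappa> x "rot \<kappa> x v"] flat_rot[OF l, of v] unflat_complex[of \<kappa> x "\<i> * u"] u l
    by (simp add: E_def r_def)
  have cE: "cnj E = E" by (simp add: E_def)
  have cv: "cnj v = ((2 + \<kappa> * x * cnj x) * cnj u - \<kappa> * (cnj x)\<^sup>2 * u) / E"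
    unfolding v by (simp add: cE mult_ac)
  have cr: "cnj r = ((2 + \<kappa> * x * cnj x) * (- \<i> * cnj u) - \<kappa> * (cnj x)\<^sup>2 * (\<i> * u)) / E"
    unfolding r by (simp add: cE mult_ac)
  \<comment> \<open>For a unit vector \<open>u\<close> this eliminates \<omega>: apart from the
    common factor \<open>a * cnj u\<close>, the first three coordinates depend on \<open>u\<close>
    and \<omega> only through \<open>n\<close>.\<close>
  have n2: "\<omega>\<^sup>2 * u = n\<^sup>2 * cnj u" using uu n by algebra
  have gen: "cext \<phi> (L a b) =
    a * ((\<phi> (v, - (\<kappa> * Im (x * cnj u) / ell \<kappa> x) *\<^sub>R (\<i> * \<omega> * u)) * (1 + \<omega>\<^sup>2)
      - \<phi> (- r, - (\<kappa> * (x \<bullet> u) / ell \<kappa> x) *\<^sub>R (\<i> * \<omega> * u)) * \<i> * (1 - \<omega>\<^sup>2)) / 2)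
    + b * ((\<phi> (0, u) + \<i> * \<phi> (0, \<i> * u)) / 2)" if "linear \<phi>" for \<phi> b
    unfolding L_def using cext_generator[OF l that, of v \<omega> a b] unfolding u(1) r_def .
  have "cext fst (L a b) = a * ((v * (1 + \<omega>\<^sup>2) + r * \<i> * (1 - \<omega>\<^sup>2)) / 2)"
    using gen[OF linear_coords(1)] by simp
  also have "v * (1 + \<omega>\<^sup>2) + r * \<i> * (1 - \<omega>\<^sup>2) =
     2 * ((2 + \<kappa> * x * cnj x) * (\<omega>\<^sup>2 * u) - \<kappa> * x\<^sup>2 * cnj u) / E"
    unfolding r v using E by (simp add: field_simps)
  also have "\<dots> = 2 * cnj u / E * xi_z \<kappa> x n" unfolding n2 xi_z_def by (simp add: algebra_simps add_divide_distrib diff_divide_distrib)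
  finally show ?A unfolding E_def by (simp add: mult_ac)
  have "cext (cnj \<circ> fst) (L a b) = a * ((cnj v * (1 + \<omega>\<^sup>2) + cnj r * \<i> * (1 - \<omega>\<^sup>2)) / 2)"
    using gen[OF linear_coords(3)] by simp
  also have "cnj v * (1 + \<omega>\<^sup>2) + cnj r * \<i> * (1 - \<omega>\<^sup>2) =
     2 * ((2 + \<kappa> * x * cnj x) * cnj u - \<kappa> * (cnj x)\<^sup>2 * (\<omega>\<^sup>2 * u)) / E"
    unfolding cr cv using E by (simp add: field_simps)
  also have "\<dots> = 2 * cnj u / E * xi_zbar \<kappa> x n" unfolding n2 xi_zbar_def by (simp add: algebra_simps add_divide_distrib diff_divide_distrib)
  finally show ?B unfolding E_def by (simp add: mult_ac o_def)
  have Imq: "\<i> * complex_of_real (Im (x * cnj u)) = (x * cnj u - cnj x * u) / 2"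
    by (simp add: complex_eq_iff)
  have "cext snd (L a b) = a * ((- (\<kappa> * Im (x * cnj u) / ell \<kappa> x) *\<^sub>R (\<i> * n)) * (1 + \<omega>\<^sup>2)
      - (- (\<kappa> * (x \<bullet> u) / ell \<kappa> x) *\<^sub>R (\<i> * n)) * \<i> * (1 - \<omega>\<^sup>2)) / 2"
    using gen[OF linear_coords(2)] by (simp add: mult.assoc n)
  also have "- (\<kappa> * Im (x * cnj u) / ell \<kappa> x) *\<^sub>R (\<i> * n) = - (2 * \<kappa> * n * (\<i> * of_real (Im (x * cnj u))) / E)"
    unfolding E_def by (simp add: scaleR_conv_of_real)
  also have "(- (\<kappa> * (x \<bullet> u) / ell \<kappa> x) *\<^sub>R (\<i> * n)) * \<i> = 2 * \<kappa> * n * of_real (x \<bullet> u) / E"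
    unfolding E_def by (simp add: scaleR_conv_of_real algebra_simps)
  also have "a * (- (2 * \<kappa> * n * (\<i> * of_real (Im (x * cnj u))) / E) * (1 + \<omega>\<^sup>2)
      - 2 * \<kappa> * n * of_real (x \<bullet> u) / E * (1 - \<omega>\<^sup>2)) / 2 =
      - (a * \<kappa> * n * (x * cnj u - cnj x * (\<omega>\<^sup>2 * u)) / E)"
    unfolding Imq of_real_inner using E by (simp add: field_simps)
  also have "\<dots> = - (a * cnj u / E) * (n * xi_nu \<kappa> x n)"
    unfolding n2 xi_nu_def by (simp add: algebra_simps add_divide_distrib diff_divide_distrib)
  finally show ?C unfolding E_def .
  \<comment> \<open>The part in \<open>a\<close> is absorbed into \<open>e\<close>. The coefficient
    \<open>cnj u\<close> of \<open>b\<close> is a unit, so this coordinate can be given any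
    value.\<close>
  have "cext (cnj \<circ> snd) (L a b) = a * (((cnj \<circ> snd) (v, - (\<kappa> * Im (x * cnj u) / ell \<kappa> x) *\<^sub>R (\<i> * \<omega> * u)) * (1 + \<omega>\<^sup>2)
      - (cnj \<circ> snd) (- r, - (\<kappa> * (x \<bullet> u) / ell \<kappa> x) *\<^sub>R (\<i> * \<omega> * u)) * \<i> * (1 - \<omega>\<^sup>2)) / 2) + b * cnj u" for b
    using gen[OF linear_coords(4), of b] by simp
  then show ?D by blast
qed

section \<open>The distribution in the coordinates \<open>(z, \<nu>)\<close>\<close>

lemma has_derivative_flat_chart:
  "((\<lambda>(x, v). (x, flat \<kappa> x v)) has_derivative (\<lambda>h. (fst h, flat_deriv \<kappa> x v h))) (at (x, v))"
  using flat_has_derivative[where \<kappa> = \<kappa> and x = x and v = v] unfolding case_prod_unfold flat_deriv_def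
  by (intro has_derivative_Pair) (auto intro!: derivative_eq_intros simp: case_prod_unfold)

lemma unflat_has_derivative:
  assumes "ell \<kappa> x > 0"
  shows "(\<lambda>(x, n). unflat \<kappa> x n) differentiable (at (x, n))"
proof -
  have "((\<lambda>p. ell \<kappa> (fst p)) has_derivative (\<lambda>h. 2 * \<kappa> * (x \<bullet> fst h))) (at (x, n))"
    unfolding ell_def power2_norm_eq_inner by (auto intro!: derivative_eq_intros simp: inner_commute)
  then have "(\<lambda>p. ell \<kappa> (fst p)) differentiable (at (x, n))" by (auto simp: differentiable_def)
  moreover have "(\<lambda>p :: complex \<times> complex. fst p \<bullet> snd p) differentiable (at (x, n))"
    using has_derivative_inner[OF bounded_linear_imp_has_derivative[OF bounded_linear_fst]
        bounded_linear_imp_has_derivative[OF bounded_linear_snd]]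
    unfolding differentiable_def by blast
  ultimately show ?thesis
    using assms unfolding unflat_def case_prod_unfold
    by (intro differentiable_diff differentiable_scaleR differentiable_divide differentiable_mult)
      (auto intro: bounded_linear_imp_differentiable bounded_linear_fst bounded_linear_snd)
qed

text \<open>Both compositions of the chart with the flat coordinates are the identity near the
  point, so the chain rule makes the derivatives mutually inverse without a formula for
  \<open>D\<close>.\<close>

lemma chart_has_derivative_inverse:
  assumes l: "ell \<kappa> z > 0" and v: "v = unflat \<kappa> z n"
  obtains D where "(chart \<kappa> has_derivative D) (at (z, n))"
    and "\<And>h. (fst (D h), flat_deriv \<kappa> z v (D h)) = h"
    and "\<And>h. D (fst h, flat_deriv \<kappa> z v h) = h"
proof -
  let ?F = "\<lambda>(x, v). (x, flat \<kappa> x v)"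
  let ?DF = "\<lambda>h. (fst h, flat_deriv \<kappa> z v h)"
  have "(\<lambda>(x, n). (x, unflat \<kappa> x n)) differentiable (at (z, n))"
    using unflat_has_derivative[OF l, of n]
      has_derivative_Pair[OF bounded_linear_imp_has_derivative[OF bounded_linear_fst]]
    unfolding differentiable_def case_prod_unfold by blast
  then obtain D where D0: "((\<lambda>(x, n). (x, unflat \<kappa> x n)) has_derivative D) (at (z, n))"
    by (auto simp: differentiable_def)
  have D: "(chart \<kappa> has_derivative D) (at (z, n))"
    by (rule has_derivative_transform_within_open[OF D0 open_ell_pos_fst[of \<kappa>]])
      (use l in \<open>auto simp: chart_unflat\<close>)
  have cz: "chart \<kappa> (z, n) = (z, v)" using chart_unflat[OF l] v by simp
  have Fzv: "?F (z, v) = (z, n)" using l v by (simp add: flat_unflat)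
  have "((?F \<circ> chart \<kappa>) has_derivative (?DF \<circ> D)) (at (z, n))"
    by (rule diff_chain_at[OF D, unfolded cz, OF has_derivative_flat_chart])
  moreover have "((?F \<circ> chart \<kappa>) has_derivative id) (at (z, n))"
    by (rule has_derivative_transform_within_open[OF has_derivative_id open_ell_pos_fst[of \<kappa>]])
      (use l in \<open>auto simp: chart_unflat flat_unflat\<close>)
  ultimately have 1: "?DF \<circ> D = id" by (rule has_derivative_unique)
  have "((chart \<kappa> \<circ> ?F) has_derivative (D \<circ> ?DF)) (at (z, v))"
    by (rule diff_chain_at[OF has_derivative_flat_chart]) (simp only: Fzv D)
  moreover have "((chart \<kappa> \<circ> ?F) has_derivative id) (at (z, v))"
    by (rule has_derivative_transform_within_open[OF has_derivative_id open_ell_pos_fst[of \<kappa>]])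
      (use l in \<open>auto simp: chart_unflat unflat_flat\<close>)
  ultimately have 2: "D \<circ> ?DF = id" by (rule has_derivative_unique)
  show ?thesis
    by (rule that[OF D]) (use 1 2 in \<open>auto simp: fun_eq_iff\<close>)
qed

text \<open>The derivative is never written out. It is pinned down by composing with the flat
  coordinates, in which \<open>proj_p\<close> is a complex product by
  \<open>flat_cmul\<close>.\<close>

lemma proj_p_differentiable:
  assumes l: "ell \<kappa> x > 0"
  shows "\<exists>D. (proj_p \<kappa> has_derivative D) (at ((x, v), \<omega>)) \<and>
    (\<forall>h. (fst (D h), flat_deriv \<kappa> x (cmul \<kappa> x \<omega> v) (D h)) = push_flat \<kappa> x v \<omega> h)"
proof -
  let ?F = "\<lambda>(x, v). (x, flat \<kappa> x v)"
  have "((\<lambda>(q, \<omega>). case q of (x, v) \<Rightarrow> rot \<kappa> x v) has_derivative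
      (\<lambda>h. (case fst h of (h, k) \<Rightarrow> frechet_derivative (\<lambda>(x, v). rot \<kappa> x v) (at (x, v)) (h, k))))
      (at ((x, v), \<omega>))"
    using diff_chain_at[OF has_derivative_fst[OF has_derivative_ident], of "\<lambda>(x, v). rot \<kappa> x v" _ "((x, v), \<omega>)"]
      rot_has_derivative[OF l, of v] frechet_derivativeI[OF rot_has_derivative[OF l, of v]]
    by (simp add: o_def case_prod_unfold)
  then have "(\<lambda>(q, \<omega>). case q of (x, v) \<Rightarrow> rot \<kappa> x v) differentiable (at ((x, v), \<omega>))"
    by (auto simp: differentiable_def)
  then obtain E where E: "((\<lambda>p. rot \<kappa> (fst (fst p)) (snd (fst p))) has_derivative E) (at ((x, v), \<omega>))"
    by (auto simp: differentiable_def case_prod_unfold)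
  note linear_has_derivative = bounded_linear_compose[THEN bounded_linear_imp_has_derivative]
  have "\<exists>D. (proj_p \<kappa> has_derivative D) (at ((x, v), \<omega>))"
    unfolding proj_p_def cmul_def case_prod_unfold
    by (rule exI, rule has_derivative_Pair[OF linear_has_derivative[OF bounded_linear_fst bounded_linear_fst]
      has_derivative_add[OF has_derivative_scaleR[OF linear_has_derivative[OF bounded_linear_Re bounded_linear_snd]
          linear_has_derivative[OF bounded_linear_snd bounded_linear_fst]]
        has_derivative_scaleR[OF linear_has_derivative[OF bounded_linear_Im bounded_linear_snd] E]]])
  then obtain D where D: "(proj_p \<kappa> has_derivative D) (at ((x, v), \<omega>))" by blast
  have "((?F \<circ> proj_p \<kappa>) has_derivative
      ((\<lambda>h. (fst h, flat_deriv \<kappa> x (cmul \<kappa> x \<omega> v) h)) \<circ> D)) (at ((x, v), \<omega>))"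
    using diff_chain_at[OF D, of ?F] has_derivative_flat_chart[of \<kappa> x "cmul \<kappa> x \<omega> v"]
    by (simp add: proj_p_def)
  moreover have "((?F \<circ> proj_p \<kappa>) has_derivative push_flat \<kappa> x v \<omega>) (at ((x, v), \<omega>))"
  proof (rule has_derivative_transform_within_open)
    have "((\<lambda>p. flat \<kappa> (fst (fst p)) (snd (fst p))) has_derivative (\<lambda>h. flat_deriv \<kappa> x v (fst h))) (at ((x, v), \<omega>))"
      using diff_chain_at[OF has_derivative_fst[OF has_derivative_ident], of "\<lambda>(x, v). flat \<kappa> x v" _ "((x, v), \<omega>)"]
        flat_has_derivative[where \<kappa> = \<kappa> and x = x and v = v]
      by (simp add: o_def case_prod_unfold flat_deriv_def)
    then show "((\<lambda>p. (fst (fst p), snd p * flat \<kappa> (fst (fst p)) (snd (fst p)))) has_derivative push_flat \<kappa> x v \<omega>)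
        (at ((x, v), \<omega>))"
      unfolding push_flat_def case_prod_unfold
      by (auto intro!: derivative_eq_intros simp: algebra_simps)
    have "open ({x. ell \<kappa> x > 0} \<times> UNIV :: (complex \<times> complex) set)" by (intro open_Times open_ell_pos open_UNIV)
    then show "open (({x. ell \<kappa> x > 0} \<times> UNIV) \<times> UNIV :: ((complex \<times> complex) \<times> complex) set)"
      by (rule open_Times) (rule open_UNIV)
  qed (use l in \<open>auto simp: proj_p_def flat_cmul\<close>)
  ultimately have "(\<lambda>h. (fst h, flat_deriv \<kappa> x (cmul \<kappa> x \<omega> v) h)) \<circ> D = push_flat \<kappa> x v \<omega>"
    by (rule has_derivative_unique)
  then show ?thesis using D by (auto simp: fun_eq_iff)
qed

text \<open>The derivative of the chart is invertible, so membership of \<open>cpush D L\<close>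
  among the generators over the tangent bundle turns into equality of \<open>L\<close> with a
  generator pushed by \<open>push_flat\<close>.\<close>

lemma transport_distr_generators:
  assumes l: "ell \<kappa> z > 0"
  shows "transport_distr \<kappa> R (z, n) =
    {cpush (push_flat \<kappa> z v \<omega>)
        (cscale a (lift_cplx (eta_minus \<kappa> (z, v) + cscale (\<omega>\<^sup>2) (eta_plus \<kappa> (z, v)))) + cscale b d_omega_bar)
      | v \<omega> a b. norm z \<le> R \<and> norm (flat \<kappa> z v) = 1 \<and> norm \<omega> \<le> 1 \<and> \<omega> * flat \<kappa> z v = n}" (is "_ = ?S")
proof -
  define y where "y = unflat \<kappa> z n"
  obtain D where D: "(chart \<kappa> has_derivative D) (at (z, n))"
    and D1: "\<And>h. (fst (D h), flat_deriv \<kappa> z y (D h)) = h"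
    and D2: "\<And>h. D (fst h, flat_deriv \<kappa> z y h) = h"
    using chart_has_derivative_inverse[OF l y_def] by metis
  have cz: "chart \<kappa> (z, n) = (z, y)" using chart_unflat[OF l] y_def by simp
  have yn: "flat \<kappa> z y = n" using l by (simp add: y_def flat_unflat)
  have push: "cpush D L = cpush (frechet_derivative (proj_p \<kappa>) (at ((z, v), \<omega>))) M \<longleftrightarrow> L = cpush (push_flat \<kappa> z v \<omega>) M"
    if c: "cmul \<kappa> z \<omega> v = y" for L M v \<omega>
  proof -
    obtain E where E: "(proj_p \<kappa> has_derivative E) (at ((z, v), \<omega>))"
      and E1: "\<And>h. (fst (E h), flat_deriv \<kappa> z y (E h)) = push_flat \<kappa> z v \<omega> h"
      using proj_p_differentiable[OF l, of v \<omega>] c by auto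
    have "D h = E k \<longleftrightarrow> h = push_flat \<kappa> z v \<omega> k" for h k
      using D1[of h] E1[of k] D2[of "E k"] by metis
    then show ?thesis
      unfolding frechet_derivativeI[OF E] by (cases L; cases M) (simp add: cpush_def)
  qed
  have mem: "proj_p \<kappa> ((x, v), \<omega>) = (z, y) \<longleftrightarrow> x = z \<and> \<omega> * flat \<kappa> z v = n" for x v \<omega>
  proof -
    have "cmul \<kappa> z \<omega> v = y \<longleftrightarrow> \<omega> * flat \<kappa> z v = n"
      using flat_cmul[OF l, of \<omega> v] yn unflat_flat[of \<kappa> z] l by (metis less_irrefl)
    then show ?thesis by (auto simp: proj_p_def)
  qed
  have unit: "(z, v) \<in> unit_tangent \<kappa> R \<longleftrightarrow> norm z \<le> R \<and> norm (flat \<kappa> z v) = 1" for v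
    by (simp add: unit_tangent_def metric_flat_norm abs_square_eq_1)
  show ?thesis
  proof (intro set_eqI iffI)
    fix L assume "L \<in> transport_distr \<kappa> R (z, n)"
    then obtain q \<omega> a b where *: "cpush D L = cpush (frechet_derivative (proj_p \<kappa>) (at (q, \<omega>)))
        (cscale a (lift_cplx (eta_minus \<kappa> q + cscale (\<omega>\<^sup>2) (eta_plus \<kappa> q))) + cscale b d_omega_bar)"
      "q \<in> unit_tangent \<kappa> R" "norm \<omega> \<le> 1" "proj_p \<kappa> (q, \<omega>) = (z, y)"
      unfolding transport_distr_def transport_distr_TM_def cz frechet_derivativeI[OF D] by blast
    obtain v where q: "q = (z, v)" "\<omega> * flat \<kappa> z v = n" using *(4) mem by (metis surj_pair)
    have "cmul \<kappa> z \<omega> v = y" using *(4) by (simp add: q proj_p_def)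
    then show "L \<in> ?S" using push *(1-3) q unit by blast
  next
    fix L assume "L \<in> ?S"
    then obtain v \<omega> a b where *: "L = cpush (push_flat \<kappa> z v \<omega>)
        (cscale a (lift_cplx (eta_minus \<kappa> (z, v) + cscale (\<omega>\<^sup>2) (eta_plus \<kappa> (z, v)))) + cscale b d_omega_bar)"
      "norm z \<le> R" "norm (flat \<kappa> z v) = 1" "norm \<omega> \<le> 1" "\<omega> * flat \<kappa> z v = n" by blast
    have p: "proj_p \<kappa> ((z, v), \<omega>) = (z, y)" using mem *(5) by blast
    then have "cmul \<kappa> z \<omega> v = y" by (simp add: proj_p_def)
    with *(1) have "cpush D L = cpush (frechet_derivative (proj_p \<kappa>) (at ((z, v), \<omega>)))
        (cscale a (lift_cplx (eta_minus \<kappa> (z, v) + cscale (\<omega>\<^sup>2) (eta_plus \<kappa> (z, v)))) + cscale b d_omega_bar)"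
      using push by blast
    then show "L \<in> transport_distr \<kappa> R (z, n)"
      unfolding transport_distr_def transport_distr_TM_def cz frechet_derivativeI[OF D]
      using *(2-5) p unit by blast
  qed
qed

text \<open>The equations express that \<open>L\<close> lies in the span of \<open>Xi\<close> and
  \<open>d_nubar\<close>, with the factor of \<open>Xi\<close> eliminated by means of the
  \<open>d_zbar\<close> coordinate; \<open>xi_zbar\<close> has no zero for |\<nu>| < 1.\<close>

lemma transport_distr_eq:
  assumes l: "ell \<kappa> z > 0" and z: "norm z \<le> R" and n: "norm n < 1"
  shows "transport_distr \<kappa> R (z, n) =
    {L. xi_zbar \<kappa> z n * cext fst L = xi_z \<kappa> z n * cext (cnj \<circ> fst) L \<and>
        xi_zbar \<kappa> z n * cext snd L = - (n * xi_nu \<kappa> z n) * cext (cnj \<circ> fst) L}" (is "_ = ?K")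
proof (intro set_eqI iffI)
  fix L assume "L \<in> transport_distr \<kappa> R (z, n)"
  then obtain v \<omega> a b where *: "L = cpush (push_flat \<kappa> z v \<omega>)
      (cscale a (lift_cplx (eta_minus \<kappa> (z, v) + cscale (\<omega>\<^sup>2) (eta_plus \<kappa> (z, v)))) + cscale b d_omega_bar)"
    "norm (flat \<kappa> z v) = 1" "\<omega> * flat \<kappa> z v = n"
    unfolding transport_distr_generators[OF l] by blast
  show "L \<in> ?K"
    using generator_coords(1-3)[OF l refl *(2,3), of a b] unfolding *(1)[symmetric] by simp
next
  fix L assume L: "L \<in> ?K"
  have A: "xi_zbar \<kappa> z n \<noteq> 0" by (rule xi_zbar_nonzero(2)[OF l n])
  \<comment> \<open>The vector with flat image \<open>1\<close> makes \<omega> equal to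
    \<open>n\<close>. Then \<open>a\<close> and \<open>b\<close> are chosen to match the two
    conjugate coordinates of \<open>L\<close>, and the equations yield the other two.\<close>
  define v where "v = unflat \<kappa> z 1"
  have v: "flat \<kappa> z v = 1" "norm (1 :: complex) = 1" "n * 1 = n" using l by (simp_all add: v_def flat_unflat)
  define a where "a = 2 * of_real (ell \<kappa> z) * (cext (cnj \<circ> fst) L / xi_zbar \<kappa> z n)"
  obtain e where e: "\<And>b. cext (cnj \<circ> snd) (cpush (push_flat \<kappa> z v n)
      (cscale a (lift_cplx (eta_minus \<kappa> (z, v) + cscale (n\<^sup>2) (eta_plus \<kappa> (z, v)))) + cscale b d_omega_bar))
      = e + b * cnj 1"
    using generator_coords(4)[OF l v, of a] by metis
  define b where "b = cext (cnj \<circ> snd) L - e"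
  have a: "a * cnj 1 / (2 * of_real (ell \<kappa> z)) = cext (cnj \<circ> fst) L / xi_zbar \<kappa> z n"
    using l by (simp add: a_def)
  note g = generator_coords(1-3)[OF l v, of a b, unfolded a]
  have e1: "cext fst L = cext (cnj \<circ> fst) L / xi_zbar \<kappa> z n * xi_z \<kappa> z n"
    and e2: "cext snd L = - (cext (cnj \<circ> fst) L / xi_zbar \<kappa> z n) * (n * xi_nu \<kappa> z n)"
    using L A by (simp_all add: field_simps)
  have "L = cpush (push_flat \<kappa> z v n)
      (cscale a (lift_cplx (eta_minus \<kappa> (z, v) + cscale (n\<^sup>2) (eta_plus \<kappa> (z, v)))) + cscale b d_omega_bar)"
    by (rule cplx_coords_eqI; unfold g e) (use A in \<open>simp_all add: e1 e2 b_def\<close>)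
  then show "L \<in> transport_distr \<kappa> R (z, n)"
    unfolding transport_distr_generators[OF l] using z n v by force
qed

section \<open>The blow-down map on the interior\<close>

definition blow_E :: "real \<Rightarrow> complex \<Rightarrow> complex \<Rightarrow> complex" where
  "blow_E \<kappa> z n = exp (\<kappa> * (z * cnj z - (cnj z)\<^sup>2 * n\<^sup>2) / 2)"

definition blow :: "real \<Rightarrow> complex \<times> complex \<Rightarrow> complex \<times> complex" where
  "blow \<kappa> = (\<lambda>(z, n). ((z - cnj z * n\<^sup>2) * blow_E \<kappa> z n, n * blow_E \<kappa> z n))"

text \<open>The logarithmic derivative of \<open>blow_E\<close>. The increments \<open>x\<close> of
  \<open>z\<close> and \<open>y\<close> of \<open>cnj z\<close> are separate arguments, since they
  are independent for complexified tangent vectors.\<close>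

definition blow_dlnE :: "real \<Rightarrow> complex \<Rightarrow> complex \<Rightarrow> complex \<Rightarrow> complex \<Rightarrow> complex \<Rightarrow> complex" where
  "blow_dlnE \<kappa> z n x y k = \<kappa> / 2 * (cnj z * x + (z - 2 * cnj z * n\<^sup>2) * y - 2 * (cnj z)\<^sup>2 * n * k)"

definition blow_dw :: "real \<Rightarrow> complex \<Rightarrow> complex \<Rightarrow> complex \<Rightarrow> complex \<Rightarrow> complex \<Rightarrow> complex" where
  "blow_dw \<kappa> z n x y k = x - n\<^sup>2 * y - 2 * cnj z * n * k + (z - cnj z * n\<^sup>2) * blow_dlnE \<kappa> z n x y k"

definition blow_dxi :: "real \<Rightarrow> complex \<Rightarrow> complex \<Rightarrow> complex \<Rightarrow> complex \<Rightarrow> complex \<Rightarrow> complex" where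
  "blow_dxi \<kappa> z n x y k = k + n * blow_dlnE \<kappa> z n x y k"

definition blow_deriv :: "real \<Rightarrow> complex \<Rightarrow> complex \<Rightarrow> complex \<times> complex \<Rightarrow> complex \<times> complex" where
  "blow_deriv \<kappa> z n = (\<lambda>(h, k). (blow_E \<kappa> z n * blow_dw \<kappa> z n h (cnj h) k,
     blow_E \<kappa> z n * blow_dxi \<kappa> z n h (cnj h) k))"

lemma blow_E_nonzero [simp]: "blow_E \<kappa> z n \<noteq> 0"
  by (simp add: blow_E_def)

section \<open>Derivative and smoothness of the blow-down map\<close>

lemma has_derivative_cnj_fst: "((\<lambda>p :: complex \<times> complex. cnj (fst p)) has_derivative (\<lambda>h. cnj (fst h))) (at p)"
  by (rule bounded_linear_compose[OF bounded_linear_cnj bounded_linear_fst, THEN bounded_linear_imp_has_derivative])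

lemma blow_E_has_derivative:
  "((\<lambda>p. blow_E \<kappa> (fst p) (snd p)) has_derivative
     (\<lambda>h. blow_E \<kappa> z n * blow_dlnE \<kappa> z n (fst h) (cnj (fst h)) (snd h))) (at (z, n))"
proof -
  let ?f = "\<lambda>p. \<kappa> / 2 * (fst p * cnj (fst p) - (cnj (fst p))\<^sup>2 * (snd p)\<^sup>2) :: complex"
  have "(?f has_derivative (\<lambda>h. blow_dlnE \<kappa> z n (fst h) (cnj (fst h)) (snd h))) (at (z, n))"
    unfolding blow_dlnE_def
    by (rule derivative_eq_intros has_derivative_cnj_fst bounded_linear_imp_has_derivative[OF bounded_linear_fst]
     bounded_linear_imp_has_derivative[OF bounded_linear_snd] refl)+
      (simp add: fun_eq_iff algebra_simps power2_eq_square)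
  moreover have "(exp has_derivative (\<lambda>v. exp (?f (z, n)) * v)) (at (?f (z, n)))"
    using DERIV_exp[of "?f (z, n)"] unfolding has_field_derivative_def .
  ultimately have "((\<lambda>p. exp (?f p)) has_derivative
      (\<lambda>h. exp (?f (z, n)) * blow_dlnE \<kappa> z n (fst h) (cnj (fst h)) (snd h))) (at (z, n))"
    by (rule has_derivative_compose)
  then show ?thesis by (simp add: blow_E_def)
qed

lemma blow_has_derivative: "(blow \<kappa> has_derivative blow_deriv \<kappa> z n) (at (z, n))"
  unfolding blow_def blow_deriv_def case_prod_unfold blow_dw_def blow_dxi_def
  by (rule derivative_eq_intros has_derivative_cnj_fst bounded_linear_imp_has_derivative[OF bounded_linear_fst]
     bounded_linear_imp_has_derivative[OF bounded_linear_snd] blow_E_has_derivative refl | simp)+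
    (simp add: fun_eq_iff algebra_simps power2_eq_square)

lemma linear_blow_deriv: "linear (blow_deriv \<kappa> z n)"
  using blow_has_derivative by (rule has_derivative_linear)

lemma Ck_on_blow_E: "open U \<Longrightarrow> Ck_on k (\<lambda>p. blow_E \<kappa> (fst p) (snd p)) U"
  unfolding blow_E_def divide_inverse
  by (intro Ck_on_exp Ck_on_mult Ck_on_diff Ck_on_const Ck_on_power Ck_on_cnj Ck_on_fst Ck_on_snd Ck_on_id)

lemma Ck_on_blow: "open U \<Longrightarrow> Ck_on k (blow \<kappa>) U"
  unfolding blow_def case_prod_unfold
  by (intro Ck_on_Pair Ck_on_mult Ck_on_diff Ck_on_power Ck_on_cnj Ck_on_fst Ck_on_snd Ck_on_id Ck_on_blow_E)

text \<open>With \<open>s\<close> the value of \<open>blow_dlnE\<close>, vanishing of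
  \<open>blow_dxi\<close> means \<open>k = - n * s\<close>. Inserted into the vanishing of
  \<open>blow_dw\<close> and into the formula for \<open>s\<close>, this leaves a linear system
  whose solution has \<open>xi_zbar * s = xi_nu * y\<close>. Multiplication by
  \<open>xi_zbar\<close> keeps the converse polynomial.\<close>

lemma blow_kernel:
  assumes A: "xi_zbar \<kappa> z n \<noteq> 0"
  shows "blow_dw \<kappa> z n x y k = 0 \<and> blow_dxi \<kappa> z n x y k = 0 \<longleftrightarrow>
    xi_zbar \<kappa> z n * x = xi_z \<kappa> z n * y \<and> xi_zbar \<kappa> z n * k = - (n * xi_nu \<kappa> z n) * y"
proof
  assume "blow_dw \<kappa> z n x y k = 0 \<and> blow_dxi \<kappa> z n x y k = 0"
  moreover define s where "s = blow_dlnE \<kappa> z n x y k"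
  ultimately have w: "x - n\<^sup>2 * y - 2 * cnj z * n * k + (z - cnj z * n\<^sup>2) * s = 0" and k: "k = - n * s"
    by (auto simp: blow_dw_def blow_dxi_def s_def add_eq_0_iff)
  have s: "2 * s = \<kappa> * (cnj z * x + (z - 2 * cnj z * n\<^sup>2) * y - 2 * (cnj z)\<^sup>2 * n * k)"
    by (simp add: s_def blow_dlnE_def)
  have As: "xi_zbar \<kappa> z n * s = xi_nu \<kappa> z n * y"
    using w s unfolding xi_zbar_def xi_nu_def k by algebra
  have "xi_zbar \<kappa> z n * x = xi_z \<kappa> z n * y"
    using w s unfolding xi_zbar_def xi_z_def k by algebra
  moreover have "xi_zbar \<kappa> z n * k = - (n * xi_nu \<kappa> z n) * y"
    using As k by algebra
  ultimately show "xi_zbar \<kappa> z n * x = xi_z \<kappa> z n * y \<and> xi_zbar \<kappa> z n * k = - (n * xi_nu \<kappa> z n) * y" ..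
next
  assume *: "xi_zbar \<kappa> z n * x = xi_z \<kappa> z n * y \<and> xi_zbar \<kappa> z n * k = - (n * xi_nu \<kappa> z n) * y"
  define s where "s = blow_dlnE \<kappa> z n x y k"
  have s: "2 * s = \<kappa> * (cnj z * x + (z - 2 * cnj z * n\<^sup>2) * y - 2 * (cnj z)\<^sup>2 * n * k)"
    by (simp add: s_def blow_dlnE_def)
  have "2 * (xi_zbar \<kappa> z n * s) = \<kappa> * (cnj z * (xi_zbar \<kappa> z n * x) + (z - 2 * cnj z * n\<^sup>2) * (xi_zbar \<kappa> z n * y)
      - 2 * (cnj z)\<^sup>2 * n * (xi_zbar \<kappa> z n * k))"
    using s by algebra
  also have "\<dots> = 2 * (xi_nu \<kappa> z n * y)"
    unfolding * [THEN conjunct1] * [THEN conjunct2] unfolding xi_zbar_def xi_z_def xi_nu_def by algebra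
  finally have As: "xi_zbar \<kappa> z n * s = xi_nu \<kappa> z n * y" by simp
  have "xi_zbar \<kappa> z n * (k + n * s) = 0" using As * by algebra
  moreover have "xi_zbar \<kappa> z n * (x - n\<^sup>2 * y - 2 * cnj z * n * k + (z - cnj z * n\<^sup>2) * s) =
      xi_zbar \<kappa> z n * x - n\<^sup>2 * (xi_zbar \<kappa> z n * y) - 2 * cnj z * n * (xi_zbar \<kappa> z n * k)
        + (z - cnj z * n\<^sup>2) * (xi_zbar \<kappa> z n * s)" by algebra
  moreover have "\<dots> = 0"
    unfolding * [THEN conjunct1] * [THEN conjunct2] As unfolding xi_zbar_def xi_z_def xi_nu_def by algebra
  ultimately show "blow_dw \<kappa> z n x y k = 0 \<and> blow_dxi \<kappa> z n x y k = 0"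
    using A by (simp add: blow_dw_def blow_dxi_def s_def[symmetric])
qed

text \<open>For a real vector the kernel equation reads \<open>xi_zbar * h = xi_z * cnj h\<close>,
  which forces \<open>h = 0\<close> because \<open>xi_zbar\<close> has the larger modulus.\<close>

lemma blow_deriv_eq_0:
  assumes "ell \<kappa> z > 0" "norm n < 1" "blow_deriv \<kappa> z n a = 0"
  shows "a = 0"
proof -
  obtain h k where a: "a = (h, k)" by (metis surj_pair)
  have A: "xi_zbar \<kappa> z n \<noteq> 0" by (rule xi_zbar_nonzero(2)[OF assms(1,2)])
  have *: "xi_zbar \<kappa> z n * h = xi_z \<kappa> z n * cnj h" "xi_zbar \<kappa> z n * k = - (n * xi_nu \<kappa> z n) * cnj h"
    using assms(3) blow_kernel[OF A, of h "cnj h" k] by (auto simp: a blow_deriv_def zero_prod_def)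
  have "norm (xi_zbar \<kappa> z n) * norm h = norm (xi_z \<kappa> z n) * norm h"
    using arg_cong[OF *(1), of norm] by (simp add: norm_mult)
  then have "h = 0" using xi_zbar_nonzero(1)[OF assms(1,2)] by auto
  then show ?thesis using * A by (simp add: a zero_prod_def)
qed

lemma blow_deriv_bij:
  assumes "ell \<kappa> z > 0" "norm n < 1"
  shows "bij (blow_deriv \<kappa> z n)"
proof -
  have "inj (blow_deriv \<kappa> z n)"
    using blow_deriv_eq_0[OF assms] linear_injective_0[OF linear_blow_deriv] by blast
  then show ?thesis
    using linear_injective_imp_surjective[OF linear_blow_deriv] by (simp add: bij_def)
qed

text \<open>A complexified vector \<open>(a, b)\<close> is annihilated by the extended derivative
  \<open>D\<close> iff \<open>D a + \<i> * D b = 0\<close>, that is \<open>D b = \<i> * D a\<close>.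
  The standard structure is constant, whence the free base point \<open>p\<close>.\<close>

lemma transport_distr_blow:
  assumes "ell \<kappa> z > 0" "norm z \<le> R" "norm n < 1"
  shows "L \<in> transport_distr \<kappa> R (z, n) \<longleftrightarrow>
    blow_deriv \<kappa> z n (snd L) = cplx_struct_std p (blow_deriv \<kappa> z n (fst L))"
proof -
  have A: "xi_zbar \<kappa> z n \<noteq> 0" by (rule xi_zbar_nonzero(2)[OF assms(1,3)])
  obtain a b c d where L: "L = ((a, b), (c, d))" by (metis surj_pair)
  let ?E = "blow_E \<kappa> z n"
  have w: "blow_dw \<kappa> z n (a + \<i> * c) (cnj a + \<i> * cnj c) (b + \<i> * d) =
      blow_dw \<kappa> z n a (cnj a) b + \<i> * blow_dw \<kappa> z n c (cnj c) d"
    and xi: "blow_dxi \<kappa> z n (a + \<i> * c) (cnj a + \<i> * cnj c) (b + \<i> * d) =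
      blow_dxi \<kappa> z n a (cnj a) b + \<i> * blow_dxi \<kappa> z n c (cnj c) d"
    unfolding blow_dw_def blow_dxi_def blow_dlnE_def by (simp_all add: algebra_simps)
  have i: "u + \<i> * v = 0 \<longleftrightarrow> ?E * v = \<i> * (?E * u)" for u v
  proof -
    have "?E * v = \<i> * (?E * u) \<longleftrightarrow> ?E * v = ?E * (\<i> * u)" by (simp add: mult_ac)
    also have "\<dots> \<longleftrightarrow> v = \<i> * u" by simp
    also have "\<dots> \<longleftrightarrow> u + \<i> * v = 0" by (auto simp: complex_eq_iff)
    finally show ?thesis by simp
  qed
  show ?thesis
    unfolding transport_distr_eq[OF assms] mem_Collect_eq blow_kernel[OF A, symmetric] L
    by (simp add: cext_def w xi i blow_deriv_def cplx_struct_std_def)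
qed

lemma blow_deriv_cplx_struct:
  assumes "ell \<kappa> z > 0" "norm z \<le> R" "norm n < 1"
  shows "blow_deriv \<kappa> z n (cplx_struct_Z \<kappa> R (z, n) a) = cplx_struct_std p (blow_deriv \<kappa> z n a)"
proof -
  let ?D = "blow_deriv \<kappa> z n"
  have bij: "bij ?D" by (rule blow_deriv_bij[OF assms(1,3)])
  have linI: "linear (cplx_struct_std p)"
    unfolding cplx_struct_std_def by (auto intro!: linearI simp: algebra_simps)
  have linv: "linear (inv ?D)" by (rule inj_linear_imp_inv_linear) (simp_all add: linear_blow_deriv bij_is_inj bij)
  define J where "J a = inv ?D (cplx_struct_std p (?D a))" for a
  have DJ: "?D (J a) = cplx_struct_std p (?D a)" for a
    using bij by (simp add: J_def bij_is_surj surj_f_inv_f)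
  have J2: "J (J a) = - a" for a
  proof -
    have "?D (J (J a)) = ?D (- a)"
      by (simp add: DJ linear_neg[OF linear_blow_deriv]) (simp add: cplx_struct_std_def case_prod_unfold prod_eq_iff)
    then show ?thesis using bij by (simp add: bij_is_inj inj_eq)
  qed
  \<comment> \<open>If \<open>K\<close> squares to minus the identity, its eigenvectors for
    \<open>- \<i>\<close> form the graph of \<open>K\<close>. So the distribution determines
    \<open>K\<close>, which settles the definite description.\<close>
  have graph: "cpush K L = cscale (- \<i>) L \<longleftrightarrow> snd L = K (fst L)" if "\<And>a. K (K a) = - a" for K :: "complex \<times> complex \<Rightarrow> _" and L
    using that by (cases L) (auto simp: cpush_def cscale_def)
  have tr: "L \<in> transport_distr \<kappa> R (z, n) \<longleftrightarrow> snd L = J (fst L)" for L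
    unfolding transport_distr_blow[OF assms, of L p] DJ[symmetric] using bij by (auto simp: bij_is_inj inj_eq)
  have "cplx_struct_Z \<kappa> R (z, n) = J"
    unfolding cplx_struct_Z_def
  proof (rule the_equality, intro conjI allI)
    have "J = inv ?D \<circ> cplx_struct_std p \<circ> ?D" by (simp add: fun_eq_iff J_def)
    then show "linear J" by (simp add: linear_compose linear_blow_deriv linI linv)
    show "transport_distr \<kappa> R (z, n) = {L. cpush J L = cscale (- \<i>) L}"
      using tr graph[of J, OF J2] by auto
  next
    fix K assume K: "linear K \<and> (\<forall>a. K (K a) = - a) \<and> transport_distr \<kappa> R (z, n) = {L. cpush K L = cscale (- \<i>) L}"
    show "K = J"
    proof
      fix a
      have "K (K a) = - a" for a using K by blast
      from graph[of K, OF this, of "(a, K a)"] have "(a, K a) \<in> transport_distr \<kappa> R (z, n)" using K by simp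
      then show "K a = J a" using tr by simp
    qed
  qed (rule J2)
  then show ?thesis by (simp add: DJ)
qed

section \<open>Injectivity on the interior\<close>

lemma one_add_pos:
  fixes t :: real
  assumes "R > 0" "\<kappa> > - 1 / R\<^sup>2" "0 \<le> t" "t \<le> R\<^sup>2"
  shows "1 + \<kappa> * t > 0"
proof -
  have "sqrt t \<le> R" using assms by (simp add: real_le_lsqrt)
  then show ?thesis using ell_pos[OF assms(1,2), of "of_real (sqrt t)"] assms(3) by (simp add: ell_def)
qed

text \<open>
  Here \<open>r\<close> stands for the modulus of \<open>\<nu>\<close> and \<open>a + \<i> b\<close> for \<open>w / \<xi>\<close>.  These determine the coordinates
  \<open>p, q\<close> of \<open>z\<close> in the direction of \<open>\<nu>\<close>, and then \<open>ln |\<xi>|\<close> has derivative \<open>(1 + \<kappa> (p\<^sup>2 + q\<^sup>2)) / r\<close>.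
\<close>

lemma modulus_increasing:
  fixes a b :: real
  assumes "R > 0" "\<kappa> > - 1 / R\<^sup>2" and r: "0 < r1" "r1 < r2" "r2 < 1"
    and le: "(a * r2 / (1 - r2\<^sup>2))\<^sup>2 + (b * r2 / (1 + r2\<^sup>2))\<^sup>2 \<le> R\<^sup>2"
  shows "ln r1 + \<kappa> / 2 * (a\<^sup>2 * (r1\<^sup>2 / (1 - r1\<^sup>2)) + b\<^sup>2 * (r1\<^sup>2 / (1 + r1\<^sup>2))) <
         ln r2 + \<kappa> / 2 * (a\<^sup>2 * (r2\<^sup>2 / (1 - r2\<^sup>2)) + b\<^sup>2 * (r2\<^sup>2 / (1 + r2\<^sup>2)))"
proof (rule DERIV_pos_imp_increasing[OF r(2)])
  fix x assume x: "r1 \<le> x" "x \<le> r2"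
  have x0: "0 < x" "x < 1" using x r by auto
  then have x2: "x\<^sup>2 < 1" by (simp add: power_less_one_iff)
  have r22: "r2\<^sup>2 < 1" using r by (simp add: power_less_one_iff)
  \<comment> \<open>\<open>t\<close> is |z|^2 for the point with |\<nu>| = \<open>x\<close> and the
    given value of \<open>w / \<xi>\<close>. Since \<open>x / (1 - x^2)\<close> and
    \<open>x / (1 + x^2)\<close> increase on the unit interval, \<open>t\<close> is bounded by its
    value at \<open>r2\<close>, so the point stays in the disk.\<close>
  define t where "t = (a * x / (1 - x\<^sup>2))\<^sup>2 + (b * x / (1 + x\<^sup>2))\<^sup>2"
  have xr: "x\<^sup>2 \<le> r2\<^sup>2" using x x0 by (intro power_mono) auto
  have "x / (1 - x\<^sup>2) \<le> r2 / (1 - r2\<^sup>2)" using x x0 r22 xr by (intro frac_le) auto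
  then have 1: "(x / (1 - x\<^sup>2))\<^sup>2 \<le> (r2 / (1 - r2\<^sup>2))\<^sup>2" using x0 x2 by (intro power_mono) auto
  have "x * (1 + r2\<^sup>2) \<le> r2 * (1 + x\<^sup>2)"
  proof -
    have "x * r2 \<le> 1" using x0 r by (simp add: mult_le_one less_imp_le)
    then have "(r2 - x) * (1 - x * r2) \<ge> 0" using x by simp
    then show ?thesis by (simp add: algebra_simps power2_eq_square)
  qed
  then have "x / (1 + x\<^sup>2) \<le> r2 / (1 + r2\<^sup>2)" by (simp add: divide_simps add_pos_nonneg)
  then have 2: "(x / (1 + x\<^sup>2))\<^sup>2 \<le> (r2 / (1 + r2\<^sup>2))\<^sup>2" using x0 by (intro power_mono) auto
  have "t \<le> (a * r2 / (1 - r2\<^sup>2))\<^sup>2 + (b * r2 / (1 + r2\<^sup>2))\<^sup>2"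
    unfolding t_def using mult_left_mono[OF 1, of "a\<^sup>2"] mult_left_mono[OF 2, of "b\<^sup>2"]
    by (simp add: power_mult_distrib power_divide)
  then have pos: "1 + \<kappa> * t > 0" using le by (intro one_add_pos[OF assms(1,2)]) (auto simp: t_def)
  have ne: "1 - x\<^sup>2 \<noteq> 0" "1 + x\<^sup>2 \<noteq> 0" "x \<noteq> 0" using x2 x0 by (auto simp: add_pos_nonneg order_less_imp_not_eq2)
  have d1: "((\<lambda>x. x\<^sup>2 / (1 - x\<^sup>2)) has_real_derivative 2 * x / (1 - x\<^sup>2)\<^sup>2) (at x)"
    using ne by (auto intro!: derivative_eq_intros simp: field_simps power2_eq_square)
  have d2: "((\<lambda>x. x\<^sup>2 / (1 + x\<^sup>2)) has_real_derivative 2 * x / (1 + x\<^sup>2)\<^sup>2) (at x)"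
    using ne by (auto intro!: derivative_eq_intros simp: field_simps power2_eq_square)
  have "((\<lambda>x. ln x + \<kappa> / 2 * (a\<^sup>2 * (x\<^sup>2 / (1 - x\<^sup>2)) + b\<^sup>2 * (x\<^sup>2 / (1 + x\<^sup>2)))) has_real_derivative
      inverse x + \<kappa> / 2 * (a\<^sup>2 * (2 * x / (1 - x\<^sup>2)\<^sup>2) + b\<^sup>2 * (2 * x / (1 + x\<^sup>2)\<^sup>2))) (at x)"
    using x0 by (intro DERIV_add DERIV_cmult d1 d2 DERIV_ln) auto
  moreover have "inverse x + \<kappa> / 2 * (a\<^sup>2 * (2 * x / (1 - x\<^sup>2)\<^sup>2) + b\<^sup>2 * (2 * x / (1 + x\<^sup>2)\<^sup>2)) = (1 + \<kappa> * t) / x"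
  proof -
    have "x * (inverse x + \<kappa> / 2 * (a\<^sup>2 * (2 * x / (1 - x\<^sup>2)\<^sup>2) + b\<^sup>2 * (2 * x / (1 + x\<^sup>2)\<^sup>2))) = 1 + \<kappa> * t"
      using ne(3) by (simp add: t_def power_mult_distrib power_divide power2_eq_square[of x] algebra_simps)
    then show ?thesis using ne(3) by (simp add: field_simps)
  qed
  ultimately show "\<exists>y. ((\<lambda>x. ln x + \<kappa> / 2 * (a\<^sup>2 * (x\<^sup>2 / (1 - x\<^sup>2)) + b\<^sup>2 * (x\<^sup>2 / (1 + x\<^sup>2)))) has_real_derivative y) (at x) \<and> y > 0"
    using pos x0 by auto
qed

text \<open>A common rotation of \<open>z\<close> and \<nu> by \<open>cnj u\<close> leaves
  \<open>w / \<xi>\<close>, the exponential factor and |\<xi>| unchanged, which reduces all three to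
  the position \<open>c\<close> and the positive number \<open>r\<close> in place of \<nu>.\<close>

lemma blow_polar:
  assumes u: "norm u = 1" and r: "r > 0" and n: "n = of_real r * u" and c: "c = z * cnj u"
  shows "fst (blow \<kappa> (z, n)) / snd (blow \<kappa> (z, n)) = (c - of_real (r\<^sup>2) * cnj c) / of_real r"
    and "blow_E \<kappa> z n = exp (\<kappa> * (c * cnj c - (cnj c)\<^sup>2 * of_real (r\<^sup>2)) / 2)"
    and "norm (snd (blow \<kappa> (z, n))) = r * exp (\<kappa> / 2 * ((Re c)\<^sup>2 * (1 - r\<^sup>2) + (Im c)\<^sup>2 * (1 + r\<^sup>2)))"
proof -
  have uu: "u * cnj u = 1" "u \<noteq> 0" using u complex_norm_square[of u] by auto
  have z: "z = c * u" unfolding c using uu(1) by algebra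
  have "z - cnj z * n\<^sup>2 = (c - of_real (r\<^sup>2) * cnj c) * u"
    unfolding z n using uu(1) by simp algebra
  then show "fst (blow \<kappa> (z, n)) / snd (blow \<kappa> (z, n)) = (c - of_real (r\<^sup>2) * cnj c) / of_real r"
    using r uu(2) by (simp add: blow_def n)
  have e: "z * cnj z - (cnj z)\<^sup>2 * n\<^sup>2 = c * cnj c - (cnj c)\<^sup>2 * of_real (r\<^sup>2)"
    unfolding z n using uu(1) by simp algebra
  then show E: "blow_E \<kappa> z n = exp (\<kappa> * (c * cnj c - (cnj c)\<^sup>2 * of_real (r\<^sup>2)) / 2)" by (simp add: blow_E_def)
  have "norm (blow_E \<kappa> z n) = exp (\<kappa> / 2 * ((Re c)\<^sup>2 * (1 - r\<^sup>2) + (Im c)\<^sup>2 * (1 + r\<^sup>2)))"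
    unfolding E norm_exp_eq_Re
    by (simp add: power2_eq_square algebra_simps add_divide_distrib diff_divide_distrib)
  then show "norm (snd (blow \<kappa> (z, n))) = r * exp (\<kappa> / 2 * ((Re c)\<^sup>2 * (1 - r\<^sup>2) + (Im c)\<^sup>2 * (1 + r\<^sup>2)))"
    using r u by (simp add: blow_def n norm_mult)
qed

text \<open>If the second modulus were larger, \<open>modulus_increasing\<close> at fixed
  \<open>w / \<xi>\<close> would make |\<xi>| strictly larger there. With the points exchanged, it
  yields equality of the moduli.\<close>

lemma blow_modulus_le:
  assumes \<kappa>: "R > 0" "\<kappa> > - 1 / R\<^sup>2"
    and m: "norm z' < R" "norm n' < 1" "n \<noteq> 0" "n' \<noteq> 0"
    and eq: "blow \<kappa> (z, n) = blow \<kappa> (z', n')"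
  shows "norm n' \<le> norm n"
proof (rule ccontr)
  assume "\<not> norm n' \<le> norm n"
  define r r' where "r = norm n" and "r' = norm n'"
  have lt: "0 < r" "r < r'" "r' < 1" "0 < r'"
    using \<open>\<not> norm n' \<le> norm n\<close> m by (auto simp: r_def r'_def)
  define c c' where "c = z * cnj (sgn n)" and "c' = z' * cnj (sgn n')"
  have n: "n = of_real r * sgn n" "n' = of_real r' * sgn n'"
    using m by (simp_all add: r_def r'_def sgn_div_norm scaleR_conv_of_real)
  have u: "norm (sgn n) = 1" "norm (sgn n') = 1" using m by (simp_all add: norm_sgn)
  note P = blow_polar[OF u(1) lt(1) n(1) c_def, of \<kappa>]
  note P' = blow_polar[OF u(2) lt(4) n(2) c'_def, of \<kappa>]
  define a b where "a = Re ((c - of_real (r\<^sup>2) * cnj c) / of_real r)" and "b = Im ((c - of_real (r\<^sup>2) * cnj c) / of_real r)"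
  have "(c - of_real (r\<^sup>2) * cnj c) / of_real r = (c' - of_real (r'\<^sup>2) * cnj c') / of_real r'" using P(1) P'(1) eq by simp
  then have a': "a = Re ((c' - of_real (r'\<^sup>2) * cnj c') / of_real r')" and b': "b = Im ((c' - of_real (r'\<^sup>2) * cnj c') / of_real r')"
    by (simp_all add: a_def b_def)
  have r2: "r\<^sup>2 < 1" "r'\<^sup>2 < 1" using lt by (simp_all add: power_less_one_iff)
  have pq: "Re c = a * r / (1 - r\<^sup>2)" "Im c = b * r / (1 + r\<^sup>2)"
    if "0 < r" "r\<^sup>2 < 1" "a = Re ((c - of_real (r\<^sup>2) * cnj c) / of_real r)" "b = Im ((c - of_real (r\<^sup>2) * cnj c) / of_real r)"
    for a b r and c :: complex
  proof -
    have "1 + r\<^sup>2 > 0" by (simp add: add_pos_nonneg)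
    moreover have "a = Re c * (1 - r\<^sup>2) / r" "b = Im c * (1 + r\<^sup>2) / r"
      unfolding that(3,4)
      by (simp_all add: Re_divide_of_real Im_divide_of_real algebra_simps del: of_real_power)
    then have "a * r = Re c * (1 - r\<^sup>2)" "b * r = Im c * (1 + r\<^sup>2)"
      using that(1) by simp_all
    ultimately show "Re c = a * r / (1 - r\<^sup>2)" "Im c = b * r / (1 + r\<^sup>2)" using that(2) by auto
  qed
  have pq1: "Re c = a * r / (1 - r\<^sup>2)" "Im c = b * r / (1 + r\<^sup>2)"
    by (rule pq[OF lt(1) r2(1) a_def b_def])+
  have pq2: "Re c' = a * r' / (1 - r'\<^sup>2)" "Im c' = b * r' / (1 + r'\<^sup>2)"
    by (rule pq[OF lt(4) r2(2) a' b'])+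
  have G: "ln (r * exp (\<kappa> / 2 * ((a * r / (1 - r\<^sup>2))\<^sup>2 * (1 - r\<^sup>2) + (b * r / (1 + r\<^sup>2))\<^sup>2 * (1 + r\<^sup>2))))
      = ln r + \<kappa> / 2 * (a\<^sup>2 * (r\<^sup>2 / (1 - r\<^sup>2)) + b\<^sup>2 * (r\<^sup>2 / (1 + r\<^sup>2)))" if "0 < r" "r\<^sup>2 < 1" for r
  proof -
    have "1 + r\<^sup>2 > 0" by (simp add: add_pos_nonneg)
    then have "(a * r / (1 - r\<^sup>2))\<^sup>2 * (1 - r\<^sup>2) = a\<^sup>2 * (r\<^sup>2 / (1 - r\<^sup>2))" "(b * r / (1 + r\<^sup>2))\<^sup>2 * (1 + r\<^sup>2) = b\<^sup>2 * (r\<^sup>2 / (1 + r\<^sup>2))"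
      using that by (simp_all add: power2_eq_square)
    then show ?thesis using that by (simp add: ln_mult)
  qed
  have "norm c' = norm z'" using u(2) by (simp add: c'_def norm_mult)
  then have "(Re c')\<^sup>2 + (Im c')\<^sup>2 \<le> R\<^sup>2"
    using m(1) by (metis cmod_power2 less_imp_le norm_ge_zero power_mono)
  then have "(a * r' / (1 - r'\<^sup>2))\<^sup>2 + (b * r' / (1 + r'\<^sup>2))\<^sup>2 \<le> R\<^sup>2" by (simp add: pq2)
  from modulus_increasing[OF \<kappa> lt(1-3) this]
  have "ln (norm (snd (blow \<kappa> (z, n)))) < ln (norm (snd (blow \<kappa> (z', n'))))"
    unfolding P(3) P'(3) unfolding pq1 pq2 G[OF lt(1) r2(1)] G[OF lt(4) r2(2)] .
  then show False using eq by simp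
qed

text \<open>The locus \<nu> = 0, where \<open>w / \<xi>\<close> is undefined, is treated apart:
  there \<open>w = z * exp (\<kappa> * |z|^2 / 2)\<close>, with modulus increasing in |z|. Elsewhere
  the moduli of \<nu> agree, \<open>w / \<xi>\<close> gives \<open>c\<close>, \<open>c\<close> gives
  the exponential, and \<xi> then gives \<nu>.\<close>

lemma inj_on_blow:
  assumes \<kappa>: "R > 0" "\<kappa> > - 1 / R\<^sup>2"
  shows "inj_on (blow \<kappa>) (Z_interior R)"
proof (rule inj_onI)
  fix p p' assume p: "p \<in> Z_interior R" "p' \<in> Z_interior R" and eq: "blow \<kappa> p = blow \<kappa> p'"
  obtain z n z' n' where zn: "p = (z, n)" "p' = (z', n')" by (metis surj_pair)
  have m: "norm z < R" "norm n < 1" "norm z' < R" "norm n' < 1" using p by (auto simp: zn Z_interior_def)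
  show "p = p'"
  proof (cases "n = 0")
    case True
    then have n': "n' = 0" using eq by (auto simp: zn blow_def)
    have mono: "x * exp (\<kappa> * x\<^sup>2 / 2) < y * exp (\<kappa> * y\<^sup>2 / 2)" if "0 \<le> x" "x < y" "y < R" for x y
    proof (rule DERIV_pos_imp_increasing[OF that(2)])
      fix t assume t: "x \<le> t" "t \<le> y"
      have "((\<lambda>x. x * exp (\<kappa> * x\<^sup>2 / 2)) has_real_derivative exp (\<kappa> * t\<^sup>2 / 2) * (1 + \<kappa> * t\<^sup>2)) (at t)"
        by (auto intro!: derivative_eq_intros simp: power2_eq_square algebra_simps)
      moreover have "1 + \<kappa> * t\<^sup>2 > 0"
        using t that by (intro one_add_pos[OF \<kappa>]) (auto intro!: power_mono)
      ultimately show "\<exists>d. ((\<lambda>x. x * exp (\<kappa> * x\<^sup>2 / 2)) has_real_derivative d) (at t) \<and> d > 0"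
        by (auto intro!: exI[of _ "exp (\<kappa> * t\<^sup>2 / 2) * (1 + \<kappa> * t\<^sup>2)"])
    qed
    have E0: "blow_E \<kappa> x 0 = of_real (exp (\<kappa> * (norm x)\<^sup>2 / 2))" for x
      by (simp add: blow_E_def complex_norm_square[symmetric] exp_of_real[symmetric])
    have e: "z * of_real (exp (\<kappa> * (norm z)\<^sup>2 / 2)) = z' * of_real (exp (\<kappa> * (norm z')\<^sup>2 / 2))"
      using eq True n' by (simp add: zn blow_def E0)
    have "norm z * exp (\<kappa> * (norm z)\<^sup>2 / 2) = norm z' * exp (\<kappa> * (norm z')\<^sup>2 / 2)"
      using arg_cong[OF e, of norm] by (simp add: norm_mult)
    then have "norm z = norm z'"
      using mono[of "norm z" "norm z'"] mono[of "norm z'" "norm z"] m by (metis less_irrefl linorder_neqE_linordered_idom norm_ge_zero)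
    then show ?thesis using e True n' zn by simp
  next
    case False
    have n': "n' \<noteq> 0" using eq False by (auto simp: zn blow_def)
    define r where "r = norm n"
    have r: "norm n' = r" "r > 0"
      using blow_modulus_le[OF \<kappa> m(3,4) False n' eq[unfolded zn]] blow_modulus_le[OF \<kappa> m(1,2) n' False eq[unfolded zn, symmetric]]
        False by (auto simp: r_def)
    define c c' where "c = z * cnj (sgn n)" and "c' = z' * cnj (sgn n')"
    have n: "n = of_real r * sgn n" "n' = of_real r * sgn n'"
      using False n' r by (simp_all add: r_def sgn_div_norm scaleR_conv_of_real)
    have u: "norm (sgn n) = 1" "norm (sgn n') = 1" using False n' by (simp_all add: norm_sgn)
    note P = blow_polar[OF u(1) r(2) n(1) c_def, of \<kappa>]
    note P' = blow_polar[OF u(2) r(2) n(2) c'_def, of \<kappa>]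
    have "(c - of_real (r\<^sup>2) * cnj c) / of_real r = (c' - of_real (r\<^sup>2) * cnj c') / of_real r"
      unfolding P(1)[symmetric] P'(1)[symmetric] using eq zn by simp
    then have "c - of_real (r\<^sup>2) * cnj c = c' - of_real (r\<^sup>2) * cnj c'" using r by simp
    then have "Re c * (1 - r\<^sup>2) = Re c' * (1 - r\<^sup>2)" "Im c * (1 + r\<^sup>2) = Im c' * (1 + r\<^sup>2)"
      unfolding complex_eq_iff by (simp_all add: algebra_simps del: of_real_power)
    moreover have "r\<^sup>2 < 1" using m(2) r by (simp add: r_def power_less_one_iff)
    moreover have "1 + r\<^sup>2 > 0" by (simp add: add_pos_nonneg)
    ultimately have cc: "c = c'" by (simp add: complex_eq_iff)
    then have "blow_E \<kappa> z n = blow_E \<kappa> z' n'" using P(2) P'(2) by simp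
    then have nn: "n = n'" using eq by (simp add: zn blow_def)
    have "cnj (sgn n) \<noteq> 0" using False by (simp add: sgn_zero_iff)
    then have "z = z'" using cc nn by (simp add: c_def c'_def)
    then show ?thesis using nn zn by simp
  qed
qed

text \<open>Eliminating \<open>k\<close> and \<open>s\<close> leaves
  \<open>A * h - B * cnj h = 2 * K\<close>, which is solved together with its conjugate by Cramer's
  rule. The formula exhibits the inverse derivative as a smooth function of the point.\<close>

lemma blow_deriv_solve:
  assumes l: "ell \<kappa> z > 0" and n: "norm n < 1" and eq: "blow_deriv \<kappa> z n (h, k) = (w, x)"
  defines "A \<equiv> xi_zbar \<kappa> z n" and "B \<equiv> xi_z \<kappa> z n" and "u \<equiv> w / blow_E \<kappa> z n" and "j \<equiv> x / blow_E \<kappa> z n"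
  defines "K \<equiv> (1 - \<kappa> * (cnj z)\<^sup>2 * n\<^sup>2) * u + cnj z * n * A * j"
  shows "h = 2 * (cnj A * K + B * cnj K) / (A * cnj A - B * cnj B)"
    and "k = j - n * ((xi_nu \<kappa> z n * cnj h + \<kappa> * cnj z * u) / A)"
proof -
  define s where "s = blow_dlnE \<kappa> z n h (cnj h) k"
  have s: "2 * s = \<kappa> * (cnj z * h + (z - 2 * cnj z * n\<^sup>2) * cnj h - 2 * (cnj z)\<^sup>2 * n * k)"
    by (simp add: s_def blow_dlnE_def)
  have u: "u = h - n\<^sup>2 * cnj h - 2 * cnj z * n * k + (z - cnj z * n\<^sup>2) * s" and j: "j = k + n * s"
    using eq by (simp_all add: u_def j_def blow_deriv_def blow_dw_def blow_dxi_def s_def[symmetric] field_simps)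
  have k: "k = j - n * s" using j by simp
  have A: "A \<noteq> 0" unfolding A_def by (rule xi_zbar_nonzero(2)[OF l n])
  have As: "A * s = xi_nu \<kappa> z n * cnj h + \<kappa> * cnj z * u"
    using s u unfolding A_def xi_zbar_def xi_nu_def k by algebra
  then have "s = (xi_nu \<kappa> z n * cnj h + \<kappa> * cnj z * u) / A" using A by (simp add: field_simps)
  then show "k = j - n * ((xi_nu \<kappa> z n * cnj h + \<kappa> * cnj z * u) / A)" using k by simp
  have hK: "A * h - B * cnj h = 2 * K"
    using s u unfolding K_def A_def B_def xi_zbar_def xi_z_def k by algebra
  have hK': "cnj A * cnj h - cnj B * h = 2 * cnj K" using arg_cong[OF hK, of cnj] by simp
  have "h * (A * cnj A - B * cnj B) = 2 * (cnj A * K + B * cnj K)" using hK hK' by algebra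
  moreover have "A * cnj A - B * cnj B = of_real ((norm A)\<^sup>2 - (norm B)\<^sup>2)"
    by (simp only: of_real_diff complex_norm_square)
  moreover have "(norm A)\<^sup>2 - (norm B)\<^sup>2 > 0" unfolding A_def B_def by (rule xi_zbar_nonzero(1)[OF l n])
  ultimately have "h * (A * cnj A - B * cnj B) = 2 * (cnj A * K + B * cnj K)" "A * cnj A - B * cnj B \<noteq> 0"
    by (simp_all only: of_real_eq_0_iff)
  then show "h = 2 * (cnj A * K + B * cnj K) / (A * cnj A - B * cnj B)" by (metis nonzero_eq_divide_eq)
qed

section \<open>Smoothness of the inverse and biholomorphy\<close>

lemma Z_interior_props:
  assumes "R > 0" "\<kappa> > - 1 / R\<^sup>2" "(z, n) \<in> Z_interior R"
  shows "ell \<kappa> z > 0" "norm z \<le> R" "norm n < 1"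
  using assms ell_pos[OF assms(1,2)] by (auto simp: Z_interior_def)

lemma open_Z_interior: "open (Z_interior R)"
  by (simp add: Z_interior_def open_Times)

lemma open_blow_image:
  assumes "R > 0" "\<kappa> > - 1 / R\<^sup>2"
  shows "open (blow \<kappa> ` Z_interior R)"
  using Ck_on_imp_continuous[OF Ck_on_blow[OF open_Z_interior]] open_Z_interior inj_on_blow[OF assms]
  by (rule invariance_of_domain)

lemma blow_inverse_has_derivative:
  assumes \<kappa>: "R > 0" "\<kappa> > - 1 / R\<^sup>2" and p: "(z, n) \<in> Z_interior R"
  shows "(inv_into (Z_interior R) (blow \<kappa>) has_derivative inv (blow_deriv \<kappa> z n)) (at (blow \<kappa> (z, n)))"
proof (rule has_derivative_inverse_strong[OF open_Z_interior p])
  show "continuous_on (Z_interior R) (blow \<kappa>)"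
    by (rule Ck_on_imp_continuous[OF Ck_on_blow[OF open_Z_interior]])
  have "bij (blow_deriv \<kappa> z n)" using Z_interior_props[OF assms] blow_deriv_bij by blast
  then show "blow_deriv \<kappa> z n \<circ> inv (blow_deriv \<kappa> z n) = id" by (simp add: bij_is_surj surj_iff[symmetric])
qed (use inj_on_blow[OF \<kappa>] blow_has_derivative in \<open>auto simp: inv_into_f_f\<close>)

lemma Ck_on_inv_blow_deriv:
  assumes \<kappa>: "R > 0" "\<kappa> > - 1 / R\<^sup>2"
  shows "Ck_on m (\<lambda>p. inv (blow_deriv \<kappa> (fst p) (snd p)) v) (Z_interior R)"
proof -
  obtain w x where v: "v = (w, x)" by (metis surj_pair)
  define A where "A = (\<lambda>p. xi_zbar \<kappa> (fst p) (snd p))"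
  define B where "B = (\<lambda>p. xi_z \<kappa> (fst p) (snd p))"
  define u where "u = (\<lambda>p. w / blow_E \<kappa> (fst p) (snd p))"
  define j where "j = (\<lambda>p. x / blow_E \<kappa> (fst p) (snd p))"
  define K where "K = (\<lambda>p. (1 - \<kappa> * (cnj (fst p))\<^sup>2 * (snd p)\<^sup>2) * u p + cnj (fst p) * snd p * A p * j p)"
  define h where "h = (\<lambda>p. 2 * (cnj (A p) * K p + B p * cnj (K p)) / (A p * cnj (A p) - B p * cnj (B p)))"
  define k where "k = (\<lambda>p. j p - snd p * ((xi_nu \<kappa> (fst p) (snd p) * cnj (h p) + \<kappa> * cnj (fst p) * u p) / A p))"
  note CkI = Ck_on_mult Ck_on_add Ck_on_diff Ck_on_const Ck_on_power Ck_on_cnj Ck_on_fst Ck_on_snd Ck_on_id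
    open_Z_interior
  have ne: "A p \<noteq> 0" "A p * cnj (A p) - B p * cnj (B p) \<noteq> 0" if "p \<in> Z_interior R" for p
  proof -
    have "A p * cnj (A p) - B p * cnj (B p) = of_real ((norm (A p))\<^sup>2 - (norm (B p))\<^sup>2)"
      by (simp only: of_real_diff complex_norm_square)
    moreover have "(norm (A p))\<^sup>2 - (norm (B p))\<^sup>2 > 0" and A: "A p \<noteq> 0"
      using Z_interior_props[OF \<kappa>, of "fst p" "snd p"] that xi_zbar_nonzero by (simp_all add: A_def B_def)
    ultimately show "A p * cnj (A p) - B p * cnj (B p) \<noteq> 0"
      by (simp only: of_real_eq_0_iff)
    show "A p \<noteq> 0" by (rule A)
  qed
  have A: "Ck_on m A (Z_interior R)" and B: "Ck_on m B (Z_interior R)"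
    unfolding A_def B_def xi_zbar_def xi_z_def by (intro CkI)+
  have u: "Ck_on m u (Z_interior R)" and j: "Ck_on m j (Z_interior R)"
    unfolding u_def j_def by (auto intro!: Ck_on_divide Ck_on_blow_E CkI)
  have K: "Ck_on m K (Z_interior R)" unfolding K_def by (intro CkI u j A)
  have h: "Ck_on m h (Z_interior R)" unfolding h_def
    by (intro Ck_on_divide CkI A B K) (use ne in auto)
  have "Ck_on m (\<lambda>p. (h p, k p)) (Z_interior R)"
    unfolding k_def xi_nu_def by (intro Ck_on_Pair Ck_on_divide CkI A B K h u j) (use ne in auto)
  then show ?thesis
  proof (rule Ck_on_cong[OF open_Z_interior, rotated])
    fix p assume p: "p \<in> Z_interior R"
    obtain z n where zn: "p = (z, n)" by (metis surj_pair)
    note pr = Z_interior_props[OF \<kappa> p[unfolded zn]]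
    obtain h' k' where hk: "inv (blow_deriv \<kappa> z n) v = (h', k')" by (metis surj_pair)
    have "blow_deriv \<kappa> z n (h', k') = (w, x)"
      using blow_deriv_bij[OF pr(1,3)] hk v by (metis bij_is_surj surj_f_inv_f)
    note sol = blow_deriv_solve[OF pr(1,3) this]
    have 1: "h p = h'"
      unfolding h_def K_def A_def B_def u_def j_def unfolding zn fst_conv snd_conv by (rule sol(1)[symmetric])
    have 2: "k p = k'"
      unfolding k_def 1 unfolding A_def u_def j_def unfolding zn fst_conv snd_conv by (rule sol(2)[symmetric])
    show "(h p, k p) = inv (blow_deriv \<kappa> (fst p) (snd p)) v"
      unfolding 1 2 unfolding zn fst_conv snd_conv hk ..
  qed
qed

text \<open>Bootstrapping: the derivative of the inverse \<open>g\<close> is a smooth function of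
  the point composed with \<open>g\<close> itself, so \<open>g\<close> of class \<open>m\<close> has
  a derivative of class \<open>m\<close>.\<close>

lemma Ck_on_blow_inverse:
  assumes \<kappa>: "R > 0" "\<kappa> > - 1 / R\<^sup>2"
  shows "Ck_on m (inv_into (Z_interior R) (blow \<kappa>)) (blow \<kappa> ` Z_interior R)" (is "Ck_on m ?g ?V")
proof -
  have der: "(?g has_derivative inv (blow_deriv \<kappa> (fst (?g y)) (snd (?g y)))) (at y)" if "y \<in> ?V" for y
  proof -
    obtain p where "p \<in> Z_interior R" "y = blow \<kappa> p" using \<open>y \<in> _\<close> by (elim imageE)
    then obtain z n where zn: "(z, n) \<in> Z_interior R" "y = blow \<kappa> (z, n)" by (cases p) simp
    then have "?g y = (z, n)" using inj_on_blow[OF \<kappa>] by (simp add: inv_into_f_f)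
    then show ?thesis using blow_inverse_has_derivative[OF \<kappa> zn(1)] zn(2) by simp
  qed
  show ?thesis
  proof (induction m)
    case 0
    show ?case using der by (auto intro!: continuous_at_imp_continuous_on has_derivative_continuous)
  next
    case (Suc m)
    show ?case
    proof (rule Ck_on_Suc[OF der open_blow_image[OF \<kappa>]])
      fix v
      show "Ck_on m (\<lambda>y. inv (blow_deriv \<kappa> (fst (?g y)) (snd (?g y))) v) ?V"
        by (rule Ck_on_compose[OF open_blow_image[OF \<kappa>] open_Z_interior _ Suc Ck_on_inv_blow_deriv[OF \<kappa>]])
          (rule image_subsetI, rule inv_into_into)
    qed
  qed
qed

lemma smooth_on_open: "open A \<Longrightarrow> (\<And>k. Ck_on k f A) \<Longrightarrow> smooth_on A f"
  unfolding smooth_on_def by blast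

lemma biholo_blow:
  assumes \<kappa>: "R > 0" "\<kappa> > - 1 / R\<^sup>2"
  shows "biholo_onto_image (cplx_struct_Z \<kappa> R) cplx_struct_std (Z_interior R) (blow \<kappa>)"
proof -
  let ?U = "Z_interior R" and ?g = "inv_into (Z_interior R) (blow \<kappa>)"
  note fd = frechet_derivativeI[OF blow_has_derivative]
  have "holo_map (cplx_struct_Z \<kappa> R) cplx_struct_std ?U (blow \<kappa>)"
    unfolding holo_map_def
  proof (intro conjI ballI allI)
    show "smooth_on ?U (blow \<kappa>)" by (intro smooth_on_open open_Z_interior Ck_on_blow)
    fix p a assume p: "p \<in> ?U"
    obtain z n where zn: "p = (z, n)" by (metis surj_pair)
    show "frechet_derivative (blow \<kappa>) (at p) (cplx_struct_Z \<kappa> R p a) =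
        cplx_struct_std (blow \<kappa> p) (frechet_derivative (blow \<kappa>) (at p) a)"
      unfolding zn fd using Z_interior_props[OF \<kappa> p[unfolded zn]] by (rule blow_deriv_cplx_struct)
  qed
  moreover have "holo_map cplx_struct_std (cplx_struct_Z \<kappa> R) (blow \<kappa> ` ?U) ?g"
    unfolding holo_map_def
  proof (intro conjI ballI allI)
    show "smooth_on (blow \<kappa> ` ?U) ?g" by (intro smooth_on_open open_blow_image Ck_on_blow_inverse \<kappa>)
    fix y a assume "y \<in> blow \<kappa> ` ?U"
    then obtain z n where zn: "(z, n) \<in> ?U" "y = blow \<kappa> (z, n)" by auto
    note pr = Z_interior_props[OF \<kappa> zn(1)]
    have g: "?g y = (z, n)" using inj_on_blow[OF \<kappa>] zn by (simp add: inv_into_f_f)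
    let ?D = "blow_deriv \<kappa> z n"
    have bij: "bij ?D" by (rule blow_deriv_bij[OF pr(1,3)])
    have "?D (cplx_struct_Z \<kappa> R (z, n) (inv ?D a)) = cplx_struct_std y a"
      using blow_deriv_cplx_struct[OF pr, of "inv ?D a" y] bij by (simp add: bij_is_surj surj_f_inv_f)
    then have "inv ?D (cplx_struct_std y a) = cplx_struct_Z \<kappa> R (z, n) (inv ?D a)"
      using bij by (metis bij_inv_eq_iff)
    then show "frechet_derivative ?g (at y) (cplx_struct_std y a) =
        cplx_struct_Z \<kappa> R (?g y) (frechet_derivative ?g (at y) a)"
      unfolding g unfolding zn(2) frechet_derivativeI[OF blow_inverse_has_derivative[OF \<kappa> zn(1)]] by simp
  qed
  ultimately show ?thesis
    unfolding biholo_onto_image_def using inj_on_blow[OF \<kappa>] open_blow_image[OF \<kappa>] by blast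
qed

section \<open>Coercivity of the pulled back Hermitian form\<close>

lemma real_linear_complex:
  fixes f :: "complex \<Rightarrow> complex"
  assumes "linear f"
  shows "f h = (f 1 - \<i> * f \<i>) / 2 * h + (f 1 + \<i> * f \<i>) / 2 * cnj h"
proof -
  have "h = Re h *\<^sub>R 1 + Im h *\<^sub>R \<i>" by (simp add: complex_eq_iff)
  then have "f h = Re h *\<^sub>R f 1 + Im h *\<^sub>R f \<i>"
    by (metis assms linear_add linear_cmul)
  then show ?thesis by (simp add: complex_eq_iff field_simps)
qed

lemma linear_wirtinger:
  fixes f :: "complex \<times> complex \<Rightarrow> complex"
  assumes "linear f"
  shows "f (h, k) = cext f d_z * h + cext f d_zbar * cnj h + cext f d_nu * k + cext f d_nubar * cnj k"
proof -
  have l1: "linear (\<lambda>h. f (h, 0))" and l2: "linear (\<lambda>k. f (0, k))"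
    using linear_compose[OF linearI assms, of "\<lambda>h. (h, 0)"] linear_compose[OF linearI assms, of "\<lambda>k. (0, k)"]
    by (simp_all add: o_def)
  have c: "f (c *\<^sub>R h, 0) = c *\<^sub>R f (h, 0)" "f (0, c *\<^sub>R h) = c *\<^sub>R f (0, h)" for c h
    using linear_cmul[OF l1] linear_cmul[OF l2] by auto
  have half: "f (1/2, 0) = f (1, 0) / 2" "f (\<i>/2, 0) = f (\<i>, 0) / 2" "f (- \<i>/2, 0) = - f (\<i>, 0) / 2"
    "f (0, 1/2) = f (0, 1) / 2" "f (0, \<i>/2) = f (0, \<i>) / 2" "f (0, - \<i>/2) = - f (0, \<i>) / 2"
    using c[of "1/2" 1] c[of "1/2" "\<i>"] c[of "-1/2" "\<i>"] by (simp_all add: scaleR_conv_of_real)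
  have "f (h, k) = f (h, 0) + f (0, k)" using linear_add[OF assms, of "(h, 0)" "(0, k)"] by simp
  also have "\<dots> = (f (1, 0) - \<i> * f (\<i>, 0)) / 2 * h + (f (1, 0) + \<i> * f (\<i>, 0)) / 2 * cnj h
      + ((f (0, 1) - \<i> * f (0, \<i>)) / 2 * k + (f (0, 1) + \<i> * f (0, \<i>)) / 2 * cnj k)"
    using real_linear_complex[OF l1, of h] real_linear_complex[OF l2, of k] by simp
  finally show ?thesis
    unfolding d_z_def d_zbar_def d_nu_def d_nubar_def cext_def case_prod_conv half
    by (simp add: field_simps)
qed

lemma cext_Xi:
  fixes f :: "complex \<times> complex \<Rightarrow> complex"
  assumes f: "linear f"
  shows "cext f (Xi \<kappa> (z, n)) = xi_z \<kappa> z n * cext f d_z + xi_zbar \<kappa> z n * cext f d_zbar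
      + xi_nu \<kappa> z n * (cnj n * cext f d_nubar - n * cext f d_nu)"
    and "cext f (cconj (Xi \<kappa> (z, n))) = cnj (xi_z \<kappa> z n) * cext f d_zbar + cnj (xi_zbar \<kappa> z n) * cext f d_z
      + cnj (xi_nu \<kappa> z n) * (n * cext f d_nu - cnj n * cext f d_nubar)"
proof -
  show "cext f (Xi \<kappa> (z, n)) = xi_z \<kappa> z n * cext f d_z + xi_zbar \<kappa> z n * cext f d_zbar
      + xi_nu \<kappa> z n * (cnj n * cext f d_nubar - n * cext f d_nu)"
    unfolding Xi_def case_prod_conv xi_z_def[symmetric] xi_zbar_def[symmetric] xi_nu_def[symmetric]
    by (simp add: cext_add[OF f] cext_diff[OF f] cext_cscale[OF f])
  have cc: "cconj (L + M) = cconj L + cconj M" "cconj (L - M) = cconj L - cconj M"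
    "cconj (cscale c L) = cscale (cnj c) (cconj L)" for L M :: "(complex \<times> complex) cplx" and c
    by (auto simp: cconj_def cscale_def split: prod.splits)
  have cd: "cconj d_z = d_zbar" "cconj d_zbar = d_z" "cconj d_nu = d_nubar" "cconj d_nubar = d_nu"
    by (simp_all add: cconj_def d_z_def d_zbar_def d_nu_def d_nubar_def)
  show "cext f (cconj (Xi \<kappa> (z, n))) = cnj (xi_z \<kappa> z n) * cext f d_zbar + cnj (xi_zbar \<kappa> z n) * cext f d_z
      + cnj (xi_nu \<kappa> z n) * (n * cext f d_nu - cnj n * cext f d_nubar)"
    unfolding Xi_def case_prod_conv xi_z_def[symmetric] xi_zbar_def[symmetric] xi_nu_def[symmetric] cc cd
    by (simp add: cext_add[OF f] cext_diff[OF f] cext_cscale[OF f] cc cd)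
qed

text \<open>Once the \<nu>-coefficients vanish, \<open>Xi\<close> and its conjugate give a
  two-by-two system for the coefficients at \<open>d_z\<close> and \<open>d_zbar\<close>, whose
  determinant is nonzero by \<open>xi_zbar_nonzero\<close>.\<close>

lemma frame_separates:
  fixes f :: "complex \<times> complex \<Rightarrow> complex"
  assumes f: "linear f" and l: "ell \<kappa> z > 0" and n: "norm n < 1"
    and "cext f d_nu = 0" "cext f d_nubar = 0" "cext f (Xi \<kappa> (z, n)) = 0" "cext f (cconj (Xi \<kappa> (z, n))) = 0"
  shows "f a = 0"
proof -
  let ?A = "xi_zbar \<kappa> z n" and ?B = "xi_z \<kappa> z n"
  have 1: "?B * cext f d_z + ?A * cext f d_zbar = 0" "cnj ?B * cext f d_zbar + cnj ?A * cext f d_z = 0"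
    using assms(4-7) unfolding cext_Xi[OF f] by simp_all
  have "(?A * cnj ?A - ?B * cnj ?B) * cext f d_z = 0" "(?A * cnj ?A - ?B * cnj ?B) * cext f d_zbar = 0"
    using 1 by algebra+
  moreover have "?A * cnj ?A - ?B * cnj ?B = of_real ((norm ?A)\<^sup>2 - (norm ?B)\<^sup>2)"
    by (simp only: of_real_diff complex_norm_square)
  then have "?A * cnj ?A - ?B * cnj ?B \<noteq> 0"
    using xi_zbar_nonzero(1)[OF l n] by (metis of_real_eq_0_iff less_irrefl)
  ultimately have "cext f d_z = 0" "cext f d_zbar = 0" by simp_all
  then show ?thesis using linear_wirtinger[OF f, of "fst a" "snd a"] assms(4,5) by simp
qed

lemma coframe_unique:
  fixes f g :: "complex \<times> complex \<Rightarrow> complex"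
  assumes f: "linear f" and g: "linear g" and l: "ell \<kappa> z > 0" and n: "norm n < 1"
    and "cext f d_nu = cext g d_nu" "cext f d_nubar = cext g d_nubar"
      "cext f (Xi \<kappa> (z, n)) = cext g (Xi \<kappa> (z, n))"
      "cext f (cconj (Xi \<kappa> (z, n))) = cext g (cconj (Xi \<kappa> (z, n)))"
  shows "f = g"
proof
  fix a
  have "cext (\<lambda>a. f a - g a) L = cext f L - cext g L" for L
    by (cases L) (simp add: cext_def algebra_simps)
  then have "f a - g a = 0"
    using assms(5-8) by (intro frame_separates[OF linear_compose_sub[OF f g] l n]) auto
  then show "f a = g a" by simp
qed

lemma cext_coords:
  fixes x y k m :: complex
  shows "cext (\<lambda>(h, j). x * h + y * cnj h + k * j + m * cnj j) d_z = x"
    "cext (\<lambda>(h, j). x * h + y * cnj h + k * j + m * cnj j) d_zbar = y"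
    "cext (\<lambda>(h, j). x * h + y * cnj h + k * j + m * cnj j) d_nu = k"
    "cext (\<lambda>(h, j). x * h + y * cnj h + k * j + m * cnj j) d_nubar = m"
  by (simp_all add: cext_def d_z_def d_zbar_def d_nu_def d_nubar_def field_simps)

lemma linear_coords_form: "linear (\<lambda>(h, j). x * h + y * cnj h + k * j + m * cnj j :: complex)"
  by (auto intro!: linearI simp: algebra_simps scaleR_conv_of_real)

lemma coframe_exists:
  assumes l: "ell \<kappa> z > 0" and n: "norm n < 1"
  shows "\<exists>f. linear f \<and> cext f d_nu = c \<and> cext f d_nubar = 0 \<and>
    cext f (Xi \<kappa> (z, n)) = 0 \<and> cext f (cconj (Xi \<kappa> (z, n))) = d"
proof -
  let ?A = "xi_zbar \<kappa> z n" and ?B = "xi_z \<kappa> z n"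
  define Q where "Q = ?A * cnj ?A - ?B * cnj ?B"
  have "Q = of_real ((norm ?A)\<^sup>2 - (norm ?B)\<^sup>2)"
    by (simp only: of_real_diff complex_norm_square Q_def)
  then have Q: "Q \<noteq> 0"
    using xi_zbar_nonzero(1)[OF l n] by (metis of_real_eq_0_iff less_irrefl)
  \<comment> \<open>\<open>e\<close> and \<open>e'\<close> are the prescribed values less the
    contribution of the \<open>d_nu\<close> coefficient \<open>c\<close> through the rotational part
    of \<open>Xi\<close>; \<open>x\<close> and \<open>y\<close> solve the remaining system by
    Cramer's rule.\<close>
  define e where "e = d - c * n * cnj (xi_nu \<kappa> z n)"
  define e' where "e' = c * n * xi_nu \<kappa> z n"
  define x y where "x = (?A * e - cnj ?B * e') / Q" and "y = (cnj ?A * e' - ?B * e) / Q"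
  let ?f = "\<lambda>(h, j). x * h + y * cnj h + c * j + 0 * cnj j"
  have "Q * (?B * x + ?A * y) = Q * e'" "Q * (cnj ?B * y + cnj ?A * x) = Q * e"
  proof -
    have "Q * x = ?A * e - cnj ?B * e'" "Q * y = cnj ?A * e' - ?B * e" using Q by (simp_all add: x_def y_def)
    then show "Q * (?B * x + ?A * y) = Q * e'" "Q * (cnj ?B * y + cnj ?A * x) = Q * e"
      unfolding Q_def by algebra+
  qed
  then have "?B * x + ?A * y = e'" "cnj ?B * y + cnj ?A * x = e" using Q by simp_all
  then have "cext ?f (Xi \<kappa> (z, n)) = 0" "cext ?f (cconj (Xi \<kappa> (z, n))) = d"
    unfolding cext_Xi[OF linear_coords_form] cext_coords by (simp_all add: e_def e'_def algebra_simps)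
  then show ?thesis
    by (intro exI[of _ ?f] conjI linear_coords_form) (simp_all only: cext_coords)
qed

text \<open>Both forms are instances of one dual-frame problem; they differ in the values prescribed
  on \<open>d_nu\<close> and on the conjugate of \<open>Xi\<close>.\<close>

lemma eta_form_props:
  assumes l: "ell \<kappa> z > 0" and n: "norm n < 1"
  shows "linear (eta_form \<kappa> (z, n) 1)" "cext (eta_form \<kappa> (z, n) 1) d_nu = 0"
      "cext (eta_form \<kappa> (z, n) 1) d_nubar = 0" "cext (eta_form \<kappa> (z, n) 1) (Xi \<kappa> (z, n)) = 0"
      "cext (eta_form \<kappa> (z, n) 1) (cconj (Xi \<kappa> (z, n))) = of_real (1 - norm n ^ 4)"
    and "linear (eta_form \<kappa> (z, n) 2)" "cext (eta_form \<kappa> (z, n) 2) d_nu = 1"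
      "cext (eta_form \<kappa> (z, n) 2) d_nubar = 0" "cext (eta_form \<kappa> (z, n) 2) (Xi \<kappa> (z, n)) = 0"
      "cext (eta_form \<kappa> (z, n) 2) (cconj (Xi \<kappa> (z, n))) = 0"
proof -
  let ?P = "\<lambda>c d f. linear f \<and> cext f d_nu = c \<and> cext f d_nubar = 0 \<and>
    cext f (Xi \<kappa> (z, n)) = 0 \<and> cext f (cconj (Xi \<kappa> (z, n))) = d"
  have ex1: "\<exists>!f. ?P c d f" for c d
  proof (rule ex_ex1I[OF coframe_exists[OF l n]])
    fix f g assume "?P c d f" "?P c d g"
    then show "f = g" by (intro coframe_unique[OF _ _ l n]) auto
  qed
  have e1: "eta_form \<kappa> (z, n) 1 = (THE f. ?P 0 (of_real (1 - norm n ^ 4)) f)"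
    unfolding eta_form_def by (rule arg_cong[of _ _ The]) auto
  have "?P 0 (of_real (1 - norm n ^ 4)) (eta_form \<kappa> (z, n) 1)" unfolding e1 by (rule theI'[OF ex1])
  then show "linear (eta_form \<kappa> (z, n) 1)" "cext (eta_form \<kappa> (z, n) 1) d_nu = 0"
      "cext (eta_form \<kappa> (z, n) 1) d_nubar = 0" "cext (eta_form \<kappa> (z, n) 1) (Xi \<kappa> (z, n)) = 0"
      "cext (eta_form \<kappa> (z, n) 1) (cconj (Xi \<kappa> (z, n))) = of_real (1 - norm n ^ 4)" by auto
  have e2: "eta_form \<kappa> (z, n) 2 = (THE f. ?P 1 0 f)"
    unfolding eta_form_def by (rule arg_cong[of _ _ The]) auto
  have "?P 1 0 (eta_form \<kappa> (z, n) 2)" unfolding e2 by (rule theI'[OF ex1])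
  then show "linear (eta_form \<kappa> (z, n) 2)" "cext (eta_form \<kappa> (z, n) 2) d_nu = 1"
      "cext (eta_form \<kappa> (z, n) 2) d_nubar = 0" "cext (eta_form \<kappa> (z, n) 2) (Xi \<kappa> (z, n)) = 0"
      "cext (eta_form \<kappa> (z, n) 2) (cconj (Xi \<kappa> (z, n))) = 0" by auto
qed

text \<open>
  The coefficients of \<open>dw\<close> and \<open>d\<xi>\<close> with respect to \<open>\<eta>\<^sub>1, \<eta>\<^sub>2\<close>.  The factor \<open>1 - |\<nu>|\<^sup>4\<close> in the
  definition of \<open>\<eta>\<^sub>1\<close> cancels, so they are continuous up to the boundary, and the determinant
  is \<open>2 (1 + \<kappa> |z|\<^sup>2) E\<^sup>2\<close>.
\<close>

definition w_coeff :: "real \<Rightarrow> complex \<times> complex \<Rightarrow> complex \<times> complex" where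
  "w_coeff \<kappa> = (\<lambda>(z, n). (blow_E \<kappa> z n * (2 + 2 * of_real \<kappa> * cnj z * (z - cnj z * n\<^sup>2)),
     blow_E \<kappa> z n * (- 2 * cnj z * n - \<kappa> * (cnj z)\<^sup>2 * n * (z - cnj z * n\<^sup>2))))"

definition xi_coeff :: "real \<Rightarrow> complex \<times> complex \<Rightarrow> complex \<times> complex" where
  "xi_coeff \<kappa> = (\<lambda>(z, n). (blow_E \<kappa> z n * (2 * of_real \<kappa> * cnj z * n),
     blow_E \<kappa> z n * (1 - \<kappa> * (cnj z)\<^sup>2 * n\<^sup>2)))"

lemma blow_coeff_det:
  "fst (w_coeff \<kappa> (z, n)) * snd (xi_coeff \<kappa> (z, n)) - snd (w_coeff \<kappa> (z, n)) * fst (xi_coeff \<kappa> (z, n))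
    = 2 * of_real (ell \<kappa> z) * (blow_E \<kappa> z n)\<^sup>2"
  unfolding w_coeff_def xi_coeff_def ell_complex case_prod_conv fst_conv snd_conv by algebra

text \<open>Both components of the derivative annihilate \<open>Xi\<close> and
  \<open>d_nubar\<close>, so they are combinations of the coframe. The coefficients are the value on
  the conjugate of \<open>Xi\<close> divided by \<open>1 - |\<nu>|^4\<close>, and the value on
  \<open>d_nu\<close>.\<close>

lemma blow_deriv_coframe:
  assumes l: "ell \<kappa> z > 0" and n: "norm n < 1"
  shows "fst (blow_deriv \<kappa> z n a) =
      fst (w_coeff \<kappa> (z, n)) * eta_form \<kappa> (z, n) 1 a + snd (w_coeff \<kappa> (z, n)) * eta_form \<kappa> (z, n) 2 a" (is "?f a = ?f' a")
    and "snd (blow_deriv \<kappa> z n a) =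
      fst (xi_coeff \<kappa> (z, n)) * eta_form \<kappa> (z, n) 1 a + snd (xi_coeff \<kappa> (z, n)) * eta_form \<kappa> (z, n) 2 a" (is "?g a = ?g' a")
proof -
  note \<eta> = eta_form_props[OF l n]
  let ?E = "blow_E \<kappa> z n"
  have lin: "linear ?f" "linear ?g"
    using linear_compose[OF linear_blow_deriv linear_coords(1)] linear_compose[OF linear_blow_deriv linear_coords(2)]
    by (simp_all add: o_def)
  have lin': "linear (\<lambda>a. x * eta_form \<kappa> (z, n) 1 a + y * eta_form \<kappa> (z, n) 2 a)" for x y
    by (rule linearI) (simp_all add: linear_add[OF \<eta>(1)] linear_add[OF \<eta>(6)] linear_cmul[OF \<eta>(1)]
      linear_cmul[OF \<eta>(6)] algebra_simps)
  have ce: "cext (\<lambda>a. x * eta_form \<kappa> (z, n) 1 a + y * eta_form \<kappa> (z, n) 2 a) L =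
      x * cext (eta_form \<kappa> (z, n) 1) L + y * cext (eta_form \<kappa> (z, n) 2) L" for x y L
    by (cases L) (simp add: cext_def algebra_simps)
  have f: "cext ?f d_z = ?E * blow_dw \<kappa> z n 1 0 0" "cext ?f d_zbar = ?E * blow_dw \<kappa> z n 0 1 0"
      "cext ?f d_nu = ?E * blow_dw \<kappa> z n 0 0 1" "cext ?f d_nubar = 0"
    and g: "cext ?g d_z = ?E * blow_dxi \<kappa> z n 1 0 0" "cext ?g d_zbar = ?E * blow_dxi \<kappa> z n 0 1 0"
      "cext ?g d_nu = ?E * blow_dxi \<kappa> z n 0 0 1" "cext ?g d_nubar = 0"
    unfolding cext_def d_z_def d_zbar_def d_nu_def d_nubar_def blow_deriv_def blow_dw_def blow_dxi_def blow_dlnE_def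
    by (simp_all add: field_simps)
  \<comment> \<open>Working with half of \<kappa> removes the division in \<open>blow_dlnE\<close>,
    so that the frame identities become polynomial.\<close>
  define k where "k = complex_of_real \<kappa> / 2"
  have half: "complex_of_real \<kappa> / 2 = k" and double: "complex_of_real \<kappa> = 2 * k" and k: "cnj k = k"
    by (simp_all add: k_def)
  note cnjs = complex_cnj_add complex_cnj_diff complex_cnj_mult complex_cnj_power complex_cnj_cnj
    complex_cnj_numeral k
  have "?f = ?f'"
  proof (rule coframe_unique[OF lin(1) lin' l n]; unfold cext_Xi[OF lin(1)] ce \<eta> f norm_power4)
    show "?E * blow_dw \<kappa> z n 0 0 1 = fst (w_coeff \<kappa> (z, n)) * 0 + snd (w_coeff \<kappa> (z, n)) * 1"
      by (simp add: w_coeff_def blow_dw_def blow_dlnE_def field_simps)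
  next
    have "2 * (xi_z \<kappa> z n * blow_dw \<kappa> z n 1 0 0 + xi_zbar \<kappa> z n * blow_dw \<kappa> z n 0 1 0 -
      xi_nu \<kappa> z n * n * blow_dw \<kappa> z n 0 0 1) = 0"
      unfolding xi_z_def xi_zbar_def xi_nu_def blow_dw_def blow_dlnE_def half unfolding double by algebra
    then show "xi_z \<kappa> z n * (?E * blow_dw \<kappa> z n 1 0 0) + xi_zbar \<kappa> z n * (?E * blow_dw \<kappa> z n 0 1 0) +
      xi_nu \<kappa> z n * (cnj n * 0 - n * (?E * blow_dw \<kappa> z n 0 0 1)) =
      fst (w_coeff \<kappa> (z, n)) * 0 + snd (w_coeff \<kappa> (z, n)) * 0" by algebra
  next
    have "2 * (cnj (xi_z \<kappa> z n) * blow_dw \<kappa> z n 0 1 0 + cnj (xi_zbar \<kappa> z n) * blow_dw \<kappa> z n 1 0 0 +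
      cnj (xi_nu \<kappa> z n) * n * blow_dw \<kappa> z n 0 0 1) =
      2 * ((2 + 2 * of_real \<kappa> * cnj z * (z - cnj z * n\<^sup>2)) * (1 - (n * cnj n)\<^sup>2))"
      unfolding xi_z_def xi_zbar_def xi_nu_def blow_dw_def blow_dlnE_def half unfolding double
      by (simp only: cnjs) algebra
    then show "cnj (xi_z \<kappa> z n) * (?E * blow_dw \<kappa> z n 0 1 0) + cnj (xi_zbar \<kappa> z n) * (?E * blow_dw \<kappa> z n 1 0 0) +
      cnj (xi_nu \<kappa> z n) * (n * (?E * blow_dw \<kappa> z n 0 0 1) - cnj n * 0) =
      fst (w_coeff \<kappa> (z, n)) * of_real (1 - norm n ^ 4) + snd (w_coeff \<kappa> (z, n)) * 0"
      unfolding of_real_diff of_real_1 norm_power4 w_coeff_def case_prod_conv fst_conv by algebra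
  qed simp
  then show "?f a = ?f' a" by (rule fun_cong)
  have "?g = ?g'"
  proof (rule coframe_unique[OF lin(2) lin' l n]; unfold cext_Xi[OF lin(2)] ce \<eta> g norm_power4)
    show "?E * blow_dxi \<kappa> z n 0 0 1 = fst (xi_coeff \<kappa> (z, n)) * 0 + snd (xi_coeff \<kappa> (z, n)) * 1"
      by (simp add: xi_coeff_def blow_dxi_def blow_dlnE_def field_simps power2_eq_square)
  next
    have "2 * (xi_z \<kappa> z n * blow_dxi \<kappa> z n 1 0 0 + xi_zbar \<kappa> z n * blow_dxi \<kappa> z n 0 1 0 -
      xi_nu \<kappa> z n * n * blow_dxi \<kappa> z n 0 0 1) = 0"
      unfolding xi_z_def xi_zbar_def xi_nu_def blow_dxi_def blow_dlnE_def half unfolding double by algebra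
    then show "xi_z \<kappa> z n * (?E * blow_dxi \<kappa> z n 1 0 0) + xi_zbar \<kappa> z n * (?E * blow_dxi \<kappa> z n 0 1 0) +
      xi_nu \<kappa> z n * (cnj n * 0 - n * (?E * blow_dxi \<kappa> z n 0 0 1)) =
      fst (xi_coeff \<kappa> (z, n)) * 0 + snd (xi_coeff \<kappa> (z, n)) * 0" by algebra
  next
    have "2 * (cnj (xi_z \<kappa> z n) * blow_dxi \<kappa> z n 0 1 0 + cnj (xi_zbar \<kappa> z n) * blow_dxi \<kappa> z n 1 0 0 +
      cnj (xi_nu \<kappa> z n) * n * blow_dxi \<kappa> z n 0 0 1) = 2 * ((2 * of_real \<kappa> * cnj z * n) * (1 - (n * cnj n)\<^sup>2))"
      unfolding xi_z_def xi_zbar_def xi_nu_def blow_dxi_def blow_dlnE_def half unfolding double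
      by (simp only: cnjs) algebra
    then show "cnj (xi_z \<kappa> z n) * (?E * blow_dxi \<kappa> z n 0 1 0) + cnj (xi_zbar \<kappa> z n) * (?E * blow_dxi \<kappa> z n 1 0 0) +
      cnj (xi_nu \<kappa> z n) * (n * (?E * blow_dxi \<kappa> z n 0 0 1) - cnj n * 0) =
      fst (xi_coeff \<kappa> (z, n)) * of_real (1 - norm n ^ 4) + snd (xi_coeff \<kappa> (z, n)) * 0"
      unfolding of_real_diff of_real_1 norm_power4 xi_coeff_def case_prod_conv fst_conv by algebra
  qed simp
  then show "?g a = ?g' a" by (rule fun_cong)
qed

text \<open>The right-hand side is continuous, homogeneous of degree two in \<open>(x, y)\<close>,
  and positive off the origin because the determinant is nonzero. Its minimum over the compact
  product of \<open>Z\<close> and the unit sphere is the constant; the product includes |\<nu>| = 1,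
  where the coframe breaks down.\<close>

lemma gram_coercive:
  assumes \<kappa>: "R > 0" "\<kappa> > - 1 / R\<^sup>2"
  obtains c :: real where "c > 0"
    and "\<And>p x y. p \<in> Z_space R \<Longrightarrow> c * ((norm x)\<^sup>2 + (norm y)\<^sup>2) \<le>
      (norm (fst (w_coeff \<kappa> p) * x + snd (w_coeff \<kappa> p) * y))\<^sup>2 +
      (norm (fst (xi_coeff \<kappa> p) * x + snd (xi_coeff \<kappa> p) * y))\<^sup>2"
proof -
  define G where "G = (\<lambda>(p, v). (norm (fst (w_coeff \<kappa> p) * fst v + snd (w_coeff \<kappa> p) * snd v))\<^sup>2 +
      (norm (fst (xi_coeff \<kappa> p) * fst v + snd (xi_coeff \<kappa> p) * snd v))\<^sup>2)"
  let ?K = "Z_space R \<times> sphere (0 :: complex \<times> complex) 1"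
  have cE: "continuous_on UNIV (\<lambda>p. blow_E \<kappa> (fst p) (snd p))"
    by (rule Ck_on_imp_continuous[OF Ck_on_blow_E[OF open_UNIV]])
  have w: "continuous_on UNIV (w_coeff \<kappa>)" and xi: "continuous_on UNIV (xi_coeff \<kappa>)"
    unfolding w_coeff_def xi_coeff_def case_prod_unfold by (intro continuous_intros cE)+
  have cG: "continuous_on ?K G"
    unfolding G_def case_prod_unfold
    by (intro continuous_intros continuous_on_compose2[OF w] continuous_on_compose2[OF xi]) auto
  have "compact ?K" unfolding Z_space_def by (intro compact_Times compact_cball compact_sphere)
  moreover have "((0, 0), (1, 0)) \<in> ?K" using \<kappa> by (simp add: Z_space_def)
  then have "?K \<noteq> {}" by blast
  ultimately obtain q where q: "q \<in> ?K" "\<And>y. y \<in> ?K \<Longrightarrow> G q \<le> G y"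
    using continuous_attains_inf[OF _ _ cG] by blast
  have pos: "G q > 0"
  proof -
    obtain z n x y where qe: "q = ((z, n), (x, y))" by (metis surj_pair)
    have l: "ell \<kappa> z > 0" using q(1) ell_pos[OF \<kappa>] by (auto simp: qe Z_space_def)
    define a b c d where "a = fst (w_coeff \<kappa> (z, n))" and "b = snd (w_coeff \<kappa> (z, n))"
      and "c = fst (xi_coeff \<kappa> (z, n))" and "d = snd (xi_coeff \<kappa> (z, n))"
    have det: "a * d - b * c \<noteq> 0" using l blow_coeff_det[of \<kappa> z n] by (simp add: a_def b_def c_def d_def)
    have "a * x + b * y \<noteq> 0 \<or> c * x + d * y \<noteq> 0"
    proof (rule ccontr)
      assume "\<not> (a * x + b * y \<noteq> 0 \<or> c * x + d * y \<noteq> 0)"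
      then have "(a * d - b * c) * x = 0" "(a * d - b * c) * y = 0" by algebra+
      then show False using det q(1) by (auto simp: qe)
    qed
    then have "G q \<noteq> 0" by (auto simp: G_def qe a_def b_def c_def d_def add_nonneg_eq_0_iff)
    moreover have "G q \<ge> 0" by (simp add: G_def qe)
    ultimately show ?thesis by simp
  qed
  show ?thesis
  proof (rule that[OF pos])
    fix p and x y :: complex assume p: "p \<in> Z_space R"
    show "G q * ((norm x)\<^sup>2 + (norm y)\<^sup>2) \<le> (norm (fst (w_coeff \<kappa> p) * x + snd (w_coeff \<kappa> p) * y))\<^sup>2 +
      (norm (fst (xi_coeff \<kappa> p) * x + snd (xi_coeff \<kappa> p) * y))\<^sup>2"
    proof (cases "(x, y) = 0")
      case False
      define t where "t = norm (x, y)"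
      have t: "t > 0" "t\<^sup>2 = (norm x)\<^sup>2 + (norm y)\<^sup>2" using False by (simp add: t_def) (simp add: t_def norm_prod_def)
      have "(p, sgn (x, y)) \<in> ?K" using p False by (simp add: norm_sgn)
      then have "G q \<le> G (p, sgn (x, y))" by (rule q(2))
      moreover have "sgn (x, y) = (x / of_real t, y / of_real t)"
        by (simp add: sgn_div_norm t_def scaleR_conv_of_real divide_inverse mult.commute)
      ultimately have "G q \<le> (norm ((fst (w_coeff \<kappa> p) * x + snd (w_coeff \<kappa> p) * y) / of_real t))\<^sup>2 +
        (norm ((fst (xi_coeff \<kappa> p) * x + snd (xi_coeff \<kappa> p) * y) / of_real t))\<^sup>2"
        by (simp add: G_def add_divide_distrib)
      also have "\<dots> = ((norm (fst (w_coeff \<kappa> p) * x + snd (w_coeff \<kappa> p) * y))\<^sup>2 +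
        (norm (fst (xi_coeff \<kappa> p) * x + snd (xi_coeff \<kappa> p) * y))\<^sup>2) / t\<^sup>2"
        using t(1) by (simp add: norm_divide power_divide) (simp add: add_divide_distrib)
      finally have "G q * t\<^sup>2 \<le> (norm (fst (w_coeff \<kappa> p) * x + snd (w_coeff \<kappa> p) * y))\<^sup>2 +
        (norm (fst (xi_coeff \<kappa> p) * x + snd (xi_coeff \<kappa> p) * y))\<^sup>2"
        using t(1) by (simp add: pos_le_divide_eq)
      then show ?thesis unfolding t(2) .
    qed (simp add: zero_prod_def)
  qed
qed

lemma coercive_pullback_blow:
  assumes \<kappa>: "R > 0" "\<kappa> > - 1 / R\<^sup>2"
  shows "coercive_pullback \<kappa> R (blow \<kappa>)"
proof -
  define C where "C = (\<lambda>v :: complex \<times> complex. \<lambda>j :: 2. if j = 1 then fst v else snd v)"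
  \<comment> \<open>Each of \<open>dw\<close> and \<open>d\<xi>\<close> contributes the rank-one
    matrix of its coefficient vector, matching the two summands of the standard form.\<close>
  define H :: "complex \<times> complex \<Rightarrow> complex^2^2" where
    "H p = (\<chi> j k. C (w_coeff \<kappa> p) j * cnj (C (w_coeff \<kappa> p) k) + C (xi_coeff \<kappa> p) j * cnj (C (xi_coeff \<kappa> p) k))" for p
  have C: "C v 1 = fst v" "C v 2 = snd v" for v by (simp_all add: C_def)
  have herm: "hermitian (H p)" for p by (simp add: hermitian_def H_def mult.commute)
  obtain c where c: "c > 0" "\<And>p x y. p \<in> Z_space R \<Longrightarrow> c * ((norm x)\<^sup>2 + (norm y)\<^sup>2) \<le>
      (norm (fst (w_coeff \<kappa> p) * x + snd (w_coeff \<kappa> p) * y))\<^sup>2 +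
      (norm (fst (xi_coeff \<kappa> p) * x + snd (xi_coeff \<kappa> p) * y))\<^sup>2"
    using gram_coercive[OF \<kappa>] by blast
  show ?thesis
    unfolding coercive_pullback_def
  proof (intro exI[of _ H] conjI ballI exI[of _ c] c(1))
    fix p assume p: "p \<in> Z_space R - SM_coords R"
    show "hermitian (H p)" by (rule herm)
    obtain z n where zn: "p = (z, n)" by (metis surj_pair)
    have n: "norm n < 1" and l: "ell \<kappa> z > 0"
      using p ell_pos[OF \<kappa>] by (auto simp: zn Z_space_def SM_coords_def)
    show "\<exists>B. (blow \<kappa> has_derivative B) (at p within Z_space R) \<and>
           (\<forall>a b. Omega_C2 (B a) (B b) =
              \<i> * (\<Sum>j\<in>UNIV. \<Sum>k\<in>UNIV.
                     H p $ j $ k * wedge (eta_form \<kappa> p j) (cnj \<circ> eta_form \<kappa> p k) a b))"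
    proof (intro exI[of _ "blow_deriv \<kappa> z n"] conjI allI)
      show "(blow \<kappa> has_derivative blow_deriv \<kappa> z n) (at p within Z_space R)"
        unfolding zn by (rule has_derivative_at_withinI[OF blow_has_derivative])
      fix a b
      show "Omega_C2 (blow_deriv \<kappa> z n a) (blow_deriv \<kappa> z n b) =
              \<i> * (\<Sum>j\<in>UNIV. \<Sum>k\<in>UNIV.
                     H p $ j $ k * wedge (eta_form \<kappa> p j) (cnj \<circ> eta_form \<kappa> p k) a b)"
        unfolding Omega_C2_def wedge_def zn blow_deriv_coframe[OF l n] o_def sum_2 H_def vec_lambda_beta C
        by (simp add: algebra_simps)
    qed
  next
    fix p assume "p \<in> Z_space R - SM_coords R"
    then have p: "p \<in> Z_space R" by simp
    show "pos_semidef (H p - mat (of_real c))"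
      unfolding pos_semidef_def
    proof (intro conjI allI)
      have "cnj (H p $ j $ k) = H p $ k $ j" for j k using herm[of p] by (metis hermitian_def)
      then show "hermitian (H p - mat (of_real c))" by (simp add: hermitian_def mat_def)
      fix a :: "complex^2"
      \<comment> \<open>\<open>pos_semidef\<close> pairs index \<open>j\<close> with
        \<open>cnj (a $ j)\<close>, and the factor of \<open>H\<close> at \<open>j\<close> is
        unconjugated, so the form is the sum of squares at the conjugated vector.\<close>
      define x y where "x = cnj (a $ 1)" and "y = cnj (a $ 2)"
      have a: "a $ 1 = cnj x" "a $ 2 = cnj y" by (simp_all add: x_def y_def)
      have "(\<Sum>j\<in>UNIV. \<Sum>k\<in>UNIV. (H p - mat (of_real c)) $ j $ k * a $ k * cnj (a $ j)) =
        (fst (w_coeff \<kappa> p) * x + snd (w_coeff \<kappa> p) * y) * cnj (fst (w_coeff \<kappa> p) * x + snd (w_coeff \<kappa> p) * y) +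
        (fst (xi_coeff \<kappa> p) * x + snd (xi_coeff \<kappa> p) * y) * cnj (fst (xi_coeff \<kappa> p) * x + snd (xi_coeff \<kappa> p) * y)
        - of_real c * (x * cnj x + y * cnj y)"
        unfolding sum_2 by (simp add: H_def C mat_def a algebra_simps)
      also have "\<dots> = of_real ((norm (fst (w_coeff \<kappa> p) * x + snd (w_coeff \<kappa> p) * y))\<^sup>2 +
        (norm (fst (xi_coeff \<kappa> p) * x + snd (xi_coeff \<kappa> p) * y))\<^sup>2 - c * ((norm x)\<^sup>2 + (norm y)\<^sup>2))"
        by (simp only: complex_norm_square of_real_add of_real_diff of_real_mult)
      finally show "0 \<le> Re (\<Sum>j\<in>UNIV. \<Sum>k\<in>UNIV. (H p - mat (of_real c)) $ j $ k * a $ k * cnj (a $ j))"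
        using c(2)[OF p, of x y] by simp
    qed
  qed
qed

section \<open>Geodesics and the scattering relation\<close>

text \<open>
  On the boundary torus, \<open>z = R cis x \<nu>\<close> where \<open>R sin x\<close> is the angular momentum of the geodesic; the
  phase of \<open>\<nu>\<close> is shifted such that \<open>t\<close> is another conserved quantity.  The scattering relation
  is then the fold \<open>x \<mapsto> pi - x\<close>.
\<close>

definition bd :: "real \<Rightarrow> real \<Rightarrow> real \<times> real \<Rightarrow> complex \<times> complex" where
  "bd \<kappa> R = (\<lambda>(x, t). (R * cis x * cis (t - \<kappa> * R\<^sup>2 * sin x * cos x), cis (t - \<kappa> * R\<^sup>2 * sin x * cos x)))"

lemma bd_in_bdry: "R > 0 \<Longrightarrow> bd \<kappa> R s \<in> bdry_SM R"
  by (cases s) (simp add: bd_def bdry_SM_def norm_mult)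

lemma bdry_cases:
  assumes "R > 0" "p \<in> bdry_SM R"
  obtains x t where "p = bd \<kappa> R (x, t)"
proof -
  obtain z n where p: "p = (z, n)" "norm z = R" "norm n = 1" using assms by (cases p) (auto simp: bdry_SM_def)
  have n0: "n \<noteq> 0" using p by auto
  define x where "x = Arg (z / n)"
  define y where "y = Arg n"
  have n: "n = cis y" using n0 p(3) by (simp add: y_def cis_Arg sgn_div_norm)
  have "z / n \<noteq> 0" using p assms(1) n0 by auto
  then have "cis x = z / n / of_real R" using cis_Arg[of "z / n"] p by (simp add: x_def sgn_eq norm_divide)
  then have "z = R * cis x * n" using n0 assms(1) by simp
  then have "p = bd \<kappa> R (x, y + \<kappa> * R\<^sup>2 * sin x * cos x)" by (simp add: bd_def p(1) n)
  then show ?thesis by (rule that)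
qed

lemma bd_cong:
  assumes "cis x = cis x'" "cis t = cis t'"
  shows "bd \<kappa> R (x, t) = bd \<kappa> R (x', t')"
proof -
  have "sin x = sin x'" "cos x = cos x'" using assms(1) by (simp_all add: complex_eq_iff)
  moreover have "cis (t - a) = cis (t' - a)" for a
    using assms(2) by (simp add: cis_divide[symmetric])
  ultimately show ?thesis using assms(1) by (simp add: bd_def)
qed

section \<open>Influx and outflux on the boundary torus\<close>

lemma metric_inward_normal:
  assumes "R > 0" "norm z = R" "ell \<kappa> z > 0"
  shows "metric_g \<kappa> z v (inward_normal \<kappa> z) = - (z \<bullet> flat \<kappa> z v) / R"
proof -
  define c where "c = - 1 / (R * ell \<kappa> z)"
  have i: "inward_normal \<kappa> z = c *\<^sub>R z"
    using assms(1,2) by (simp add: c_def inward_normal_def sgn_div_norm ell_def scaleR_conv_of_real divide_inverse mult_ac)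
  have "flat \<kappa> z (c *\<^sub>R z) = (c * ell \<kappa> z) *\<^sub>R z"
    by (simp add: flat_def ell_def power2_norm_eq_inner algebra_simps)
  moreover have "c * ell \<kappa> z = - 1 / R" using assms(3) by (simp add: c_def)
  ultimately have "flat \<kappa> z (inward_normal \<kappa> z) = (- 1 / R) *\<^sub>R z" unfolding i by simp
  then show ?thesis by (simp add: metric_flat inner_commute)
qed

lemma flux_iff:
  assumes "R > 0" "\<kappa> > - 1 / R\<^sup>2" and p: "(z, n) \<in> bdry_SM R"
  shows "(z, n) \<in> influx \<kappa> R \<longleftrightarrow> z \<bullet> n \<le> 0" and "(z, n) \<in> outflux \<kappa> R \<longleftrightarrow> z \<bullet> n \<ge> 0"
proof -
  have z: "norm z = R" using p by (simp add: bdry_SM_def)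
  have l: "ell \<kappa> z > 0" using ell_pos[OF assms(1,2)] z by simp
  have "metric_g \<kappa> z (unflat \<kappa> z n) (inward_normal \<kappa> z) = - (z \<bullet> n) / R"
    using metric_inward_normal[OF assms(1) z l] l by (simp add: flat_unflat)
  then show "(z, n) \<in> influx \<kappa> R \<longleftrightarrow> z \<bullet> n \<le> 0" "(z, n) \<in> outflux \<kappa> R \<longleftrightarrow> z \<bullet> n \<ge> 0"
    using p assms(1) by (auto simp: influx_def outflux_def chart_unflat[OF l] zero_le_divide_iff divide_le_0_iff)
qed

lemma bd_momentum:
  "fst (bd \<kappa> R (x, t)) * cnj (snd (bd \<kappa> R (x, t))) = R * cis x"
  "fst (bd \<kappa> R (x, t)) \<bullet> snd (bd \<kappa> R (x, t)) = R * cos x"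
proof -
  have "cis a * cnj (cis a) = 1" for a using complex_norm_square[of "cis a"] by simp
  then show *: "fst (bd \<kappa> R (x, t)) * cnj (snd (bd \<kappa> R (x, t))) = R * cis x"
    by (simp add: bd_def mult.assoc del: cis_cnj)
  have inn: "z \<bullet> n = Re (z * cnj n)" for z n by (simp add: inner_complex_def)
  show "fst (bd \<kappa> R (x, t)) \<bullet> snd (bd \<kappa> R (x, t)) = R * cos x" unfolding inn * by simp
qed

lemma bd_flux:
  assumes "R > 0" "\<kappa> > - 1 / R\<^sup>2"
  shows "bd \<kappa> R (x, t) \<in> influx \<kappa> R \<longleftrightarrow> cos x \<le> 0" and "bd \<kappa> R (x, t) \<in> outflux \<kappa> R \<longleftrightarrow> cos x \<ge> 0"
proof -
  obtain z n where zn: "bd \<kappa> R (x, t) = (z, n)" by (metis surj_pair)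
  have "z \<bullet> n = R * cos x" using bd_momentum(2)[of \<kappa> R x t] by (simp add: zn)
  then show "bd \<kappa> R (x, t) \<in> influx \<kappa> R \<longleftrightarrow> cos x \<le> 0" "bd \<kappa> R (x, t) \<in> outflux \<kappa> R \<longleftrightarrow> cos x \<ge> 0"
    using flux_iff[OF assms, of z n] bd_in_bdry[OF assms(1), of \<kappa> "(x, t)"] assms(1)
    by (auto simp: zn mult_le_0_iff zero_le_mult_iff)
qed

text \<open>The second component is the flat velocity with the rotation accumulated along the
  geodesic undone; at the boundary point with parameters \<open>(x, t)\<close> it is
  \<open>cis t\<close>.\<close>

definition conserved :: "real \<Rightarrow> complex \<times> complex \<Rightarrow> real \<times> complex" where
  "conserved \<kappa> = (\<lambda>(x, v). let P = x * cnj (flat \<kappa> x v)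
     in (Im P, flat \<kappa> x v * exp (\<i> * of_real (\<kappa> * Re P * Im P))))"

text \<open>\<open>P\<close> has the real derivative \<open>1 / ell\<close>, so \<open>Im P\<close>
  is constant. The phase of the exponential then grows at the rate
  \<open>\<kappa> * Im P / ell\<close>, opposite to the rotation of the flat velocity.\<close>

lemma conserved_geodesic:
  assumes \<kappa>: "R > 0" "\<kappa> > - 1 / R\<^sup>2" and geo: "geodesic_from_to \<kappa> R q q'"
  shows "conserved \<kappa> q = conserved \<kappa> q'"
proof -
  obtain T c where T: "T \<ge> 0" "c 0 = q" "c T = q'"
    and c: "\<And>t. t \<in> {0..T} \<Longrightarrow> c t \<in> unit_tangent \<kappa> R"
      "\<And>t. t \<in> {0..T} \<Longrightarrow> (c has_vector_derivative geodesic_field \<kappa> (c t)) (at t within {0..T})"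
    using geo unfolding geodesic_from_to_def by blast
  define X N P where "X = (\<lambda>t. fst (c t))" and "N = (\<lambda>t. flat \<kappa> (fst (c t)) (snd (c t)))"
    and "P = (\<lambda>t. fst (c t) * cnj (flat \<kappa> (fst (c t)) (snd (c t))))"
  have "((\<lambda>t. conserved \<kappa> (c t)) has_vector_derivative 0) (at t within {0..T})" if t: "t \<in> {0..T}" for t
  proof -
    obtain x v where xv: "c t = (x, v)" by (metis surj_pair)
    define n where "n = flat \<kappa> x v"
    have x: "norm x \<le> R" and n1: "norm n = 1"
      using c(1)[OF t] by (auto simp: xv unit_tangent_def metric_flat_norm n_def abs_square_eq_1)
    have l: "ell \<kappa> x > 0" by (rule ell_pos[OF \<kappa> x])
    have nn: "n * cnj n = 1" using complex_norm_square[of n] n1 by simp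
    define p q where "p = Re (x * cnj n)" and "q = Im (x * cnj n)"
    have Pt: "P t = x * cnj n" by (simp add: P_def xv n_def)
    have pq: "x * cnj n = of_real p + \<i> * of_real q" by (simp add: complex_eq_iff p_def q_def)
    have xn: "x \<bullet> n = p" by (simp add: p_def inner_complex_def)
    have c': "(c has_derivative (\<lambda>h. h *\<^sub>R geodesic_field \<kappa> (x, v))) (at t within {0..T})"
      using c(2)[OF t] by (simp add: has_vector_derivative_def xv)
    have X': "(X has_vector_derivative v) (at t within {0..T})"
      using has_derivative_fst[OF c'] unfolding X_def has_vector_derivative_def by (simp add: geodesic_field_def)
    have "((\<lambda>(x, v). flat \<kappa> x v) has_derivative flat_deriv \<kappa> x v) (at (c t))"
      using flat_has_derivative[where \<kappa> = \<kappa> and x = x and v = v] unfolding xv flat_deriv_def .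
    from has_derivative_compose[OF c' this]
    have "(N has_vector_derivative flat_deriv \<kappa> x v (geodesic_field \<kappa> (x, v))) (at t within {0..T})"
      unfolding N_def has_vector_derivative_def
      by (simp add: case_prod_unfold linear_cmul[OF linear_flat_deriv])
    then have N': "(N has_vector_derivative - (\<i> * of_real (\<kappa> * q / ell \<kappa> x) * n)) (at t within {0..T})"
      unfolding flat_deriv_geodesic_field[OF l] n_def[symmetric] q_def[symmetric]
      by (simp add: scaleR_conv_of_real mult_ac)
    have Nt: "N t = n" "X t = x" by (simp_all add: N_def X_def xv n_def)
    have "((\<lambda>t. X t * cnj (N t)) has_vector_derivative
        X t * cnj (- (\<i> * of_real (\<kappa> * q / ell \<kappa> x) * n)) + v * cnj (N t)) (at t within {0..T})"
      by (rule has_vector_derivative_mult[OF X' has_vector_derivative_cnj[OF N']])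
    moreover have "X t * cnj (- (\<i> * of_real (\<kappa> * q / ell \<kappa> x) * n)) + v * cnj (N t) = of_real (1 / ell \<kappa> x)"
    proof -
      have "v = unflat \<kappa> x n" using l by (simp add: n_def unflat_flat)
      then have v: "v = n - of_real (\<kappa> * p / ell \<kappa> x) * x" by (simp add: unflat_def xn scaleR_conv_of_real)
      \<comment> \<open>As |n| = 1, \<open>p^2 + q^2\<close> is |x|^2. The derivative of
        \<open>P\<close> thereby becomes \<open>1 - \<kappa> * |x|^2 / ell\<close>, which is
        \<open>1 / ell\<close>.\<close>
      have pq2: "(of_real p + \<i> * of_real q) * (of_real p - \<i> * of_real q) = x * cnj x"
      proof -
        have "(of_real p + \<i> * of_real q) * (of_real p - \<i> * of_real q) = (x * cnj n) * cnj (x * cnj n)"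
          unfolding pq by simp
        then show ?thesis using nn by (simp add: mult_ac)
      qed
      have "X t * cnj (- (\<i> * of_real (\<kappa> * q / ell \<kappa> x) * n)) + v * cnj (N t) =
          n * cnj n - of_real (\<kappa> / ell \<kappa> x) * ((of_real p - \<i> * of_real q) * (x * cnj n))"
        unfolding v Nt by (simp add: algebra_simps)
      also have "\<dots> = 1 - of_real (\<kappa> / ell \<kappa> x) * (x * cnj x)"
        unfolding nn pq using pq2 by (simp add: mult.commute)
      also have "of_real (\<kappa> / ell \<kappa> x) * (x * cnj x) = (of_real (ell \<kappa> x) - 1) / of_real (ell \<kappa> x)"
        unfolding ell_complex[of \<kappa> x] using ell_complex[of \<kappa> x] by simp
      also have "1 - \<dots> = of_real (1 / ell \<kappa> x)" using l by (simp add: diff_divide_distrib)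
      finally show ?thesis .
    qed
    ultimately have P': "(P has_vector_derivative of_real (1 / ell \<kappa> x)) (at t within {0..T})"
      by (simp add: P_def X_def N_def)
    have Re': "((\<lambda>t. Re (P t)) has_vector_derivative 1 / ell \<kappa> x) (at t within {0..T})"
      and Im': "((\<lambda>t. Im (P t)) has_vector_derivative 0) (at t within {0..T})"
      using bounded_linear.has_vector_derivative[OF bounded_linear_Re P']
        bounded_linear.has_vector_derivative[OF bounded_linear_Im P'] by simp_all
    have "((\<lambda>t. Re (P t) * Im (P t)) has_vector_derivative (Re (P t) * 0 + 1 / ell \<kappa> x * Im (P t))) (at t within {0..T})"
      by (rule has_vector_derivative_mult[OF Re' Im'])
    then have "((\<lambda>t. \<i> * of_real \<kappa> * of_real (Re (P t) * Im (P t))) has_vector_derivative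
        \<i> * of_real \<kappa> * of_real (q / ell \<kappa> x)) (at t within {0..T})"
      by (intro has_vector_derivative_mult_right has_vector_derivative_of_real)
        (simp add: Pt q_def has_real_derivative_iff_has_vector_derivative)
    then have "((\<lambda>t. exp (\<i> * of_real \<kappa> * of_real (Re (P t) * Im (P t)))) has_vector_derivative
        (\<i> * of_real \<kappa> * of_real (q / ell \<kappa> x)) * exp (\<i> * of_real \<kappa> * of_real (Re (P t) * Im (P t)))) (at t within {0..T})"
      by (rule field_vector_diff_chain_within[OF _ has_field_derivative_at_within[OF DERIV_exp], unfolded o_def])
    from has_vector_derivative_mult[OF N' this]
    have "((\<lambda>t. N t * exp (\<i> * of_real \<kappa> * of_real (Re (P t) * Im (P t)))) has_vector_derivative 0) (at t within {0..T})"
      by (simp add: Nt algebra_simps)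
    from has_vector_derivative_Pair[OF Im' this]
    show ?thesis
      by (simp add: conserved_def case_prod_unfold Let_def N_def P_def mult.assoc zero_prod_def)
  qed
  then obtain d where "\<And>t. t \<in> {0..T} \<Longrightarrow> conserved \<kappa> (c t) = d"
    using has_vector_derivative_zero_constant[of "{0..T}" "\<lambda>t. conserved \<kappa> (c t)"] by auto
  then show ?thesis using T by (metis atLeastAtMost_iff order_refl)
qed

lemma conserved_bd:
  assumes "R > 0" "\<kappa> > - 1 / R\<^sup>2"
  shows "conserved \<kappa> (chart \<kappa> (bd \<kappa> R (x, t))) = (R * sin x, cis t)"
proof -
  obtain z n where zn: "bd \<kappa> R (x, t) = (z, n)" by (metis surj_pair)
  have "norm z = R" using bd_in_bdry[OF assms(1), of \<kappa> "(x, t)"] by (simp add: zn bdry_SM_def)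
  then have l: "ell \<kappa> z > 0" using ell_pos[OF assms] by simp
  have P: "z * cnj n = R * cis x" using bd_momentum(1)[of \<kappa> R x t] by (simp add: zn)
  have "n * exp (\<i> * of_real (\<kappa> * (R * cos x) * (R * sin x))) = cis t"
    using zn unfolding cis_conv_exp[symmetric] bd_def
    by (auto simp: cis_mult power2_eq_square algebra_simps)
  moreover have fu: "flat \<kappa> z (unflat \<kappa> z n) = n" using l by (simp add: flat_unflat)
  have "conserved \<kappa> (z, unflat \<kappa> z n) =
      (Im (R * cis x), n * exp (\<i> * of_real (\<kappa> * Re (R * cis x) * Im (R * cis x))))"
    unfolding conserved_def case_prod_conv Let_def fu P ..
  ultimately show ?thesis
    using l by (simp add: zn chart_unflat)
qed

text \<open>The condition on \<kappa> is open in the radius. The larger disk gives room to invert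
  the time function on an open interval around the endpoints of a geodesic.\<close>

lemma slack_radius:
  fixes R \<kappa> :: real
  assumes "R > 0" "\<kappa> > - 1 / R\<^sup>2"
  obtains r where "r > R" "\<kappa> > - 1 / r\<^sup>2"
proof -
  have "((\<lambda>r. - 1 / r\<^sup>2) \<longlongrightarrow> - 1 / R\<^sup>2) (at_right R)"
    using assms(1) by (auto intro!: tendsto_eq_intros)
  then have "eventually (\<lambda>r. - 1 / r\<^sup>2 < \<kappa>) (at_right R)" using assms(2) by (rule order_tendstoD)
  then have "eventually (\<lambda>r. - 1 / r\<^sup>2 < \<kappa> \<and> r > R) (at_right R)"
    using eventually_at_right_less[of R] by eventually_elim simp
  then show ?thesis using that eventually_happens'[OF trivial_limit_at_right_real] by blast
qed

text \<open>The time along a geodesic as a function of \<open>p\<close> is \<open>p + \<kappa> (p\<^sup>3 / 3 + q\<^sup>2 p)\<close>.\<close>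

lemma radial_motion:
  fixes m q :: real
  assumes "R > 0" "\<kappa> > - 1 / R\<^sup>2" "m \<ge> 0" and mq: "m\<^sup>2 + q\<^sup>2 = R\<^sup>2"
  obtains T p where "T \<ge> 0" "p 0 = - m" "p T = m" "\<And>t. t \<in> {0..T} \<Longrightarrow> \<bar>p t\<bar> \<le> m"
    and "\<And>t. t \<in> {0..T} \<Longrightarrow> (p has_real_derivative 1 / (1 + \<kappa> * ((p t)\<^sup>2 + q\<^sup>2))) (at t within {0..T})"
proof -
  obtain r where r: "r > R" "\<kappa> > - 1 / r\<^sup>2" using slack_radius[OF assms(1,2)] .
  have r0: "r > 0" using r assms(1) by simp
  \<comment> \<open>Half the chord length at distance \<open>q\<close> in the larger disk. The open
    interval \<open>S\<close> thus contains \<open>[-m, m]\<close>, also in the tangential case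
    \<open>m = 0\<close>.\<close>
  define m' where "m' = sqrt (r\<^sup>2 - q\<^sup>2)"
  have "R\<^sup>2 < r\<^sup>2" using r assms(1) by (simp add: power_strict_mono)
  then have "m\<^sup>2 < r\<^sup>2 - q\<^sup>2" using mq by simp
  then have m': "m' > m" unfolding m'_def using assms(3) by (metis real_less_rsqrt)
  have "0 \<le> r\<^sup>2 - q\<^sup>2" using \<open>m\<^sup>2 < r\<^sup>2 - q\<^sup>2\<close> zero_le_power2[of m] by linarith
  then have m'2: "m'\<^sup>2 = r\<^sup>2 - q\<^sup>2" by (simp add: m'_def)
  define S where "S = {- m'<..<m'}"
  have pos: "1 + \<kappa> * (p\<^sup>2 + q\<^sup>2) > 0" if "p \<in> S" for p
  proof (rule one_add_pos[OF r0 r(2)])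
    have "\<bar>p\<bar> \<le> m'" using that by (auto simp: S_def)
    then have "p\<^sup>2 \<le> m'\<^sup>2" by (metis abs_ge_zero power2_abs power_mono)
    then show "p\<^sup>2 + q\<^sup>2 \<le> r\<^sup>2" using m'2 by simp
  qed simp
  define f where "f p = p + \<kappa> * (p ^ 3 / 3 + q\<^sup>2 * p)" for p
  have f': "(f has_real_derivative 1 + \<kappa> * (p\<^sup>2 + q\<^sup>2)) (at p)" for p
    unfolding f_def by (auto intro!: derivative_eq_intros simp: algebra_simps)
  have mono: "f a < f b" if "a < b" "a \<in> S" "b \<in> S" for a b
  proof (rule DERIV_pos_imp_increasing[OF that(1)])
    fix x assume "a \<le> x" "x \<le> b"
    then have "x \<in> S" using that by (auto simp: S_def)
    then show "\<exists>y. (f has_real_derivative y) (at x) \<and> y > 0" using f' pos by blast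
  qed
  have inj: "inj_on f S"
    by (rule inj_onI) (metis mono less_irrefl linorder_neqE_linordered_idom)
  have cont: "continuous_on A f" for A
    using f' by (meson DERIV_continuous_on DERIV_subset continuous_on_subset subset_UNIV)
  define g where "g = inv_into S f"
  have g: "g (f p) = p" if "p \<in> S" for p using inj that by (simp add: g_def inv_into_f_f)
  have mS: "{- m..m} \<subseteq> S" using m' assms(3) by (auto simp: S_def)
  define T where "T = f m - f (- m)"
  have mS': "- m \<in> S" "m \<in> S" using m' assms(3) by (auto simp: S_def)
  have T: "T \<ge> 0" using mono[of "- m" m] mS' assms(3) by (cases "m = 0") (auto simp: T_def)
  define p where "p = (\<lambda>t. g (t + f (- m)))"
  have ex: "\<exists>y\<in>{- m..m}. t + f (- m) = f y" if "t \<in> {0..T}" for t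
    using IVT'[of f "- m" "t + f (- m)" m] that assms(3) cont by (force simp: T_def)
  show ?thesis
  proof (rule that[OF T, of p])
    show "p 0 = - m" "p T = m" using g[OF mS'(1)] g[OF mS'(2)] by (simp_all add: p_def T_def)
    fix t assume t: "t \<in> {0..T}"
    obtain y where y: "y \<in> {- m..m}" "t + f (- m) = f y" using ex[OF t] by blast
    have yS: "y \<in> S" using y mS by auto
    have py: "p t = y" by (simp add: p_def y g yS)
    show "\<bar>p t\<bar> \<le> m" using y py by auto
    have ne: "1 + \<kappa> * (y\<^sup>2 + q\<^sup>2) \<noteq> 0" using pos[OF yS] by simp
    have "(g has_derivative (*) (1 / (1 + \<kappa> * (y\<^sup>2 + q\<^sup>2)))) (at (f y))"
    proof (rule has_derivative_inverse_strong[OF _ yS cont g])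
      show "open S" by (simp add: S_def)
      show "(f has_derivative (\<lambda>h. (1 + \<kappa> * (y\<^sup>2 + q\<^sup>2)) * h)) (at y)"
        using f'[of y] by (simp add: has_field_derivative_def)
      show "(\<lambda>h. (1 + \<kappa> * (y\<^sup>2 + q\<^sup>2)) * h) \<circ> (*) (1 / (1 + \<kappa> * (y\<^sup>2 + q\<^sup>2))) = id"
        using ne by (simp add: fun_eq_iff)
    qed
    then have "(g has_real_derivative 1 / (1 + \<kappa> * (y\<^sup>2 + q\<^sup>2))) (at (t + f (- m)))"
      unfolding y(2) has_field_derivative_def .
    then have "(p has_real_derivative 1 / (1 + \<kappa> * (y\<^sup>2 + q\<^sup>2))) (at t)"
      unfolding p_def DERIV_shift .
    then show "(p has_real_derivative 1 / (1 + \<kappa> * ((p t)\<^sup>2 + q\<^sup>2))) (at t within {0..T})"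
      unfolding py by (rule has_field_derivative_at_within)
  qed
qed

text \<open>The conserved quantities integrate the equation: for fixed \<open>q\<close> and
  \<open>t\<close> the flat velocity is \<open>N\<close> and the position
  \<open>(p + \<i> * q) * N\<close>. The radial coordinate \<open>p\<close> runs from
  \<open>R * cos x\<close> to \<open>- R * cos x\<close>, which replaces \<open>x\<close> by
  \<open>pi - x\<close>.\<close>

lemma geodesic_bd:
  assumes \<kappa>: "R > 0" "\<kappa> > - 1 / R\<^sup>2" and x: "cos x \<le> 0"
  shows "geodesic_from_to \<kappa> R (chart \<kappa> (bd \<kappa> R (x, t))) (chart \<kappa> (bd \<kappa> R (pi - x, t)))"
proof -
  define m q where "m = - R * cos x" and "q = R * sin x"
  have m: "m \<ge> 0" using x \<kappa>(1) by (simp add: m_def mult_nonneg_nonpos)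
  have mq: "m\<^sup>2 + q\<^sup>2 = R\<^sup>2"
    by (simp add: m_def q_def power_mult_distrib distrib_left[symmetric] add.commute)
  obtain T p where T: "T \<ge> 0" "p 0 = - m" "p T = m" and pm: "\<And>s. s \<in> {0..T} \<Longrightarrow> \<bar>p s\<bar> \<le> m"
    and p': "\<And>s. s \<in> {0..T} \<Longrightarrow> (p has_real_derivative 1 / (1 + \<kappa> * ((p s)\<^sup>2 + q\<^sup>2))) (at s within {0..T})"
    using radial_motion[OF \<kappa> m mq] by metis
  define N where "N = (\<lambda>s. exp (\<i> * of_real (t - \<kappa> * q * p s)))"
  define Z where "Z = (\<lambda>s. (of_real (p s) + \<i> * of_real q) * N s)"
  have N1: "norm (N s) = 1" for s by (simp add: N_def)
  have nZ: "(norm (Z s))\<^sup>2 = (p s)\<^sup>2 + q\<^sup>2" for s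
    by (simp add: Z_def norm_mult N1 cmod_power2)
  have Z: "norm (Z s) \<le> R" if "s \<in> {0..T}" for s
  proof -
    have "(p s)\<^sup>2 \<le> m\<^sup>2" using pm[OF that] by (metis abs_ge_zero power2_abs power_mono)
    then show ?thesis using nZ mq \<kappa>(1) by (metis add_le_cancel_right less_imp_le power2_le_imp_le)
  qed
  have start: "bd \<kappa> R (x, t) = (Z 0, N 0)" and stop: "bd \<kappa> R (pi - x, t) = (Z T, N T)"
    unfolding bd_def Z_def N_def T cis_conv_exp[symmetric]
    by (simp_all add: m_def q_def complex_eq_iff power2_eq_square algebra_simps)
  show ?thesis
    unfolding geodesic_from_to_def start stop
  proof (intro exI[of _ T] exI[of _ "\<lambda>s. chart \<kappa> (Z s, N s)"] conjI ballI T(1) refl)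
    fix s assume s: "s \<in> {0..T}"
    define l where "l = ell \<kappa> (Z s)"
    have l: "l > 0" "ell \<kappa> (Z s) > 0" using ell_pos[OF \<kappa> Z[OF s]] by (simp_all add: l_def)
    have leq: "l = 1 + \<kappa> * ((p s)\<^sup>2 + q\<^sup>2)" by (simp add: l_def ell_def nZ)
    define v where "v = unflat \<kappa> (Z s) (N s)"
    have fv: "flat \<kappa> (Z s) v = N s" using l by (simp add: v_def flat_unflat)
    have ch: "chart \<kappa> (Z s, N s) = (Z s, v)" using l(2) by (simp add: chart_unflat v_def)
    show "chart \<kappa> (Z s, N s) \<in> unit_tangent \<kappa> R"
      unfolding ch using Z[OF s] by (simp add: unit_tangent_def metric_flat_norm fv N1)
    have pd: "(p has_real_derivative 1 / l) (at s within {0..T})"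
      using p'[OF s] unfolding leq .
    have "((\<lambda>s. \<i> * of_real (t - \<kappa> * q * p s)) has_vector_derivative \<i> * of_real (0 - \<kappa> * q * (1 / l))) (at s within {0..T})"
      by (intro has_vector_derivative_mult_right has_vector_derivative_of_real DERIV_diff DERIV_const DERIV_cmult pd)
    from field_vector_diff_chain_within[OF this has_field_derivative_at_within[OF DERIV_exp]]
    have N': "(N has_vector_derivative - (\<i> * of_real (\<kappa> * q / l) * N s)) (at s within {0..T})"
      by (simp add: N_def o_def)
    have "((\<lambda>s. of_real (p s) + \<i> * of_real q) has_vector_derivative of_real (1 / l) + 0) (at s within {0..T})"
      by (intro has_vector_derivative_add has_vector_derivative_of_real has_vector_derivative_const pd)
    from has_vector_derivative_mult[OF this N']
    have "(Z has_vector_derivative (of_real (p s) + \<i> * of_real q) * (- (\<i> * of_real (\<kappa> * q / l) * N s))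
        + (of_real (1 / l) + 0) * N s) (at s within {0..T})"
      unfolding Z_def .
    moreover have "(of_real (p s) + \<i> * of_real q) * (- (\<i> * of_real (\<kappa> * q / l) * N s))
        + (of_real (1 / l) + 0) * N s = v"
    proof -
      have inn: "Z s \<bullet> N s = p s"
      proof -
        have "Z s \<bullet> N s = Re (Z s * cnj (N s))" by (simp add: inner_complex_def)
        also have "Z s * cnj (N s) = of_real (p s) + \<i> * of_real q"
          using complex_norm_square[of "N s"] N1[of s] by (simp add: Z_def mult.assoc)
        finally show ?thesis by simp
      qed
      have "v = N s - of_real (\<kappa> * p s / l) * Z s"
        by (simp add: v_def unflat_def inn l_def scaleR_conv_of_real)
      also have "\<dots> = (of_real l - of_real (\<kappa> * p s) * (of_real (p s) + \<i> * of_real q)) / of_real l * N s"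
        using l by (simp add: Z_def field_simps)
      also have "of_real l - of_real (\<kappa> * p s) * (of_real (p s) + \<i> * of_real q) =
          1 - \<i> * of_real (\<kappa> * q) * (of_real (p s) + \<i> * of_real q)"
        by (simp add: leq complex_eq_iff power2_eq_square algebra_simps)
      finally show ?thesis using l by (simp add: field_simps)
    qed
    ultimately have Z': "(Z has_vector_derivative v) (at s within {0..T})" by simp
    \<comment> \<open>The derivative of the chart inverts that of the flat coordinates, so it
      suffices to match the flat components of the velocity with those of the geodesic
      field.\<close>
    obtain D where D: "(chart \<kappa> has_derivative D) (at (Z s, N s))"
      and D2: "\<And>h. D (fst h, flat_deriv \<kappa> (Z s) v h) = h"
      using chart_has_derivative_inverse[OF l(2) v_def] by metis
    define k where "k = geodesic_field \<kappa> (Z s, v)"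
    have "Im (Z s * cnj (N s)) = q"
      using complex_norm_square[of "N s"] N1[of s] by (simp add: Z_def mult.assoc)
    then have "flat_deriv \<kappa> (Z s) v k = - (\<i> * of_real (\<kappa> * q / l) * N s)"
      unfolding k_def flat_deriv_geodesic_field[OF l(2)] fv by (simp add: l_def scaleR_conv_of_real mult_ac)
    moreover have "fst k = v" by (simp add: k_def geodesic_field_def)
    ultimately have Dk: "D (v, - (\<i> * of_real (\<kappa> * q / l) * N s)) = k" using D2[of k] by simp
    have "((\<lambda>s. (Z s, N s)) has_derivative (\<lambda>h. h *\<^sub>R (v, - (\<i> * of_real (\<kappa> * q / l) * N s)))) (at s within {0..T})"
      using has_vector_derivative_Pair[OF Z' N'] by (simp add: has_vector_derivative_def)
    from has_derivative_compose[OF this D]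
    have "((\<lambda>s. chart \<kappa> (Z s, N s)) has_vector_derivative k) (at s within {0..T})"
      unfolding has_vector_derivative_def linear_cmul[OF has_derivative_linear[OF D]] Dk .
    then show "((\<lambda>s. chart \<kappa> (Z s, N s)) has_vector_derivative geodesic_field \<kappa> (chart \<kappa> (Z s, N s))) (at s within {0..T})"
      unfolding ch k_def .
  qed
qed

text \<open>For uniqueness, the conserved quantities fix \<open>sin x\<close> and
  \<open>cis t\<close>; what remains is the sign of the cosine, decided by the exchange of influx
  and outflux.\<close>

lemma scattering_bd:
  assumes \<kappa>: "R > 0" "\<kappa> > - 1 / R\<^sup>2"
  shows "scattering \<kappa> R (bd \<kappa> R (x, t)) = bd \<kappa> R (pi - x, t)"
  unfolding scattering_def
proof (rule the_equality)
  let ?p = "bd \<kappa> R (x, t)" and ?q = "bd \<kappa> R (pi - x, t)"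
  show "?p \<in> influx \<kappa> R \<and> ?q \<in> outflux \<kappa> R \<and> geodesic_from_to \<kappa> R (chart \<kappa> ?p) (chart \<kappa> ?q) \<or>
     ?p \<in> outflux \<kappa> R \<and> ?q \<in> influx \<kappa> R \<and> geodesic_from_to \<kappa> R (chart \<kappa> ?q) (chart \<kappa> ?p)"
  proof (cases "cos x \<le> 0")
    case True
    then show ?thesis using geodesic_bd[OF \<kappa> True, of t] by (simp add: bd_flux[OF \<kappa>])
  next
    case False
    then show ?thesis using geodesic_bd[OF \<kappa>, of "pi - x" t] by (simp add: bd_flux[OF \<kappa>])
  qed
  fix q
  assume q: "?p \<in> influx \<kappa> R \<and> q \<in> outflux \<kappa> R \<and> geodesic_from_to \<kappa> R (chart \<kappa> ?p) (chart \<kappa> q) \<or>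
     ?p \<in> outflux \<kappa> R \<and> q \<in> influx \<kappa> R \<and> geodesic_from_to \<kappa> R (chart \<kappa> q) (chart \<kappa> ?p)"
  then have "q \<in> bdry_SM R" by (auto simp: influx_def outflux_def)
  then obtain x' t' where qe: "q = bd \<kappa> R (x', t')" using bdry_cases[OF \<kappa>(1)] by metis
  have "conserved \<kappa> (chart \<kappa> ?p) = conserved \<kappa> (chart \<kappa> q)"
    using q conserved_geodesic[OF \<kappa>] by metis
  then have *: "sin x' = sin x" "cis t' = cis t" using \<kappa>(1) by (simp_all add: qe conserved_bd[OF \<kappa>])
  have sgn: "cos x \<le> 0 \<and> cos x' \<ge> 0 \<or> cos x \<ge> 0 \<and> cos x' \<le> 0" using q by (auto simp: qe bd_flux[OF \<kappa>])
  have "(cos x')\<^sup>2 = (cos x)\<^sup>2" using *(1) by (simp add: cos_squared_eq)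
  then have "cos x' = cos x \<or> cos x' = - cos x" by (simp add: power2_eq_iff)
  then have "cos x' = - cos x" using sgn by auto
  then show "q = ?q" unfolding qe using * by (intro bd_cong) (simp_all add: complex_eq_iff)
qed

text \<open>The imaginary part of the exponent is \<open>\<kappa> * R^2 * sin x * cos x\<close>,
  exactly the phase shift built into \<open>bd\<close>. The two cancel, and the dependence on
  \<open>x\<close> is through \<open>sin x\<close> alone.\<close>

lemma blow_bd:
  "blow \<kappa> (bd \<kappa> R (x, t)) =
    (2 * \<i> * of_real (R * sin x * exp (\<kappa> * R\<^sup>2 * (sin x)\<^sup>2)) * cis t, of_real (exp (\<kappa> * R\<^sup>2 * (sin x)\<^sup>2)) * cis t)"
proof -
  obtain z n where zn: "bd \<kappa> R (x, t) = (z, n)" by (metis surj_pair)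
  have P: "z * cnj n = R * cis x" using bd_momentum(1)[of \<kappa> R x t] by (simp add: zn)
  have n: "n = cis (t - \<kappa> * R\<^sup>2 * sin x * cos x)" using zn by (simp add: bd_def)
  have nn: "n * cnj n = 1" using complex_norm_square[of n] by (simp add: n)
  have P': "cnj z * n = R * cnj (cis x)" using arg_cong[OF P, of cnj] by simp
  have w: "z - cnj z * n\<^sup>2 = 2 * \<i> * of_real (R * sin x) * n"
  proof -
    have "z - cnj z * n\<^sup>2 = (z * cnj n - cnj z * n) * n" using nn by algebra
    also have "z * cnj n - cnj z * n = 2 * \<i> * of_real (R * sin x)" unfolding P P' by (simp add: complex_eq_iff)
    finally show ?thesis .
  qed
  have e: "\<kappa> * (z * cnj z - (cnj z)\<^sup>2 * n\<^sup>2) / 2 = of_real (\<kappa> * R\<^sup>2 * (sin x)\<^sup>2) + \<i> * of_real (\<kappa> * R\<^sup>2 * sin x * cos x)"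
  proof -
    have "z * cnj z - (cnj z)\<^sup>2 * n\<^sup>2 = (cnj z * n) * (z * cnj n - cnj z * n)" using nn by algebra
    also have "\<dots> = R * cnj (cis x) * (2 * \<i> * of_real (R * sin x))"
      unfolding P P' by (simp add: complex_eq_iff)
    finally show ?thesis by (simp add: complex_eq_iff power2_eq_square)
  qed
  have "n * blow_E \<kappa> z n = of_real (exp (\<kappa> * R\<^sup>2 * (sin x)\<^sup>2)) * cis t"
    unfolding blow_E_def e unfolding exp_add n cis_conv_exp[symmetric] exp_of_real
    by (simp add: mult_ac cis_mult)
  then show ?thesis unfolding zn blow_def w case_prod_conv by (simp add: mult_ac)
qed

section \<open>Smooth functions on the quotient by the scattering relation\<close>

lemma Ck_on_bd: "Ck_on k (bd \<kappa> R) UNIV"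
proof -
  have "Ck_on k (\<lambda>s. fst s :: real) UNIV" "Ck_on k (\<lambda>s :: real \<times> real. snd s :: real) UNIV"
    by (intro Ck_on_fst Ck_on_snd Ck_on_id open_UNIV)+
  then show ?thesis
    unfolding bd_def case_prod_unfold cis_conv_exp
    by (intro Ck_on_Pair Ck_on_mult Ck_on_exp Ck_on_const Ck_on_of_real Ck_on_diff Ck_on_sin Ck_on_cos open_UNIV)
qed

lemma Ck_on_bd_pullback:
  assumes "smooth_on (bdry_SM R) f" "R > 0"
  shows "Ck_on k (\<lambda>s. f (bd \<kappa> R s)) UNIV"
proof (rule Ck_on_local)
  fix s :: "real \<times> real"
  obtain U F where U: "open U" "bd \<kappa> R s \<in> U" "\<And>k. Ck_on k F U" "\<And>x. x \<in> bdry_SM R \<inter> U \<Longrightarrow> F x = f x"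
    using assms(1) bd_in_bdry[OF assms(2), of \<kappa> s] unfolding smooth_on_def by metis
  have cont: "continuous_on UNIV (bd \<kappa> R)" by (rule Ck_on_imp_continuous[OF Ck_on_bd])
  let ?V = "bd \<kappa> R -` U"
  have V: "open ?V" using continuous_open_preimage[OF cont open_UNIV U(1)] by simp
  have "Ck_on k (\<lambda>s. F (bd \<kappa> R s)) ?V"
    by (rule Ck_on_compose[OF V U(1) _ Ck_on_subset[OF Ck_on_bd] U(3)]) auto
  then have "Ck_on k (\<lambda>s. f (bd \<kappa> R s)) ?V"
    by (rule Ck_on_cong[OF V, rotated]) (use U(4) bd_in_bdry[OF assms(2)] in auto)
  then show "\<exists>V. open V \<and> s \<in> V \<and> Ck_on k (\<lambda>s. f (bd \<kappa> R s)) V" using V U(2) by blast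
qed

text \<open>Near a given point, \<open>bd\<close> has a right inverse that extends smoothly to an
  open set of the ambient space: logarithms of \<open>z / \<nu>\<close> and \<nu> recover the
  angles. Composing \<open>G\<close> with it gives the required extension.\<close>

lemma smooth_on_bdryI:
  fixes G :: "real \<times> real \<Rightarrow> 'b::real_normed_vector"
  assumes R: "R > 0" and G: "\<And>k. Ck_on k G UNIV" and f: "\<And>s. f (bd \<kappa> R s) = G s"
  shows "smooth_on (bdry_SM R) f"
  unfolding smooth_on_def
proof
  fix p assume "p \<in> bdry_SM R"
  then obtain x0 t0 where p: "p = bd \<kappa> R (x0, t0)" using bdry_cases[OF R] by metis
  define y0 where "y0 = t0 - \<kappa> * R\<^sup>2 * sin x0 * cos x0"
  have p': "p = (R * cis x0 * cis y0, cis y0)" by (simp add: p bd_def y0_def)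
  \<comment> \<open>At \<open>p\<close> the values of \<open>a\<close> and \<open>b\<close> are the
    positive reals \<open>R\<close> and \<open>1\<close>, away from the branch cut of
    \<open>Ln\<close>.\<close>
  define a where "a = (\<lambda>q :: complex \<times> complex. fst q / snd q * cis (- x0))"
  define b where "b = (\<lambda>q :: complex \<times> complex. snd q * cis (- y0))"
  define U where "U = {q. snd q \<noteq> 0} \<inter> {q \<in> {q. snd q \<noteq> 0}. a q \<in> - \<real>\<^sub>\<le>\<^sub>0} \<inter> b -` (- \<real>\<^sub>\<le>\<^sub>0)"
  define X where "X = (\<lambda>q. x0 + Im (Ln (a q)))"
  define Y where "Y = (\<lambda>q. y0 + Im (Ln (b q)))"
  define L where "L = (\<lambda>q. (X q, Y q + \<kappa> * R\<^sup>2 * sin (X q) * cos (X q)))"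
  have o: "open {q :: complex \<times> complex. snd q \<noteq> 0}"
    by (intro open_Collect_neq continuous_intros)
  have "continuous_on {q. snd q \<noteq> 0} a" "continuous_on UNIV b"
    unfolding a_def b_def by (intro continuous_intros; simp)+
  then have U: "open U"
    unfolding U_def using o continuous_open_preimage[of "{q. snd q \<noteq> 0}" a "- \<real>\<^sub>\<le>\<^sub>0"]
      continuous_open_preimage[of UNIV b "- \<real>\<^sub>\<le>\<^sub>0"]
    by (intro open_Int) (auto simp: open_Compl vimage_def Collect_conj_eq)
  have Uprops: "snd q \<noteq> 0" "a q \<notin> \<real>\<^sub>\<le>\<^sub>0" "b q \<notin> \<real>\<^sub>\<le>\<^sub>0" if "q \<in> U" for q
    using that by (auto simp: U_def)
  have cc: "cis x * cis (- x) = 1" for x by (simp add: cis_mult)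
  have pU: "p \<in> U"
    using R cc[of x0] cc[of y0] by (simp add: U_def a_def b_def p' complex_nonpos_Reals_iff mult.assoc)
  have fs: "Ck_on k (\<lambda>q :: complex \<times> complex. fst q) U" "Ck_on k (\<lambda>q :: complex \<times> complex. snd q) U" for k
    by (intro Ck_on_fst Ck_on_snd Ck_on_id U)+
  have CX: "Ck_on k X U" for k
    unfolding X_def a_def
    by (intro Ck_on_add Ck_on_const Ck_on_Im Ck_on_Ln Ck_on_mult Ck_on_divide fs U)
      (use Uprops in \<open>auto simp: a_def\<close>)
  have CY: "Ck_on k Y U" for k
    unfolding Y_def b_def
    by (intro Ck_on_add Ck_on_const Ck_on_Im Ck_on_Ln Ck_on_mult fs U)
      (use Uprops in \<open>auto simp: b_def\<close>)
  have CL: "Ck_on k L U" for k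
    unfolding L_def by (intro Ck_on_Pair Ck_on_add Ck_on_mult Ck_on_const Ck_on_sin Ck_on_cos CX CY U)
  have "Ck_on k (\<lambda>q. G (L q)) U" for k
    by (rule Ck_on_compose[OF U open_UNIV _ CL G]) simp
  moreover have "G (L q) = f q" if q: "q \<in> bdry_SM R \<inter> U" for q
  proof -
    obtain z n where zn: "q = (z, n)" by (metis surj_pair)
    have norms: "norm z = R" "norm n = 1" using q by (auto simp: zn bdry_SM_def)
    have n0: "n \<noteq> 0" using norms by auto
    have cisIm: "cis (Im (Ln c)) = sgn c" if "c \<noteq> 0" for c
      using that by (simp add: cis_Arg[symmetric] Arg_eq_Im_Ln)
    have "b q \<noteq> 0" "a q \<noteq> 0" using Uprops[of q] q by auto
    then have cY: "cis (Y q) = cis y0 * sgn (b q)" and cX: "cis (X q) = cis x0 * sgn (a q)"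
      by (simp_all add: Y_def X_def cis_mult[symmetric] cisIm)
    have sb: "sgn (b q) = b q" using norms by (simp add: sgn_eq b_def zn norm_mult)
    have sa: "sgn (a q) = a q / R" using norms by (simp add: sgn_eq a_def zn norm_mult norm_divide)
    have "cis (Y q) = (cis y0 * cis (- y0)) * n" "cis (X q) = (cis x0 * cis (- x0)) * (z / n) / R"
      unfolding cY cX sa sb by (simp_all add: a_def b_def zn mult_ac)
    then have "cis (Y q) = n" "R * cis (X q) * cis (Y q) = z"
      unfolding cc using R n0 by simp_all
    then have "bd \<kappa> R (L q) = q" by (simp add: bd_def L_def zn)
    then show ?thesis using f[of "L q"] by simp
  qed
  ultimately show "\<exists>U F. open U \<and> p \<in> U \<and> (\<forall>k. Ck_on k F U) \<and> (\<forall>x\<in>bdry_SM R \<inter> U. F x = f x)"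
    using U pU by blast
qed

text \<open>Smooth functions on the quotient, pulled back to the parameter plane. Equality of
  \<open>sin\<close> encodes the period in \<open>x\<close> together with the fold, equality of
  \<open>cis\<close> the period in \<open>t\<close>.\<close>

definition fold_invariant :: "(real \<times> real \<Rightarrow> 'b::real_normed_vector) \<Rightarrow> bool" where
  "fold_invariant G \<longleftrightarrow> (\<forall>k. Ck_on k G UNIV) \<and>
     (\<forall>x x' t t'. sin x = sin x' \<longrightarrow> cis t = cis t' \<longrightarrow> G (x, t) = G (x', t'))"

lemma fold_invariantI:
  assumes "\<And>k. Ck_on k G UNIV" "\<And>x x' t t'. sin x = sin x' \<Longrightarrow> cis t = cis t' \<Longrightarrow> G (x, t) = G (x', t')"
  shows "fold_invariant G"
  using assms unfolding fold_invariant_def by blast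

lemma fold_invariantD:
  assumes "fold_invariant G"
  shows "Ck_on k G UNIV" "sin x = sin x' \<Longrightarrow> cis t = cis t' \<Longrightarrow> G (x, t) = G (x', t')"
  using assms unfolding fold_invariant_def by blast+

section \<open>Fold-invariant functions as smooth functions on the quotient\<close>

lemma cos_cases_of_sin_eq:
  assumes "sin x = sin (x' :: real)"
  shows "cis x' = cis x \<or> cis x' = cis (pi - x)"
proof -
  have "(cos x')\<^sup>2 = (cos x)\<^sup>2" using assms by (simp add: cos_squared_eq)
  then have "cos x' = cos x \<or> cos x' = - cos x" by (simp add: power2_eq_iff)
  then show ?thesis using assms by (auto simp: complex_eq_iff)
qed

lemma scattering_ext_bd:
  assumes \<kappa>: "R > 0" "\<kappa> > - 1 / R\<^sup>2"
  shows "scattering_ext \<kappa> R u (bd \<kappa> R (x, t)) = u (bd \<kappa> R (if cos x \<le> 0 then x else pi - x, t))"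
  by (simp add: scattering_ext_def bd_flux[OF \<kappa>] scattering_bd[OF \<kappa>])

lemma alpha_smooth_fold_invariant:
  assumes \<kappa>: "R > 0" "\<kappa> > - 1 / R\<^sup>2" and u: "alpha_smooth \<kappa> R u"
  shows "fold_invariant (\<lambda>s. scattering_ext \<kappa> R u (bd \<kappa> R s))"
proof (rule fold_invariantI)
  show "Ck_on k (\<lambda>s. scattering_ext \<kappa> R u (bd \<kappa> R s)) UNIV" for k
    using Ck_on_bd_pullback[OF u[unfolded alpha_smooth_def] \<kappa>(1)] .
  fix x x' t t' :: real assume x: "sin x = sin x'" and t: "cis t = cis t'"
  \<comment> \<open>The representative in the influx set. Its cosine is
    \<open>- \<bar>cos x\<bar>\<close>, so its position on the circle depends on
    \<open>sin x\<close> alone.\<close>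
  define y where "y x = (if cos x \<le> 0 then x else pi - x)" for x :: real
  have "cos (y x) = - \<bar>cos x\<bar>" "sin (y x) = sin x" for x by (auto simp: y_def)
  moreover have "\<bar>cos x\<bar> = \<bar>cos x'\<bar>" using x by (metis cos_squared_eq power2_abs abs_ge_zero power2_eq_iff_nonneg)
  ultimately have "cis (y x) = cis (y x')" using x by (simp add: complex_eq_iff)
  then show "scattering_ext \<kappa> R u (bd \<kappa> R (x, t)) = scattering_ext \<kappa> R u (bd \<kappa> R (x', t'))"
    unfolding scattering_ext_bd[OF \<kappa>] y_def[symmetric] using t by (metis bd_cong)
qed

text \<open>Inverse of the pullback along \<open>bd\<close>: invariance makes the choice of
  parameters immaterial on the torus, and off it the value is arbitrary.\<close>

definition lift_bd :: "real \<Rightarrow> real \<Rightarrow> (real \<times> real \<Rightarrow> 'b) \<Rightarrow> complex \<times> complex \<Rightarrow> 'b" where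
  "lift_bd \<kappa> R G p = G (SOME s. bd \<kappa> R s = p)"

lemma bd_eqD:
  assumes "R > 0" "bd \<kappa> R (x, t) = bd \<kappa> R (x', t')"
  shows "cis x = cis x'" "cis t = cis t'"
proof -
  have "of_real R * cis x = of_real R * cis x'" using assms(2) bd_momentum(1) by metis
  then show x: "cis x = cis x'" using assms(1) by simp
  then have "sin x = sin x'" "cos x = cos x'" by (simp_all add: complex_eq_iff)
  then have "cis (t - \<kappa> * R\<^sup>2 * sin x * cos x) = cis (t' - \<kappa> * R\<^sup>2 * sin x * cos x)"
    using assms(2) by (simp add: bd_def)
  then show "cis t = cis t'" by (simp add: cis_divide[symmetric])
qed

lemma lift_bd_bd:
  assumes "R > 0" "fold_invariant G"
  shows "lift_bd \<kappa> R G (bd \<kappa> R s) = G s"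
proof -
  obtain x t where s: "s = (x, t)" by (metis surj_pair)
  obtain x' t' where s': "(SOME s'. bd \<kappa> R s' = bd \<kappa> R s) = (x', t')" by (metis surj_pair)
  have "bd \<kappa> R (SOME s'. bd \<kappa> R s' = bd \<kappa> R s) = bd \<kappa> R s" by (rule someI[of _ s]) (rule refl)
  then have "bd \<kappa> R (x', t') = bd \<kappa> R (x, t)" unfolding s' unfolding s .
  from bd_eqD[OF assms(1) this] have "sin x' = sin x" "cis t' = cis t" by (simp_all add: complex_eq_iff)
  then show ?thesis
    unfolding lift_bd_def s' unfolding s by (rule fold_invariantD(2)[OF assms(2)])
qed

lemma alpha_smooth_lift_bd:
  assumes \<kappa>: "R > 0" "\<kappa> > - 1 / R\<^sup>2" and G: "fold_invariant G"
  shows "alpha_smooth \<kappa> R (lift_bd \<kappa> R G)"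
  unfolding alpha_smooth_def
proof (rule smooth_on_bdryI[OF \<kappa>(1) fold_invariantD(1)[OF G]])
  fix s :: "real \<times> real"
  obtain x t where s: "s = (x, t)" by (metis surj_pair)
  show "scattering_ext \<kappa> R (lift_bd \<kappa> R G) (bd \<kappa> R s) = G s"
    unfolding s scattering_ext_bd[OF \<kappa>] lift_bd_bd[OF \<kappa>(1) G] by (rule fold_invariantD(2)[OF G]) auto
qed

section \<open>Division lemmas\<close>

text \<open>\<open>H\<close> is the average of the \<open>x\<close>-derivative over the segment from
  \<open>a\<close> to \<open>x\<close>; the factorization is the fundamental theorem of calculus,
  and smoothness comes from \<open>Ck_on_integral\<close>.\<close>

lemma hadamard_division:
  fixes f :: "real \<times> real \<Rightarrow> real"
  assumes f: "\<And>k. Ck_on k f UNIV" and z: "\<And>t. f (a, t) = 0"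
  obtains H where "\<And>k. Ck_on k H UNIV" "\<And>x t. f (x, t) = (x - a) * H (x, t)"
    "\<And>t. H (a, t) = frechet_derivative f (at (a, t)) (1, 0)"
proof -
  define f1 where "f1 p = frechet_derivative f (at p) (1, 0)" for p
  have f1: "Ck_on k f1 UNIV" for k
    using f[of "Suc k"] unfolding f1_def[abs_def] by simp
  define F where "F = (\<lambda>q :: (real \<times> real) \<times> real. f1 (a + snd q * (fst (fst q) - a), snd (fst q)))"
  have "Ck_on k (\<lambda>q :: (real \<times> real) \<times> real. fst (fst q)) UNIV" "Ck_on k (\<lambda>q :: (real \<times> real) \<times> real. snd (fst q)) UNIV"
     "Ck_on k (\<lambda>q :: (real \<times> real) \<times> real. snd q) UNIV" for k
    by (intro Ck_on_fst Ck_on_snd Ck_on_id open_UNIV)+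
  then have "Ck_on k (\<lambda>q :: (real \<times> real) \<times> real. (a + snd q * (fst (fst q) - a), snd (fst q))) UNIV" for k
    by (intro Ck_on_Pair Ck_on_add Ck_on_mult Ck_on_diff Ck_on_const open_UNIV)
  from Ck_on_compose[OF open_UNIV open_UNIV _ this f1]
  have F: "Ck_on k F UNIV" for k by (simp add: F_def)
  define H where "H = (\<lambda>p. integral {0..1} (\<lambda>s. F (p, s)))"
  show ?thesis
  proof (rule that)
    show "Ck_on k H UNIV" for k unfolding H_def by (rule Ck_on_integral[OF F])
    show "H (a, t) = frechet_derivative f (at (a, t)) (1, 0)" for t
      by (simp add: H_def F_def f1_def)
    show "f (x, t) = (x - a) * H (x, t)" for x t
    proof -
      have "((\<lambda>s. (x - a) * F ((x, t), s)) has_integral f (a + 1 * (x - a), t) - f (a + 0 * (x - a), t)) {0..1}"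
      proof (rule fundamental_theorem_of_calculus)
        fix s :: real
        let ?p = "(a + s * (x - a), t)"
        have df: "(f has_derivative frechet_derivative f (at ?p)) (at ?p)"
          using Ck_on_SucD[OF f[of "Suc 0"], of ?p] by simp
        have "((\<lambda>s. (a + s * (x - a), t)) has_derivative (\<lambda>h. h *\<^sub>R (x - a, 0))) (at s)"
          by (auto intro!: derivative_eq_intros)
        from has_derivative_compose[OF this df]
        have "((\<lambda>s. f (a + s * (x - a), t)) has_vector_derivative frechet_derivative f (at ?p) (x - a, 0)) (at s)"
          unfolding has_vector_derivative_def linear_cmul[OF has_derivative_linear[OF df]] .
        moreover have "frechet_derivative f (at ?p) (x - a, 0) = (x - a) * F ((x, t), s)"
          using linear_cmul[OF has_derivative_linear[OF df], of "x - a" "(1, 0)"] by (simp add: F_def f1_def)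
        ultimately show "((\<lambda>s. f (a + s * (x - a), t)) has_vector_derivative (x - a) * F ((x, t), s)) (at s within {0..1})"
          by (simp add: has_vector_derivative_at_within)
      qed simp
      from integral_unique[OF this] show ?thesis by (simp add: H_def z)
    qed
  qed
qed

lemma eventually_sin_nonzero: "eventually (\<lambda>x. sin ((x - a) / 2) \<noteq> 0) (at (y :: real))"
proof (cases "sin ((y - a) / 2) = 0")
  case False
  have "((\<lambda>x. sin ((x - a) / 2)) \<longlongrightarrow> sin ((y - a) / 2)) (at y)" by (intro tendsto_intros) simp
  then show ?thesis using False by (rule tendsto_imp_eventually_ne)
next
  case True
  then have c: "cos ((y - a) / 2) \<noteq> 0" using sin_cos_squared_add[of "(y - a) / 2"] by auto
  have "sin ((x - a) / 2) \<noteq> 0" if x: "x \<noteq> y" "dist x y < 2 * pi" for x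
  proof -
    have "sin ((x - a) / 2) = sin ((x - y) / 2 + (y - a) / 2)" by (simp add: field_simps)
    also have "\<dots> = sin ((x - y) / 2) * cos ((y - a) / 2)" unfolding sin_add using True by simp
    finally have e: "sin ((x - a) / 2) = sin ((x - y) / 2) * cos ((y - a) / 2)" .
    have "sin ((x - y) / 2) \<noteq> 0"
    proof (cases "x > y")
      case True
      then show ?thesis using sin_gt_zero[of "(x - y) / 2"] x by (simp add: dist_real_def)
    next
      case False
      have "sin ((x - y) / 2) = - sin ((y - x) / 2)" by (simp add: sin_minus[symmetric] minus_divide_left)
      then show ?thesis using False sin_gt_zero[of "(y - x) / 2"] x by (simp add: dist_real_def)
    qed
    then show ?thesis using c e by simp
  qed
  then show ?thesis unfolding eventually_at using pi_gt_zero by (intro exI[of _ "2 * pi"]) auto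
qed

text \<open>The zeros of the sine factors are isolated, so \<open>h\<close> vanishes on a punctured
  neighbourhood of \<open>y\<close>, and by continuity at \<open>y\<close>.\<close>

lemma sin_cancel:
  fixes h :: "real \<Rightarrow> real"
  assumes "isCont h y" "\<And>x. sin ((x - a) / 2) * sin ((x - b) / 2) * h x = 0"
  shows "h y = 0"
proof -
  have "eventually (\<lambda>x. h x = 0) (at y)"
    using eventually_sin_nonzero[of a y] eventually_sin_nonzero[of b y]
    by eventually_elim (use assms(2) in auto)
  then have "(h \<longlongrightarrow> 0) (at y)" by (rule tendsto_eventually)
  then show ?thesis using assms(1) unfolding isCont_def by (rule LIM_unique[symmetric])
qed

text \<open>All zeros of the divisor are simple. Near a zero \<open>x0\<close>, both
  \<open>f\<close> and the divisor are divided by \<open>x - x0\<close>, and the quotient of the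
  latter does not vanish there.\<close>

lemma sin_division:
  fixes f :: "real \<times> real \<Rightarrow> real"
  assumes f: "\<And>k. Ck_on k f UNIV" and z: "\<And>x t. sin ((x - a) / 2) = 0 \<Longrightarrow> f (x, t) = 0"
  shows "\<exists>g. (\<forall>k. Ck_on k g UNIV) \<and> (\<forall>x t. f (x, t) = sin ((x - a) / 2) * g (x, t))"
proof -
  \<comment> \<open>At the zeros of the divisor the value is the one forced by l'Hospital's
    rule.\<close>
  define g where "g = (\<lambda>p. if sin ((fst p - a) / 2) = 0
    then frechet_derivative f (at p) (1, 0) / (cos ((fst p - a) / 2) / 2) else f p / sin ((fst p - a) / 2))"
  define S where "S = (\<lambda>p :: real \<times> real. sin ((fst p - a) / 2))"
  have CS: "Ck_on k S UNIV" for k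
    unfolding S_def divide_inverse by (intro Ck_on_sin Ck_on_mult Ck_on_diff Ck_on_const Ck_on_fst Ck_on_id open_UNIV)
  have "Ck_on k g UNIV" for k
  proof (rule Ck_on_local)
    fix p :: "real \<times> real"
    obtain x0 t0 where p: "p = (x0, t0)" by (metis surj_pair)
    show "\<exists>V. open V \<and> p \<in> V \<and> Ck_on k g V"
    proof (cases "S p = 0")
      case False
      let ?V = "{q. S q \<noteq> 0}"
      have V: "open ?V"
        using Ck_on_imp_continuous[OF CS] by (intro open_Collect_neq) auto
      have "Ck_on k (\<lambda>q. f q / S q) ?V"
        using V by (intro Ck_on_divide Ck_on_subset[OF f] Ck_on_subset[OF CS]) auto
      then have "Ck_on k g ?V"
        by (rule Ck_on_cong[OF V, rotated]) (simp add: g_def S_def)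
      then show ?thesis using V False by blast
    next
      case True
      then have s0: "sin ((x0 - a) / 2) = 0" by (simp add: S_def p)
      then have c0: "cos ((x0 - a) / 2) \<noteq> 0" using sin_cos_squared_add[of "(x0 - a) / 2"] by auto
      obtain H where H: "\<And>k. Ck_on k H UNIV" "\<And>x t. f (x, t) = (x - x0) * H (x, t)"
        "\<And>t. H (x0, t) = frechet_derivative f (at (x0, t)) (1, 0)"
        using hadamard_division[OF f, of x0] z[OF s0] by metis
      obtain K where K: "\<And>k. Ck_on k K UNIV" "\<And>x t. S (x, t) = (x - x0) * K (x, t)"
        "\<And>t. K (x0, t) = frechet_derivative S (at (x0, t)) (1, 0)"
        using hadamard_division[OF CS, of x0] s0 by (auto simp: S_def)
      have "(S has_derivative (\<lambda>h. fst h / 2 * cos ((x0 - a) / 2))) (at (x0, t))" for t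
        unfolding S_def by (auto intro!: derivative_eq_intros bounded_linear_imp_has_derivative[OF bounded_linear_fst])
      then have K0: "K (x0, t) = cos ((x0 - a) / 2) / 2" for t
        unfolding K(3) by (subst frechet_derivativeI) auto
      let ?V = "{q. K q \<noteq> 0}"
      have V: "open ?V"
        using Ck_on_imp_continuous[OF K(1)] by (intro open_Collect_neq) auto
      have "Ck_on k (\<lambda>q. H q / K q) ?V"
        using V by (intro Ck_on_divide Ck_on_subset[OF H(1)] Ck_on_subset[OF K(1)]) auto
      then have "Ck_on k g ?V"
      proof (rule Ck_on_cong[OF V, rotated])
        fix q assume q: "q \<in> ?V"
        obtain x t where xt: "q = (x, t)" by (metis surj_pair)
        show "H q / K q = g q"
        proof (cases "x = x0")
          case True
          then show ?thesis using s0 by (simp add: g_def xt K0 H(3))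
        next
          case False
          then have "S q \<noteq> 0" using q K(2) by (simp add: xt)
          then have "g q = f q / S q" by (simp add: g_def S_def)
          then show ?thesis using False by (simp add: xt H(2) K(2))
        qed
      qed
      moreover have "K p \<noteq> 0" using c0 K0[of t0] p by simp
      ultimately show ?thesis using V by blast
    qed
  qed
  moreover have "f (x, t) = sin ((x - a) / 2) * g (x, t)" for x t
    using z by (simp add: g_def)
  ultimately show ?thesis by blast
qed

lemma cis_eq_shift:
  assumes "cis x' = cis x"
  shows "\<exists>d. x' = x + d \<and> (\<forall>y. cis (y + d) = cis y)"
proof (intro exI conjI allI)
  show "x' = x + (x' - x)" by simp
  have "cis (x' - x) = 1" using assms by (simp add: cis_divide[symmetric])
  then show "cis (y + (x' - x)) = cis y" for y by (simp add: cis_mult[symmetric])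
qed

lemma Ck_on_line1: "Ck_on k g UNIV \<Longrightarrow> isCont (\<lambda>x. g (x, t)) (y :: real)"
  using Ck_on_imp_continuous[of k g UNIV] by (intro continuous_intros continuous_within_compose3[where f = "\<lambda>x. (x, t)"])
    (auto simp: continuous_on_eq_continuous_at intro!: isCont_o2[where f = "\<lambda>x. (x, t)" and g = g] continuous_intros)

text \<open>Each factor is a divisor for \<open>sin_division\<close>, so the difference of sines can
  be divided out in two rounds, also where \<open>cos a = 0\<close> and both factors vanish at
  \<open>a\<close>.\<close>

lemma sin_diff_factor: "sin x - sin a = - 2 * (sin ((x - a) / 2) * sin ((x - (pi - a)) / 2))" for x a :: real
proof -
  have "(x - (pi - a)) / 2 = (x + a) / 2 - pi / 2" by (simp add: add_divide_distrib diff_divide_distrib)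
  then have "sin ((x - (pi - a)) / 2) = sin ((x + a) / 2 - pi / 2)" by (simp only:)
  also have "\<dots> = - cos ((x + a) / 2)" by (simp add: sin_diff)
  finally show ?thesis by (simp add: sin_diff_sin)
qed

lemma one_minus_cos: "1 - cos (t - a) = 2 * (sin ((t - a) / 2) * sin ((t - a) / 2))" for t a :: real
proof -
  have "cos (2 * ((t - a) / 2)) = 1 - 2 * (sin ((t - a) / 2))\<^sup>2" by (rule cos_double_sin)
  moreover have "2 * ((t - a) / 2) = t - a" by simp
  ultimately show ?thesis by (simp only: power2_eq_square)
qed

text \<open>
  For a fold point, where \<open>sin x0 = \<plusminus>1\<close>, both factors of \<open>sin x - sin x0\<close> vanish there, and the
  symmetry under the fold gives the second zero.
\<close>

lemma fold_division:
  fixes u :: "real \<times> real \<Rightarrow> real"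
  assumes u: "fold_invariant u"
  obtains g where "fold_invariant g" "\<And>x t. u (x, t) - u (x0, t) = (sin x - sin x0) * g (x, t)"
proof -
  define f where "f = (\<lambda>p. u p - u (x0, snd p))"
  have f: "Ck_on k f UNIV" for k
  proof -
    have "Ck_on k (\<lambda>p :: real \<times> real. (x0, snd p)) UNIV"
      by (intro Ck_on_Pair Ck_on_const Ck_on_snd Ck_on_id open_UNIV)
    from Ck_on_compose[OF open_UNIV open_UNIV _ this fold_invariantD(1)[OF u]]
    show ?thesis unfolding f_def by (intro Ck_on_diff fold_invariantD(1)[OF u] open_UNIV) simp
  qed
  have f0: "f (x, t) = f (x', t')" if "sin x = sin x'" "cis t = cis t'" for x x' t t'
    using fold_invariantD(2)[OF u that] fold_invariantD(2)[OF u refl that(2)] by (simp add: f_def)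
  have fz: "f (x, t) = 0" if "sin x = sin x0" for x t
    using f0[OF that refl, of t] by (simp add: f_def)
  have "f (x, t) = 0" if "sin ((x - x0) / 2) = 0" for x t
    using sin_diff_factor[of x x0] that by (intro fz) simp
  from sin_division[OF f this]
  obtain f1 where f1: "\<And>k. Ck_on k f1 UNIV" "\<And>x t. f (x, t) = sin ((x - x0) / 2) * f1 (x, t)"
    by blast
  have "f1 (x, t) = 0" if x: "sin ((x - (pi - x0)) / 2) = 0" for x t
  proof -
    have sx: "sin x = sin x0" using sin_diff_factor[of x x0] x by simp
    show "f1 (x, t) = 0"
    proof (cases "sin ((x - x0) / 2) = 0")
      case False
      then show ?thesis using fz[OF sx, of t] f1(2) by simp
    next
      case True
      have "cos x = 0"
      proof -
        have "x - pi / 2 = (x - x0) / 2 + (x - (pi - x0)) / 2" by (simp add: field_simps)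
        then have "sin (x - pi / 2) = 0" using True x by (simp add: sin_add)
        then show ?thesis by (simp add: sin_diff)
      qed
      \<comment> \<open>At a fold point the reflection \<open>y \<mapsto> 2 * x - y\<close>
        preserves \<open>f\<close> and reverses \<open>sin ((y - x0) / 2)\<close>. So
        \<open>f1\<close> is odd about \<open>x\<close> and vanishes there.\<close>
      have mirror: "sin (2 * x - y) = sin y" for y
      proof -
        have "sin (2 * x) = 0" "cos (2 * x) = - 1"
          using \<open>cos x = 0\<close> sin_cos_squared_add[of x] by (simp_all add: sin_double cos_double)
        then show ?thesis by (simp add: sin_diff)
      qed
      have odd: "sin ((2 * x - y - x0) / 2) = - sin ((y - x0) / 2)" for y
      proof -
        have "(2 * x - y - x0) / 2 = 2 * ((x - x0) / 2) - (y - x0) / 2" by (simp add: field_simps)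
        moreover have "sin (2 * ((x - x0) / 2)) = 0" "cos (2 * ((x - x0) / 2)) = 1"
          using True unfolding sin_double cos_double_sin by simp_all
        ultimately show ?thesis by (simp only: sin_diff)
      qed
      have "sin ((y - x0) / 2) * (f1 (2 * x - y, t) + f1 (y, t)) = 0" for y
      proof -
        have "f (2 * x - y, t) = f (y, t)" by (rule f0[OF mirror refl])
        then have "- sin ((y - x0) / 2) * f1 (2 * x - y, t) = sin ((y - x0) / 2) * f1 (y, t)"
          unfolding f1(2) odd .
        then show ?thesis by (simp add: distrib_left)
      qed
      moreover have "isCont (\<lambda>y. f1 (2 * x - y, t) + f1 (y, t)) x"
        by (intro continuous_intros Ck_on_line1[OF f1(1)] isCont_o2[where g = "\<lambda>y. f1 (y, t)" and f = "\<lambda>y. 2 * x - y"])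
      ultimately have "f1 (2 * x - x, t) + f1 (x, t) = 0"
        using sin_cancel[where h = "\<lambda>y. f1 (2 * x - y, t) + f1 (y, t)" and y = x and a = x0 and b = x0] by simp
      then show ?thesis by simp
    qed
  qed
  from sin_division[OF f1(1) this]
  obtain f2 where f2: "\<And>k. Ck_on k f2 UNIV" "\<And>x t. f1 (x, t) = sin ((x - (pi - x0)) / 2) * f2 (x, t)"
    by blast
  define g where "g = (\<lambda>p. (- 1 / 2) * f2 p)"
  have g: "Ck_on k g UNIV" for k unfolding g_def by (intro Ck_on_mult Ck_on_const f2 open_UNIV)
  have fg: "f (x, t) = (sin x - sin x0) * g (x, t)" for x t
    unfolding f1(2) f2(2) sin_diff_factor[of x x0] by (simp add: g_def)
  have "fold_invariant g"
  proof (rule fold_invariantI[OF g])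
    fix x x' t t' :: real assume x: "sin x = sin x'" and t: "cis t = cis t'"
    \<comment> \<open>Invariance of the quotient follows from that of \<open>f\<close> and of the
      divisor by cancellation, for each of the maps that generate the symmetry: shifts by a period,
      and the fold followed by such a shift.\<close>
    have key: "g (\<phi> x, t') = g (x, t)" if \<phi>: "\<And>y. sin (\<phi> y) = sin y" "\<And>y. isCont \<phi> y" for \<phi>
    proof -
      have "(sin y - sin x0) * (g (\<phi> y, t') - g (y, t)) = 0" for y
        using fg[of "\<phi> y" t'] fg[of y t] f0[of "\<phi> y" y t' t] \<phi>(1)[of y] t by (simp add: algebra_simps)
      then have "sin ((y - x0) / 2) * sin ((y - (pi - x0)) / 2) * (g (\<phi> y, t') - g (y, t)) = 0" for y
        unfolding sin_diff_factor by simp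
      moreover have "isCont (\<lambda>y. g (\<phi> y, t') - g (y, t)) x"
        by (intro continuous_intros Ck_on_line1[OF g] isCont_o2[where g = "\<lambda>y. g (y, t')" and f = \<phi>] \<phi>(2))
      ultimately have "g (\<phi> x, t') - g (x, t) = 0"
        by (intro sin_cancel[where h = "\<lambda>y. g (\<phi> y, t') - g (y, t)" and y = x and a = x0 and b = "pi - x0"])
      then show ?thesis by simp
    qed
    from cos_cases_of_sin_eq[OF x] show "g (x, t) = g (x', t')"
    proof
      assume "cis x' = cis x"
      then obtain d where d: "x' = x + d" "\<And>y. cis (y + d) = cis y" using cis_eq_shift by blast
      have "g (x + d, t') = g (x, t)"
        using d(2) by (intro key[of "\<lambda>y. y + d"]) (auto simp: complex_eq_iff intro!: continuous_intros)
      then show ?thesis using d(1) by simp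
    next
      assume "cis x' = cis (pi - x)"
      then obtain d where d: "x' = pi - x + d" "\<And>y. cis (y + d) = cis y" using cis_eq_shift by blast
      have "g (pi - x + d, t') = g (x, t)"
        using d(2)[of "pi - y" for y] by (intro key[of "\<lambda>y. pi - y + d"]) (auto simp: complex_eq_iff intro!: continuous_intros)
      then show ?thesis using d(1) by simp
    qed
  qed
  then show ?thesis using fg that by (simp add: f_def)
qed

text \<open>Second-order Taylor formula on the circle: \<open>sin (t - t0)\<close> and
  \<open>1 - cos (t - t0)\<close> replace \<open>t - t0\<close> and its square, so that
  \<open>h\<close> is periodic. Derivations at \<open>t0\<close> annihilate the last
  summand.\<close>

lemma circle_division:
  fixes v :: "real \<Rightarrow> real"
  assumes v: "\<And>k. Ck_on k v UNIV" and per: "\<And>t t'. cis t = cis t' \<Longrightarrow> v t = v t'"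
    and v': "(v has_real_derivative b) (at t0)"
  obtains h where "fold_invariant (\<lambda>s :: real \<times> real. h (snd s))"
    "\<And>t. v t = v t0 + b * sin (t - t0) + (1 - cos (t - t0)) * h t"
proof -
  define r where "r = (\<lambda>t. v t - v t0 - b * sin (t - t0))"
  \<comment> \<open>\<open>sin_division\<close> is stated for two variables; the second one is a
    dummy here.\<close>
  have Cv: "Ck_on k (\<lambda>p :: real \<times> real. v (fst p)) UNIV" for k
    by (rule Ck_on_compose[OF open_UNIV open_UNIV _ _ v]) (auto intro!: Ck_on_fst Ck_on_id)
  have r: "Ck_on k (\<lambda>p :: real \<times> real. r (fst p)) UNIV" for k
    unfolding r_def by (intro Ck_on_diff Ck_on_mult Ck_on_const Ck_on_sin Ck_on_fst Ck_on_id open_UNIV Cv)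
  have cis_t0: "cis t = cis t0" if "sin ((t - t0) / 2) = 0" for t
  proof -
    have e: "t - t0 = 2 * ((t - t0) / 2)" by simp
    have "cos (t - t0) = 1" "sin (t - t0) = 0"
      by (subst e, unfold sin_double cos_double_sin that, simp)+
    then have "cis (t - t0) = 1" by (simp add: complex_eq_iff)
    then show ?thesis by (simp add: cis_divide[symmetric])
  qed
  have rper: "r t = r t'" if "cis t = cis t'" for t t'
  proof -
    have "cis (t - t0) = cis (t' - t0)" using that by (simp add: cis_divide[symmetric])
    then show ?thesis using per[OF that] by (simp add: r_def complex_eq_iff)
  qed
  have r0: "r t = 0" if "sin ((t - t0) / 2) = 0" for t
    using rper[OF cis_t0[OF that]] by (simp add: r_def)
  have "\<exists>g. (\<forall>k. Ck_on k g UNIV) \<and> (\<forall>t y. r (fst (t, y :: real)) = sin ((t - t0) / 2) * g (t, y))"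
    by (rule sin_division[OF r]) (simp add: r0)
  then obtain r1 where r1: "\<And>k. Ck_on k r1 UNIV" "\<And>t y :: real. r t = sin ((t - t0) / 2) * r1 (t, y)"
    by auto
  \<comment> \<open>Subtracting the sine has removed the first-order term, which gives the second
    zero. By periodicity it recurs at every \<open>t\<close> with
    \<open>cis t = cis t0\<close>.\<close>
  have r': "(r has_real_derivative 0) (at t0)"
    unfolding r_def by (auto intro!: derivative_eq_intros v')
  have "r1 (t, y) = 0" if t: "sin ((t - t0) / 2) = 0" for t y
  proof -
    obtain d where d: "t = t0 + d" "\<And>y. cis (y + d) = cis y"
      using cis_eq_shift[OF cis_t0[OF t]] by blast
    have "(\<lambda>s. r (s + - d)) = r"
    proof
      fix s show "r (s + - d) = r s" using rper[OF d(2)[of "s - d"]] by simp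
    qed
    moreover have "(r has_real_derivative 0) (at (t + - d))" using r' by (simp add: d(1))
    ultimately have r't: "(r has_real_derivative 0) (at t)"
      using DERIV_shift[of r 0 t "- d"] by (simp only:)
    have "((\<lambda>s. r1 (s, y)) has_derivative (\<lambda>h. frechet_derivative r1 (at (t, y)) (h, 0))) (at t)"
    proof -
      have "((\<lambda>s. (s, y)) has_derivative (\<lambda>h. (h, 0))) (at t)" by (auto intro!: derivative_eq_intros)
      from has_derivative_compose[OF this Ck_on_SucD[OF r1(1)[of "Suc 0"]]] show ?thesis by simp
    qed
    then obtain D where D: "((\<lambda>s. r1 (s, y)) has_real_derivative D) (at t)"
      using differentiableI real_differentiable_def by blast
    have "((\<lambda>s. sin ((s - t0) / 2) * r1 (s, y)) has_real_derivative
        cos ((t - t0) / 2) / 2 * r1 (t, y) + D * sin ((t - t0) / 2)) (at t)"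
      by (auto intro!: derivative_eq_intros D)
    moreover have "(\<lambda>s. sin ((s - t0) / 2) * r1 (s, y)) = r" using r1(2) by auto
    ultimately have "(r has_real_derivative cos ((t - t0) / 2) / 2 * r1 (t, y) + D * sin ((t - t0) / 2)) (at t)" by simp
    from DERIV_unique[OF this r't] have "cos ((t - t0) / 2) * r1 (t, y) = 0" using t by simp
    moreover have "cos ((t - t0) / 2) \<noteq> 0" using t sin_cos_squared_add[of "(t - t0) / 2"] by auto
    ultimately show ?thesis by simp
  qed
  from sin_division[OF r1(1) this]
  obtain r2 where r2: "\<And>k. Ck_on k r2 UNIV" "\<And>t y. r1 (t, y) = sin ((t - t0) / 2) * r2 (t, y)"
    by blast
  define h where "h = (\<lambda>t. r2 (t, 0) / 2)"
  have rh: "r t = (1 - cos (t - t0)) * h t" for t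
    unfolding one_minus_cos using r1(2)[of t 0] r2(2)[of t 0] by (simp add: h_def)
  have hC: "isCont h t" for t
    unfolding h_def by (intro continuous_intros Ck_on_line1[OF r2(1)]) simp
  have "fold_invariant (\<lambda>s :: real \<times> real. h (snd s))"
  proof (rule fold_invariantI)
    have "Ck_on k (\<lambda>s :: real \<times> real. (snd s, 0 :: real)) UNIV" for k
      by (intro Ck_on_Pair Ck_on_snd Ck_on_const Ck_on_id open_UNIV)
    from Ck_on_compose[OF open_UNIV open_UNIV _ this r2(1)]
    show "Ck_on k (\<lambda>s :: real \<times> real. h (snd s)) UNIV" for k
      unfolding h_def divide_inverse by (intro Ck_on_mult Ck_on_const open_UNIV) simp
    fix x x' t t' :: real assume "cis t = cis t'"
    then have "cis t' = cis t" by simp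
    then obtain d where d: "t' = t + d" "\<And>y. cis (y + d) = cis y" using cis_eq_shift by blast
    have "(1 - cos (y - t0)) * (h (y + d) - h y) = 0" for y
    proof -
      have "cis (y + d - t0) = cis (y - t0)" using d(2)[of "y - t0"] by (simp add: algebra_simps)
      then have "cos (y + d - t0) = cos (y - t0)" by (simp add: complex_eq_iff)
      then show ?thesis using rh[of y] rh[of "y + d"] rper[OF d(2)[of y]] by (simp add: algebra_simps)
    qed
    then have "sin ((y - t0) / 2) * sin ((y - t0) / 2) * (h (y + d) - h y) = 0" for y
      unfolding one_minus_cos by simp
    moreover have "isCont (\<lambda>y. h (y + d) - h y) t"
      by (intro continuous_intros hC isCont_o2[where g = h and f = "\<lambda>y. y + d"])
    ultimately have "h (t + d) - h t = 0"
      by (intro sin_cancel[where h = "\<lambda>y. h (y + d) - h y" and y = t and a = t0 and b = t0])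
    then show "h (snd (x, t)) = h (snd (x', t'))" by (simp add: d(1))
  qed
  moreover have "v t = v t0 + b * sin (t - t0) + (1 - cos (t - t0)) * h t" for t
    using rh[of t] by (simp add: r_def)
  ultimately show ?thesis by (rule that)
qed

section \<open>Tangent vectors of the quotient\<close>

definition fold_derivation :: "real \<times> real \<Rightarrow> ((real \<times> real \<Rightarrow> real) \<Rightarrow> real) \<Rightarrow> bool" where
  "fold_derivation s D \<longleftrightarrow> (\<forall>G H. fold_invariant G \<longrightarrow> fold_invariant H \<longrightarrow>
     D (\<lambda>s. G s + H s) = D G + D H \<and> (\<forall>c. D (\<lambda>s. c * G s) = c * D G) \<and>
     D (\<lambda>s. G s * H s) = D G * H s + G s * D H)"

lemma fold_derivationD:
  assumes "fold_derivation s D" "fold_invariant G" "fold_invariant H"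
  shows "D (\<lambda>s. G s + H s) = D G + D H" "D (\<lambda>s. c * G s) = c * D G"
    "D (\<lambda>s. G s * H s) = D G * H s + G s * D H"
  using assms(1)[unfolded fold_derivation_def, rule_format, OF assms(2,3)] by simp_all

section \<open>Derivations on the fold-invariant functions\<close>

lemma fold_invariant_const: "fold_invariant (\<lambda>s. c)"
  by (rule fold_invariantI) (simp_all add: Ck_on_const)

lemma fold_invariant_add:
  assumes G: "fold_invariant G" and H: "fold_invariant H"
  shows "fold_invariant (\<lambda>s. G s + H s)"
proof (rule fold_invariantI)
  show "Ck_on k (\<lambda>s. G s + H s) UNIV" for k
    by (intro Ck_on_add fold_invariantD(1)[OF G] fold_invariantD(1)[OF H] open_UNIV)
  show "G (x, t) + H (x, t) = G (x', t') + H (x', t')" if "sin x = sin x'" "cis t = cis t'" for x x' t t'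
    using fold_invariantD(2)[OF G that] fold_invariantD(2)[OF H that] by simp
qed

lemma fold_invariant_mult:
  fixes G H :: "real \<times> real \<Rightarrow> real"
  assumes G: "fold_invariant G" and H: "fold_invariant H"
  shows "fold_invariant (\<lambda>s. G s * H s)"
proof (rule fold_invariantI)
  show "Ck_on k (\<lambda>s. G s * H s) UNIV" for k
    by (intro Ck_on_mult fold_invariantD(1)[OF G] fold_invariantD(1)[OF H] open_UNIV)
  show "G (x, t) * H (x, t) = G (x', t') * H (x', t')" if "sin x = sin x'" "cis t = cis t'" for x x' t t'
    using fold_invariantD(2)[OF G that] fold_invariantD(2)[OF H that] by simp
qed

lemma fold_invariant_trig:
  "fold_invariant (\<lambda>s :: real \<times> real. sin (fst s))"
  "fold_invariant (\<lambda>s :: real \<times> real. sin (snd s - a))"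
  "fold_invariant (\<lambda>s :: real \<times> real. cos (snd s - a))"
proof -
  have trig: "sin (t - a) = sin (t' - a) \<and> cos (t - a) = cos (t' - a)" if "cis t = cis t'" for t t'
  proof -
    have "cis (t - a) = cis (t' - a)" unfolding cis_divide[symmetric] that ..
    then show ?thesis by (simp add: complex_eq_iff)
  qed
  have Ck: "Ck_on k (\<lambda>s :: real \<times> real. sin (fst s)) UNIV" "Ck_on k (\<lambda>s :: real \<times> real. sin (snd s - a)) UNIV"
    "Ck_on k (\<lambda>s :: real \<times> real. cos (snd s - a)) UNIV" for k
    by (intro Ck_on_sin Ck_on_cos Ck_on_diff Ck_on_fst Ck_on_snd Ck_on_id Ck_on_const open_UNIV)+
  show "fold_invariant (\<lambda>s :: real \<times> real. sin (fst s))"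
    by (rule fold_invariantI, rule Ck) simp
  show "fold_invariant (\<lambda>s :: real \<times> real. sin (snd s - a))"
    by (rule fold_invariantI, rule Ck, unfold snd_conv, rule trig[THEN conjunct1])
  show "fold_invariant (\<lambda>s :: real \<times> real. cos (snd s - a))"
    by (rule fold_invariantI, rule Ck, unfold snd_conv, rule trig[THEN conjunct2])
qed

lemma fold_derivation_const:
  assumes D: "fold_derivation s D"
  shows "D (\<lambda>s. c) = 0"
proof -
  have "D (\<lambda>s. 1) = 0"
    using fold_derivationD(3)[OF D fold_invariant_const[of 1] fold_invariant_const[of 1]] by simp
  then show ?thesis
    using fold_derivationD(2)[OF D fold_invariant_const[of 1] fold_invariant_const[of 1], of c] by simp
qed

text \<open>\<open>u\<close> is a constant plus \<open>b * sin (t - t0)\<close>,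
  \<open>(1 - cos (t - t0)) * h\<close> and \<open>(sin x - sin x0) * g\<close>. In the products,
  the Leibniz rule leaves the terms in which the vanishing factor is differentiated.\<close>

lemma fold_derivation_expand:
  assumes D: "fold_derivation (x0, t0) D" and u: "fold_invariant u"
    and g: "fold_invariant g" "\<And>x t. u (x, t) - u (x0, t) = (sin x - sin x0) * g (x, t)"
    and b: "((\<lambda>t. u (x0, t)) has_real_derivative b) (at t0)"
  shows "D u = D (\<lambda>s. sin (fst s)) * g (x0, t0) + D (\<lambda>s. sin (snd s - t0)) * b"
proof -
  note FI = fold_invariant_add fold_invariant_mult fold_invariant_const fold_invariant_trig
  note DD = fold_derivationD[OF D]
  have Ckv: "Ck_on k (\<lambda>t. u (x0, t)) UNIV" for k
    by (rule Ck_on_compose[OF open_UNIV open_UNIV _ _ fold_invariantD(1)[OF u]])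
      (auto intro!: Ck_on_Pair Ck_on_const Ck_on_id)
  obtain h where h: "fold_invariant (\<lambda>s :: real \<times> real. h (snd s))"
    "\<And>t. u (x0, t) = u (x0, t0) + b * sin (t - t0) + (1 - cos (t - t0)) * h t"
    using circle_division[OF Ckv fold_invariantD(2)[OF u refl] b] by metis
  let ?Q = "\<lambda>s :: real \<times> real. sin (fst s)" and ?S = "\<lambda>s :: real \<times> real. sin (snd s - t0)"
    and ?C = "\<lambda>s :: real \<times> real. cos (snd s - t0)"
  \<comment> \<open>At \<open>t0\<close> the sine vanishes and the cosine is 1, so the Leibniz rule
    applied to this constant gives \<open>D ?C = 0\<close>.\<close>
  have "(\<lambda>s. ?S s * ?S s + ?C s * ?C s) = (\<lambda>s. 1)"
    by (rule ext) (simp add: power2_eq_square[symmetric])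
  then have "D (\<lambda>s. ?S s * ?S s + ?C s * ?C s) = 0" using fold_derivation_const[OF D, of 1] by (simp only:)
  then have C0: "D ?C = 0"
    using DD(1)[of "\<lambda>s. ?S s * ?S s" "\<lambda>s. ?C s * ?C s"] DD(3)[of ?S ?S] DD(3)[of ?C ?C] by (simp add: FI)
  define F1 where "F1 = (\<lambda>s. - sin x0 + ?Q s)"
  define F2 where "F2 = (\<lambda>s. 1 + (-1) * ?C s)"
  have inv: "fold_invariant F1" "fold_invariant F2" unfolding F1_def F2_def by (intro FI)+
  have F1: "D F1 = D ?Q" unfolding F1_def using DD(1)[of "\<lambda>s. - sin x0" ?Q] fold_derivation_const[OF D] by (simp add: FI)
  have F2: "D F2 = 0"
    unfolding F2_def using DD(1)[of "\<lambda>s. 1" "\<lambda>s. (-1) * ?C s"] DD(2)[of ?C ?C "-1"] fold_derivation_const[OF D] C0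
    by (simp only: FI)
  have "u = (\<lambda>s. (u (x0, t0) + b * ?S s) + (F2 s * h (snd s) + F1 s * g s))"
  proof
    fix s :: "real \<times> real"
    show "u s = (u (x0, t0) + b * ?S s) + (F2 s * h (snd s) + F1 s * g s)"
    proof -
      have "u s - u (x0, snd s) = F1 s * g s" using g(2)[of "fst s" "snd s"] by (simp add: F1_def)
      moreover have "u (x0, snd s) = u (x0, t0) + b * ?S s + F2 s * h (snd s)"
        using h(2)[of "snd s"] by (simp add: F2_def)
      ultimately show ?thesis by linarith
    qed
  qed
  then have "D u = D (\<lambda>s. (u (x0, t0) + b * ?S s) + (F2 s * h (snd s) + F1 s * g s))" by simp
  also have "\<dots> = D (\<lambda>s. u (x0, t0) + b * ?S s) + (D (\<lambda>s. F2 s * h (snd s)) + D (\<lambda>s. F1 s * g s))"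
    by (subst DD(1), (intro FI inv h(1) g(1))+, subst DD(1), (intro FI inv h(1) g(1))+) (rule refl)
  also have "D (\<lambda>s. u (x0, t0) + b * ?S s) = D ?S * b"
    using DD(1)[of "\<lambda>s. u (x0, t0)" "\<lambda>s. b * ?S s"] DD(2)[of ?S ?S b] fold_derivation_const[OF D] by (simp add: FI)
  also have "D (\<lambda>s. F2 s * h (snd s)) = 0"
    using DD(3)[OF inv(2) h(1)] F2 by (simp add: F2_def)
  also have "D (\<lambda>s. F1 s * g s) = D ?Q * g (x0, t0)"
    using DD(3)[OF inv(1) g(1)] F1 by (simp add: F1_def)
  finally show ?thesis by simp
qed

text \<open>Identifies \<open>g (x0, t0)\<close> when \<open>u\<close> is known as a function of
  \<open>sin x\<close>: off the zeros of \<open>sin x - sin x0\<close>, \<open>g\<close> is the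
  Caratheodory slope \<open>k\<close> of \<open>f\<close>, and continuity carries this to
  \<open>x0\<close>. The argument covers the fold points as well.\<close>

lemma fold_derivation_eq:
  assumes D: "fold_derivation (x0, t0) D" and u: "fold_invariant u"
    and b: "((\<lambda>t. u (x0, t)) has_real_derivative b) (at t0)"
    and f: "\<And>x. u (x, t0) = f (sin x)" and d: "(f has_real_derivative d) (at (sin x0))"
  shows "D u = D (\<lambda>s. sin (fst s)) * d + D (\<lambda>s. sin (snd s - t0)) * b"
proof -
  obtain g where g: "fold_invariant g" "\<And>x t. u (x, t) - u (x0, t) = (sin x - sin x0) * g (x, t)"
    using fold_division[OF u, of x0] by metis
  obtain k where k: "\<And>y. f y - f (sin x0) = k y * (y - sin x0)" "isCont k (sin x0)" "k (sin x0) = d"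
    using d unfolding CARAT_DERIV by metis
  have "(sin x - sin x0) * (g (x, t0) - k (sin x)) = 0" for x
    using g(2)[of x t0] k(1)[of "sin x"] by (simp add: f algebra_simps)
  then have "sin ((x - x0) / 2) * sin ((x - (pi - x0)) / 2) * (g (x, t0) - k (sin x)) = 0" for x
    unfolding sin_diff_factor by simp
  moreover have "isCont (\<lambda>x. g (x, t0) - k (sin x)) x0"
    by (intro continuous_intros Ck_on_line1[OF fold_invariantD(1)[OF g(1)]] isCont_o2[where g = k and f = sin] k(2))
  ultimately have "g (x0, t0) - k (sin x0) = 0"
    by (intro sin_cancel[where h = "\<lambda>x. g (x, t0) - k (sin x)" and y = x0 and a = x0 and b = "pi - x0"])
  then have "g (x0, t0) = d" using k(3) by simp
  then show ?thesis using fold_derivation_expand[OF D u g b] by simp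
qed

lemma fold_derivation_complex:
  fixes f :: "real \<Rightarrow> complex"
  assumes D: "fold_derivation (x0, t0) D"
    and u: "fold_invariant (\<lambda>s. Re (U s))" "fold_invariant (\<lambda>s. Im (U s))"
    and U: "\<And>x t. U (x, t) = f (sin x) * cis t" and f: "(f has_vector_derivative d) (at (sin x0))"
  shows "Complex (D (\<lambda>s. Re (U s))) (D (\<lambda>s. Im (U s))) =
    D (\<lambda>s. sin (fst s)) * (d * cis t0) + D (\<lambda>s. sin (snd s - t0)) * (\<i> * f (sin x0) * cis t0)"
proof -
  have 1: "((\<lambda>t. f (sin x0) * cis t) has_vector_derivative f (sin x0) * (\<i> * cis t0)) (at t0)"
  proof -
    have "((\<lambda>t. Complex (cos t) (sin t)) has_vector_derivative Complex (- sin t0) (cos t0)) (at t0)"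
      unfolding has_vector_derivative_complex_iff by (auto intro!: derivative_eq_intros)
    moreover have "Complex (- sin t0) (cos t0) = \<i> * cis t0" by (simp add: complex_eq_iff)
    ultimately have "(cis has_vector_derivative \<i> * cis t0) (at t0)" by (simp add: cis.code[abs_def])
    then show ?thesis by (rule has_vector_derivative_mult_right)
  qed
  have 2: "((\<lambda>y. f y * cis t0) has_vector_derivative d * cis t0) (at (sin x0))"
    by (rule has_vector_derivative_mult_left[OF f])
  have "D (\<lambda>s. Re (U s)) = D (\<lambda>s. sin (fst s)) * Re (d * cis t0) + D (\<lambda>s. sin (snd s - t0)) * Re (f (sin x0) * (\<i> * cis t0))"
    using 1 2 unfolding has_vector_derivative_complex_iff
    by (intro fold_derivation_eq[OF D u(1), where f = "\<lambda>y. Re (f y * cis t0)"]) (simp_all only: U)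
  moreover have "D (\<lambda>s. Im (U s)) = D (\<lambda>s. sin (fst s)) * Im (d * cis t0) + D (\<lambda>s. sin (snd s - t0)) * Im (f (sin x0) * (\<i> * cis t0))"
    using 1 2 unfolding has_vector_derivative_complex_iff
    by (intro fold_derivation_eq[OF D u(2), where f = "\<lambda>y. Im (f y * cis t0)"]) (simp_all only: U)
  ultimately show ?thesis by (simp add: complex_eq_iff algebra_simps)
qed

text \<open>The invariant extension evaluates \<open>u\<close> on the influx set, so it vanishes on
  the whole torus whatever values \<open>u\<close> takes elsewhere.\<close>

lemma alpha_smooth_vanishing:
  assumes \<kappa>: "R > 0" "\<kappa> > - 1 / R\<^sup>2" and u: "\<And>q. q \<in> influx \<kappa> R \<Longrightarrow> u q = 0"
  shows "alpha_smooth \<kappa> R u"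
  unfolding alpha_smooth_def
proof (rule smooth_on_bdryI[where G = "\<lambda>_. 0" and \<kappa> = \<kappa>, OF \<kappa>(1)])
  show "Ck_on k (\<lambda>_. 0) UNIV" for k by (rule Ck_on_const)
  fix s :: "real \<times> real"
  obtain x t where s: "s = (x, t)" by (metis surj_pair)
  show "scattering_ext \<kappa> R u (bd \<kappa> R s) = 0"
    unfolding s scattering_ext_bd[OF \<kappa>] by (intro u) (auto simp: bd_flux[OF \<kappa>])
qed

text \<open>The difference \<open>d\<close> satisfies \<open>d = d * e\<close> with \<open>e\<close>
  the indicator of the complement of the influx set. Both factors vanish at \<open>p\<close>, so the
  Leibniz rule gives \<open>\<delta> d = 0\<close>.\<close>

lemma alpha_tangent_cong:
  assumes \<kappa>: "R > 0" "\<kappa> > - 1 / R\<^sup>2" and p: "p \<in> influx \<kappa> R" and \<delta>: "\<delta> \<in> alpha_tangent \<kappa> R p"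
    and u: "alpha_smooth \<kappa> R u" "alpha_smooth \<kappa> R v" "\<And>q. q \<in> influx \<kappa> R \<Longrightarrow> u q = v q"
  shows "\<delta> u = \<delta> v"
proof -
  define d where "d = (\<lambda>q. u q - v q)"
  define e where "e = (\<lambda>q. if q \<in> influx \<kappa> R then 0 else (1 :: real))"
  have s: "alpha_smooth \<kappa> R d" "alpha_smooth \<kappa> R e"
    using u(3) by (auto intro!: alpha_smooth_vanishing[OF \<kappa>] simp: d_def e_def)
  have "\<delta> (\<lambda>q. d q * e q) = \<delta> d * e p + d p * \<delta> e"
    using \<delta> s unfolding alpha_tangent_def by blast
  moreover have "(\<lambda>q. d q * e q) = d" using u(3) by (auto simp: d_def e_def)
  moreover have "e p = 0" "d p = 0" using p u(3) by (simp_all add: d_def e_def)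
  ultimately have "\<delta> d = 0" by simp
  moreover have "\<delta> (\<lambda>q. v q + d q) = \<delta> v + \<delta> d"
    using \<delta> s(1) u(2) unfolding alpha_tangent_def by blast
  moreover have "(\<lambda>q. v q + d q) = u" by (simp add: d_def)
  ultimately show ?thesis by simp
qed

lemma alpha_tangent_fold_derivation:
  assumes \<kappa>: "R > 0" "\<kappa> > - 1 / R\<^sup>2" and \<delta>: "\<delta> \<in> alpha_tangent \<kappa> R (bd \<kappa> R s)"
  shows "fold_derivation s (\<lambda>G. \<delta> (lift_bd \<kappa> R G))"
  unfolding fold_derivation_def
proof (intro allI impI)
  fix G H :: "real \<times> real \<Rightarrow> real" assume G: "fold_invariant G" and H: "fold_invariant H"
  have lift: "lift_bd \<kappa> R (\<lambda>s. G s + H s) = (\<lambda>q. lift_bd \<kappa> R G q + lift_bd \<kappa> R H q)"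
    "lift_bd \<kappa> R (\<lambda>s. c * G s) = (\<lambda>q. c * lift_bd \<kappa> R G q)"
    "lift_bd \<kappa> R (\<lambda>s. G s * H s) = (\<lambda>q. lift_bd \<kappa> R G q * lift_bd \<kappa> R H q)" for c
    by (simp_all add: lift_bd_def fun_eq_iff)
  have s: "alpha_smooth \<kappa> R (lift_bd \<kappa> R G)" "alpha_smooth \<kappa> R (lift_bd \<kappa> R H)"
    by (rule alpha_smooth_lift_bd[OF \<kappa>], fact)+
  show "\<delta> (lift_bd \<kappa> R (\<lambda>s. G s + H s)) = \<delta> (lift_bd \<kappa> R G) + \<delta> (lift_bd \<kappa> R H) \<and>
    (\<forall>c. \<delta> (lift_bd \<kappa> R (\<lambda>s. c * G s)) = c * \<delta> (lift_bd \<kappa> R G)) \<and>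
    \<delta> (lift_bd \<kappa> R (\<lambda>s. G s * H s)) = \<delta> (lift_bd \<kappa> R G) * H s + G s * \<delta> (lift_bd \<kappa> R H)"
    using \<delta> s unfolding lift alpha_tangent_def mem_Collect_eq
    by (simp add: lift_bd_bd[OF \<kappa>(1)] G H)
qed

text \<open>Transfers the evaluation of a derivation to fold-invariant functions: the lift of the
  invariant extension agrees with \<open>u\<close> on the influx set.\<close>

lemma alpha_tangent_lift:
  assumes \<kappa>: "R > 0" "\<kappa> > - 1 / R\<^sup>2" and p: "p \<in> influx \<kappa> R" and \<delta>: "\<delta> \<in> alpha_tangent \<kappa> R p"
    and u: "alpha_smooth \<kappa> R u"
  shows "\<delta> u = \<delta> (lift_bd \<kappa> R (\<lambda>s. scattering_ext \<kappa> R u (bd \<kappa> R s)))"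
proof (rule alpha_tangent_cong[OF \<kappa> p \<delta> u])
  have fi: "fold_invariant (\<lambda>s. scattering_ext \<kappa> R u (bd \<kappa> R s))"
    by (rule alpha_smooth_fold_invariant[OF \<kappa> u])
  show "alpha_smooth \<kappa> R (lift_bd \<kappa> R (\<lambda>s. scattering_ext \<kappa> R u (bd \<kappa> R s)))"
    by (rule alpha_smooth_lift_bd[OF \<kappa> fi])
  fix q assume q: "q \<in> influx \<kappa> R"
  then have "q \<in> bdry_SM R" by (simp add: influx_def)
  then obtain x t where "q = bd \<kappa> R (x, t)" using bdry_cases[OF \<kappa>(1)] by metis
  then show "u q = lift_bd \<kappa> R (\<lambda>s. scattering_ext \<kappa> R u (bd \<kappa> R s)) q"
    using q by (simp add: lift_bd_bd[OF \<kappa>(1) fi]) (simp add: scattering_ext_def)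
qed

lemma fold_invariant_bd:
  fixes w :: "complex \<times> complex \<Rightarrow> 'b::real_normed_vector"
  assumes \<kappa>: "R > 0" "\<kappa> > - 1 / R\<^sup>2" and w: "fold_invariant (\<lambda>s. w (bd \<kappa> R s))"
  shows "scattering_ext \<kappa> R w (bd \<kappa> R s) = w (bd \<kappa> R s)" "alpha_smooth \<kappa> R w"
proof -
  show *: "scattering_ext \<kappa> R w (bd \<kappa> R s) = w (bd \<kappa> R s)" for s
    by (cases s) (auto simp: scattering_ext_bd[OF \<kappa>] intro: fold_invariantD(2)[OF w])
  show "alpha_smooth \<kappa> R w"
    unfolding alpha_smooth_def by (rule smooth_on_bdryI[OF \<kappa>(1) fold_invariantD(1)[OF w] *])
qed

section \<open>The blow-down map on the quotient\<close>

lemma fold_invariant_blow: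
  assumes "bounded_linear f"
  shows "fold_invariant (\<lambda>s. f (blow \<kappa> (bd \<kappa> R s)))"
proof (rule fold_invariantI)
  have "Ck_on k (\<lambda>s. blow \<kappa> (bd \<kappa> R s)) UNIV" for k
    by (rule Ck_on_compose[OF open_UNIV open_UNIV _ Ck_on_bd Ck_on_blow[OF open_UNIV]]) simp
  then show "Ck_on k (\<lambda>s. f (blow \<kappa> (bd \<kappa> R s))) UNIV" for k
    by (rule Ck_on_bounded_linear[OF assms open_UNIV])
qed (simp add: blow_bd)

text \<open>Product and chain rule for \<open>w = 2 * \<i> * R * sin x * \<xi>\<close> and
  \<open>\<xi> = exp (\<kappa> * R^2 * (sin x)^2) * cis t\<close>, with \<open>A\<close> and
  \<open>B\<close> in the roles of the differentials of \<open>sin x\<close> and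
  \<open>t\<close>.\<close>

lemma alpha_differential_blow:
  assumes \<kappa>: "R > 0" "\<kappa> > - 1 / R\<^sup>2" and p: "bd \<kappa> R (x, t) \<in> influx \<kappa> R"
    and \<delta>: "\<delta> \<in> alpha_tangent \<kappa> R (bd \<kappa> R (x, t))"
  defines "A \<equiv> complex_of_real (\<delta> (lift_bd \<kappa> R (\<lambda>s. sin (fst s))))"
    and "B \<equiv> complex_of_real (\<delta> (lift_bd \<kappa> R (\<lambda>s. sin (snd s - t))))"
    and "\<xi> \<equiv> snd (blow \<kappa> (bd \<kappa> R (x, t)))"
  shows "alpha_differential (blow \<kappa>) \<delta> =
    (2 * \<i> * R * (A * \<xi> + of_real (sin x) * (\<xi> * (A * of_real (2 * \<kappa> * R\<^sup>2 * sin x) + \<i> * B))),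
     \<xi> * (A * of_real (2 * \<kappa> * R\<^sup>2 * sin x) + \<i> * B))"
proof -
  note D = alpha_tangent_fold_derivation[OF \<kappa> \<delta>]
  define e where "e = exp (\<kappa> * R\<^sup>2 * (sin x)\<^sup>2)"
  have \<xi>: "\<xi> = of_real e * cis t" by (simp add: \<xi>_def blow_bd e_def)
  have lin: "bounded_linear (\<lambda>q :: complex \<times> complex. Re (fst q))" "bounded_linear (\<lambda>q :: complex \<times> complex. Im (fst q))"
    "bounded_linear (\<lambda>q :: complex \<times> complex. Re (snd q))" "bounded_linear (\<lambda>q :: complex \<times> complex. Im (snd q))"
    by (intro bounded_linear_compose[OF bounded_linear_Re] bounded_linear_compose[OF bounded_linear_Im]
        bounded_linear_fst bounded_linear_snd)+
  have lift: "\<delta> (\<lambda>q. f (blow \<kappa> q)) = \<delta> (lift_bd \<kappa> R (\<lambda>s. f (blow \<kappa> (bd \<kappa> R s))))"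
    if "bounded_linear f" for f :: "complex \<times> complex \<Rightarrow> real"
    using alpha_tangent_lift[OF \<kappa> p \<delta> fold_invariant_bd(2)[OF \<kappa> fold_invariant_blow[OF that]]]
    unfolding fold_invariant_bd(1)[OF \<kappa> fold_invariant_blow[OF that]] .
  define f where "f y = exp (\<kappa> * R\<^sup>2 * y\<^sup>2)" for y :: real
  have f: "(f has_real_derivative 2 * \<kappa> * R\<^sup>2 * y * f y) (at y)" for y
    unfolding f_def by (auto intro!: derivative_eq_intros)
  have f2: "((\<lambda>y. of_real (f y) :: complex) has_vector_derivative of_real (2 * \<kappa> * R\<^sup>2 * sin x * f (sin x))) (at (sin x))"
    by (rule has_vector_derivative_of_real[OF f])
  have "((\<lambda>y. R * y * f y) has_real_derivative R * f (sin x) + R * sin x * (2 * \<kappa> * R\<^sup>2 * sin x * f (sin x))) (at (sin x))"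
    by (auto intro!: derivative_eq_intros f)
  then have f1: "((\<lambda>y. 2 * \<i> * of_real (R * y * f y)) has_vector_derivative
      2 * \<i> * of_real (R * f (sin x) + R * sin x * (2 * \<kappa> * R\<^sup>2 * sin x * f (sin x)))) (at (sin x))"
    by (intro has_vector_derivative_mult_right has_vector_derivative_of_real)
  have "alpha_differential (blow \<kappa>) \<delta> =
    (A * (2 * \<i> * of_real (R * f (sin x) + R * sin x * (2 * \<kappa> * R\<^sup>2 * sin x * f (sin x))) * cis t)
       + B * (\<i> * (2 * \<i> * of_real (R * sin x * f (sin x))) * cis t),
     A * (of_real (2 * \<kappa> * R\<^sup>2 * sin x * f (sin x)) * cis t) + B * (\<i> * of_real (f (sin x)) * cis t))"
    unfolding alpha_differential_def lin[THEN lift] A_def B_def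
  proof (intro prod.inject[THEN iffD2] conjI)
    show "Complex (\<delta> (lift_bd \<kappa> R (\<lambda>s. Re (fst (blow \<kappa> (bd \<kappa> R s)))))) (\<delta> (lift_bd \<kappa> R (\<lambda>s. Im (fst (blow \<kappa> (bd \<kappa> R s)))))) =
      \<delta> (lift_bd \<kappa> R (\<lambda>s. sin (fst s))) * (2 * \<i> * of_real (R * f (sin x) + R * sin x * (2 * \<kappa> * R\<^sup>2 * sin x * f (sin x))) * cis t)
       + \<delta> (lift_bd \<kappa> R (\<lambda>s. sin (snd s - t))) * (\<i> * (2 * \<i> * of_real (R * sin x * f (sin x))) * cis t)"
      by (rule fold_derivation_complex[OF D _ _ _ f1]) (auto intro: fold_invariant_blow lin simp: blow_bd f_def)
    show "Complex (\<delta> (lift_bd \<kappa> R (\<lambda>s. Re (snd (blow \<kappa> (bd \<kappa> R s)))))) (\<delta> (lift_bd \<kappa> R (\<lambda>s. Im (snd (blow \<kappa> (bd \<kappa> R s)))))) =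
      \<delta> (lift_bd \<kappa> R (\<lambda>s. sin (fst s))) * (of_real (2 * \<kappa> * R\<^sup>2 * sin x * f (sin x)) * cis t)
       + \<delta> (lift_bd \<kappa> R (\<lambda>s. sin (snd s - t))) * (\<i> * of_real (f (sin x)) * cis t)"
      by (rule fold_derivation_complex[OF D _ _ _ f2]) (auto intro: fold_invariant_blow lin simp: blow_bd f_def)
  qed
  moreover have "f (sin x) = e" by (simp add: f_def e_def)
  ultimately show ?thesis unfolding \<xi> by (simp add: algebra_simps)
qed

lemma blow_bd_nonzero: "snd (blow \<kappa> (bd \<kappa> R (x, t))) \<noteq> 0"
  by (simp add: blow_bd)

lemma influx_cases:
  assumes "R > 0" "p \<in> influx \<kappa> R"
  obtains x t where "p = bd \<kappa> R (x, t)"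
proof -
  have "p \<in> bdry_SM R" using assms(2) by (simp add: influx_def)
  then show ?thesis using bdry_cases[OF assms(1)] that by blast
qed

text \<open>On the compact influx set it remains to check injectivity: \<open>w / \<xi>\<close>
  gives \<open>sin x\<close>, the influx condition \<open>cos x \<le> 0\<close> then fixes the
  cosine, and \<xi> gives \<open>cis t\<close>.\<close>

lemma influx_homeomorphism:
  assumes \<kappa>: "R > 0" "\<kappa> > - 1 / R\<^sup>2"
  shows "\<exists>g. homeomorphism (influx \<kappa> R) (blow \<kappa> ` influx \<kappa> R) (blow \<kappa>) g"
proof (rule homeomorphism_compact)
  have "influx \<kappa> R \<subseteq> bdry_SM R" by (auto simp: influx_def)
  then have "influx \<kappa> R = bdry_SM R \<inter> {p. fst p \<bullet> snd p \<le> 0}"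
    using flux_iff(1)[OF \<kappa>] by auto
  moreover have "closed {p :: complex \<times> complex. fst p \<bullet> snd p \<le> 0}"
    by (intro closed_Collect_le continuous_intros)
  moreover have "compact (bdry_SM R)" unfolding bdry_SM_def by (intro compact_Times compact_sphere)
  ultimately show "compact (influx \<kappa> R)" by (simp add: compact_Int_closed)
  show "continuous_on (influx \<kappa> R) (blow \<kappa>)"
    using Ck_on_imp_continuous[OF Ck_on_blow[OF open_UNIV]] continuous_on_subset by blast
  show "inj_on (blow \<kappa>) (influx \<kappa> R)"
  proof (rule inj_onI)
    fix p p' assume p: "p \<in> influx \<kappa> R" "p' \<in> influx \<kappa> R" and eq: "blow \<kappa> p = blow \<kappa> p'"
    obtain x t where b1: "p = bd \<kappa> R (x, t)" by (rule influx_cases[OF \<kappa>(1) p(1)])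
    obtain x' t' where b2: "p' = bd \<kappa> R (x', t')" by (rule influx_cases[OF \<kappa>(1) p(2)])
    note b = b1 b2
    have f: "fst (blow \<kappa> (bd \<kappa> R (x, t))) = 2 * \<i> * of_real (R * sin x) * snd (blow \<kappa> (bd \<kappa> R (x, t)))" for x t
      by (simp add: blow_bd)
    have "2 * \<i> * of_real (R * sin x) * snd (blow \<kappa> p) = 2 * \<i> * of_real (R * sin x') * snd (blow \<kappa> p)"
      using f[of x t] f[of x' t'] eq unfolding b by argo
    then have s: "sin x = sin x'" using blow_bd_nonzero[of \<kappa> R x t] \<kappa>(1) by (simp add: b)
    have "cos x \<le> 0" "cos x' \<le> 0" using p by (simp_all add: b bd_flux[OF \<kappa>])
    moreover have "(cos x)\<^sup>2 = (cos x')\<^sup>2" using s by (simp add: cos_squared_eq)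
    then have "cos x = cos x' \<or> cos x = - cos x'" by (simp add: power2_eq_iff)
    ultimately have "cis x = cis x'" using s by (auto simp: complex_eq_iff)
    moreover have "cis t = cis t'" using eq s by (simp add: b blow_bd)
    ultimately show "p = p'" unfolding b by (rule bd_cong)
  qed
qed simp

text \<open>The combination \<open>dw - 2 * \<i> * R * sin x * d\<xi>\<close> equals
  \<open>2 * \<i> * R * A * \<xi>\<close>, which isolates the real number \<open>A\<close>; then
  \<open>d\<xi>\<close> yields \<open>B\<close>. So a vanishing differential has
  \<open>A = B = 0\<close>. A vector in \<open>P\<close> and \<open>\<i> P\<close> gives
  \<open>A = \<i> * A'\<close> with real \<open>A, A'\<close>, hence both zero, and likewise for
  \<open>B\<close>.\<close>

lemma totally_real_blow:
  assumes \<kappa>: "R > 0" "\<kappa> > - 1 / R\<^sup>2"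
  shows "totally_real_alpha_embedding \<kappa> R (blow \<kappa>)"
  unfolding totally_real_alpha_embedding_def
proof (intro conjI ballI impI allI influx_homeomorphism[OF \<kappa>])
  show "alpha_smooth \<kappa> R (blow \<kappa>)"
    using fold_invariant_bd(2)[OF \<kappa> fold_invariant_blow[OF bounded_linear_ident]] .
next
  fix p \<delta> and u :: "complex \<times> complex \<Rightarrow> real"
  assume p: "p \<in> influx \<kappa> R" and \<delta>: "\<delta> \<in> alpha_tangent \<kappa> R p"
    and zero: "alpha_differential (blow \<kappa>) \<delta> = 0" and u: "alpha_smooth \<kappa> R u"
  obtain x t where b: "p = bd \<kappa> R (x, t)" by (rule influx_cases[OF \<kappa>(1) p])
  define A B where "A = \<delta> (lift_bd \<kappa> R (\<lambda>s. sin (fst s)))" and "B = \<delta> (lift_bd \<kappa> R (\<lambda>s. sin (snd s - t)))"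
  note dw = alpha_differential_blow[OF \<kappa> p[unfolded b] \<delta>[unfolded b], folded A_def B_def]
  have 2: "of_real A * of_real (2 * \<kappa> * R\<^sup>2 * sin x) + \<i> * of_real B = 0"
    using dw zero blow_bd_nonzero[of \<kappa> R x t] by (simp add: zero_prod_def)
  then have "fst (alpha_differential (blow \<kappa>) \<delta>) = 2 * \<i> * R * (of_real A * snd (blow \<kappa> (bd \<kappa> R (x, t))))"
    unfolding dw by simp
  then have A: "A = 0" using zero \<kappa>(1) blow_bd_nonzero[of \<kappa> R x t] by (simp add: zero_prod_def)
  then have B: "B = 0" using 2 by simp
  define v where "v = (\<lambda>s. scattering_ext \<kappa> R u (bd \<kappa> R s))"
  have v: "fold_invariant v" unfolding v_def by (rule alpha_smooth_fold_invariant[OF \<kappa> u])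
  obtain g where g: "fold_invariant g" "\<And>y s. v (y, s) - v (x, s) = (sin y - sin x) * g (y, s)"
    using fold_division[OF v, of x] by metis
  have "((\<lambda>s. (x, s)) has_derivative (\<lambda>h. (0, h))) (at t)" by (auto intro!: derivative_eq_intros)
  from has_derivative_compose[OF this Ck_on_SucD[OF fold_invariantD(1)[OF v, of "Suc 0"]]]
  obtain c where c: "((\<lambda>s. v (x, s)) has_real_derivative c) (at t)"
    using differentiableI real_differentiable_def by blast
  have "\<delta> u = \<delta> (lift_bd \<kappa> R v)" unfolding v_def by (rule alpha_tangent_lift[OF \<kappa> p \<delta> u])
  also have "\<dots> = A * g (x, t) + B * c"
    unfolding A_def B_def
    by (rule fold_derivation_expand[OF alpha_tangent_fold_derivation[OF \<kappa> \<delta>[unfolded b]] v g c])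
  finally show "\<delta> u = 0" by (simp add: A B)
next
  fix p assume p: "p \<in> influx \<kappa> R"
  obtain x t where b: "p = bd \<kappa> R (x, t)" by (rule influx_cases[OF \<kappa>(1) p])
  let ?P = "alpha_differential (blow \<kappa>) ` alpha_tangent \<kappa> R p" and ?J = "cplx_struct_std (blow \<kappa> p)"
  define \<xi> where "\<xi> = snd (blow \<kappa> (bd \<kappa> R (x, t)))"
  have \<xi>: "\<xi> \<noteq> 0" unfolding \<xi>_def by (rule blow_bd_nonzero)
  define k where "k = 2 * \<kappa> * R\<^sup>2 * sin x"
  define V where "V A B = (2 * \<i> * R * (of_real A * \<xi> + of_real (sin x) * (\<xi> * (of_real A * of_real k + \<i> * of_real B))),
     \<xi> * (of_real A * of_real k + \<i> * of_real B))" for A B :: real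
  have sub: "\<exists>A B. e = V A B" if "e \<in> ?P" for e
    using that alpha_differential_blow[OF \<kappa> p[unfolded b]] unfolding b V_def \<xi>_def k_def by blast
  have zero: "(\<lambda>u. 0) \<in> alpha_tangent \<kappa> R p" by (simp add: alpha_tangent_def)
  have "alpha_differential (blow \<kappa>) (\<lambda>u. 0) = 0"
    by (simp add: alpha_differential_def zero_prod_def complex_eq_iff)
  then have 0: "0 \<in> ?P" using zero by (metis imageI)
  have J0: "?J 0 = 0" by (simp add: cplx_struct_std_def zero_prod_def)
  have "?P \<inter> ?J ` ?P = {0}"
  proof
    show "{0} \<subseteq> ?P \<inter> ?J ` ?P" using 0 J0 by (metis IntI empty_subsetI imageI insert_subset)
    show "?P \<inter> ?J ` ?P \<subseteq> {0}"
    proof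
      fix e assume "e \<in> ?P \<inter> ?J ` ?P"
      then obtain e' where e: "e \<in> ?P" "e' \<in> ?P" "e = ?J e'" by blast
      obtain A B A' B' where V: "e = V A B" "e' = V A' B'" using sub e by metis
      have 2: "\<xi> * (of_real A * of_real k + \<i> * of_real B) = \<i> * (\<xi> * (of_real A' * of_real k + \<i> * of_real B'))"
        using e(3) by (simp add: V V_def cplx_struct_std_def)
      have "2 * \<i> * R * (of_real A * \<xi> + of_real (sin x) * (\<xi> * (of_real A * of_real k + \<i> * of_real B))) =
        \<i> * (2 * \<i> * R * (of_real A' * \<xi> + of_real (sin x) * (\<xi> * (of_real A' * of_real k + \<i> * of_real B'))))"
        using e(3) by (simp add: V V_def cplx_struct_std_def)
      \<comment> \<open>The relation \<open>2\<close> between the \<xi>-components cancels the terms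
        containing \<open>sin x\<close>.\<close>
      then have "2 * \<i> * R * \<xi> * of_real A = 2 * \<i> * R * \<xi> * (\<i> * of_real A')"
        unfolding 2 by (simp add: algebra_simps)
      then have "of_real A = \<i> * of_real A'" using \<xi> \<kappa>(1) by simp
      then have A: "A = 0" "A' = 0" by (auto simp: complex_eq_iff)
      have "\<xi> * (\<i> * of_real B) = \<xi> * (- of_real B')" using 2 by (simp add: A algebra_simps)
      then have "\<i> * of_real B = - of_real B'" using \<xi> by (simp only: mult_cancel_left) simp
      then have B: "B = 0" by (auto simp: complex_eq_iff)
      show "e \<in> {0}" by (simp add: V V_def A B zero_prod_def)
    qed
  qed
  then show "let P = ?P in P \<inter> ?J ` P = {0}" by (simp add: Let_def)
qed

theorem theorem1:
  fixes R \<kappa> :: real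
  assumes "R > 0" and "\<kappa> > - 1 / R\<^sup>2"
  shows "holomorphic_blow_down \<kappa> R
    (\<lambda>(z, \<nu>).
       ((z - cnj z * \<nu>\<^sup>2) * exp (\<kappa> * (z * cnj z - (cnj z)\<^sup>2 * \<nu>\<^sup>2) / 2),
        \<nu> * exp (\<kappa> * (z * cnj z - (cnj z)\<^sup>2 * \<nu>\<^sup>2) / 2)))"
proof -
  have "(\<lambda>(z, \<nu>).
       ((z - cnj z * \<nu>\<^sup>2) * exp (\<kappa> * (z * cnj z - (cnj z)\<^sup>2 * \<nu>\<^sup>2) / 2),
        \<nu> * exp (\<kappa> * (z * cnj z - (cnj z)\<^sup>2 * \<nu>\<^sup>2) / 2))) = blow \<kappa>"
    by (simp add: blow_def blow_E_def)
  moreover have "smooth_on (Z_space R) (blow \<kappa>)"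
    unfolding smooth_on_def using Ck_on_blow[OF open_UNIV] by blast
  ultimately show ?thesis
    unfolding holomorphic_blow_down_def
    using totally_real_blow[OF assms] biholo_blow[OF assms] coercive_pullback_blow[OF assms] by simp
qed

end
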